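(* Let $s\ge0$. There is a constant $C>0$, independent of $h$, such that for every $0<h\le1$ with $h=\pi/N$, $N\in\mathbb N$, each choice of sign $\pm$, and all $u_h^\pm,v_h^\pm\in X_{h,\pm}^{s,\frac12}$ with mean zero (that is, $\sum_{x\in\mathbb T_h}u_h^\pm(t,x)=\sum_{x\in\mathbb T_h}v_h^\pm(t,x)=0$ for all $t$), $$\left\|\nabla_h(u_h^\pm v_h^\pm)\right\|_{Z_{h,\pm}^s}\le C\,\|u_h^\pm\|_{X_{h,\pm}^{s,\frac12}}\|v_h^\pm\|_{X_{h,\pm}^{s,\frac12}}.$$
   Context: $\mathbb T_h=h\mathbb Z/2\pi\mathbb Z=\{hn:n=-N,\dots,N-1\}$ with $h=\pi/N$, $(\mathbb T_h)^*=\mathbb Z/2N\mathbb Z=\{-N,\dots,N-1\}$. $\nabla_h$ is the Fourier multiplier on $\mathbb T_h$ with symbol $\frac{2i}h\sin(\frac{hk}2)$, $k\in\{-N,\dots,N-1\}$. The space-time Fourier transform of $u_h$ on $\mathbb R\times\mathbb T_h$ is $\widetilde{u_h}(\tau,k)=\frac h{2\pi}\sum_{x\in\mathbb T_h}\int_{\mathbb R}e^{-it\tau}e^{-ixk}u_h(t,x)\,dt$. Let $\langle a\rangle=(1+a^2)^{1/2}$ and $s_h(k)=\frac1{h^2}\big(k-\frac2h\sin(\frac{hk}2)\big)$. The space $X_{h,\pm}^{s,b}$ is the completion of the functions that are Schwartz in $t$ with respect to $$\|u_h\|_{X_{h,\pm}^{s,b}}^2=\sum_{k\in(\mathbb T_h)^*}\int_{\mathbb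 R}\langle k\rangle^{2s}\langle\tau\mp s_h(k)\rangle^{2b}|\widetilde{u_h}(\tau,k)|^2\,d\tau,$$ and $$\|u_h\|_{Z_{h,\pm}^s}=\|u_h\|_{X_{h,\pm}^{s,-\frac12}}+\left\|\langle k\rangle^s\langle\tau\mp s_h(k)\rangle^{-1}\widetilde{u_h}(\tau,k)\right\|_{\ell^2_{k\in(\mathbb T_h)^*}L^1_\tau(\mathbb R)}.$$ *)

theory Defs
  imports "HOL-Analysis.Analysis"
begin

(* Everything is indexed by the natural number N, the mesh size being h = pi / N.
   A function on the discrete torus hZ / 2 pi Z is a function on the set of
   representatives {h n | n = -N, ..., N-1}; its values elsewhere are never used.  Likewise
   the dual group Z / 2N Z is represented by {-N, ..., N-1}.  The symbols below are not
   2N-periodic in k, so this choice of representatives matters. *)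

definition mesh :: "nat \<Rightarrow> real"
  where "mesh N = pi / real N"

definition dtorus :: "nat \<Rightarrow> real set"
  where "dtorus N = (\<lambda>n::int. mesh N * of_int n) ` {- int N..<int N}"

definition dfreq :: "nat \<Rightarrow> int set"
  where "dfreq N = {- int N..<int N}"

(* With this normalisation f x = (SUM k:dfreq N. cis (k * x) * dfourier N f k) on dtorus N. *)
definition dfourier :: "nat \<Rightarrow> (real \<Rightarrow> complex) \<Rightarrow> int \<Rightarrow> complex"
  where "dfourier N f k =
    of_real (mesh N / (2 * pi)) * (\<Sum>x\<in>dtorus N. cis (- (x * of_int k)) * f x)"

definition dnabla :: "nat \<Rightarrow> (real \<Rightarrow> complex) \<Rightarrow> real \<Rightarrow> complex"
  where "dnabla N f x =
    (\<Sum>k\<in>dfreq N. (2 * \<i> / of_real (mesh N)) * of_real (sin (mesh N * of_int k / 2))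
                   * dfourier N f k * cis (of_int k * x))"

definition stfourier :: "nat \<Rightarrow> (real \<Rightarrow> real \<Rightarrow> complex) \<Rightarrow> real \<Rightarrow> int \<Rightarrow> complex"
  where "stfourier N u \<tau> k =
    of_real (mesh N / (2 * pi)) *
      (\<Sum>x\<in>dtorus N. \<integral>t. cis (- (t * \<tau>)) * cis (- (x * of_int k)) * u t x \<partial>lborel)"

definition jbracket :: "real \<Rightarrow> real"
  where "jbracket a = (1 + a\<^sup>2) powr (1 / 2)"

definition dphase :: "nat \<Rightarrow> int \<Rightarrow> real"
  where "dphase N k =
    (1 / (mesh N)\<^sup>2) * (of_int k - (2 / mesh N) * sin (mesh N * of_int k / 2))"

definition schwartz :: "(real \<Rightarrow> complex) \<Rightarrow> bool"
  where "schwartz f \<longleftrightarrow> (\<exists>D :: nat \<Rightarrow> real \<Rightarrow> complex. D 0 = f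
    \<and> (\<forall>n t. (D n has_vector_derivative D (Suc n) t) (at t))
    \<and> (\<forall>m n. bounded (range (\<lambda>t. t ^ m *\<^sub>R D n t))))"

definition schwartz_in_time :: "nat \<Rightarrow> (real \<Rightarrow> real \<Rightarrow> complex) \<Rightarrow> bool"
  where "schwartz_in_time N u \<longleftrightarrow> (\<forall>x\<in>dtorus N. schwartz (\<lambda>t. u t x))"

definition esqrt :: "ennreal \<Rightarrow> ennreal"
  where "esqrt a = (if a = top then top else ennreal (sqrt (enn2real a)))"

(* The sign choice is a real number sg, either 1 or -1.

   This is the X norm written through the classical Fourier integral; it is used only
   for functions that are integrable in time, for which that integral is meaningful. *)
definition bourgain_norm ::
    "nat \<Rightarrow> real \<Rightarrow> real \<Rightarrow> real \<Rightarrow> (real \<Rightarrow> real \<Rightarrow> complex) \<Rightarrow> ennreal"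
  where "bourgain_norm N sg s b u = esqrt (\<Sum>k\<in>dfreq N. \<integral>\<^sup>+\<tau>. ennreal
      (jbracket (of_int k) powr (2 * s) * jbracket (\<tau> - sg * dphase N k) powr (2 * b)
        * (cmod (stfourier N u \<tau> k))\<^sup>2) \<partial>lborel)"

(* Completion of the functions that are Schwartz in time, for b >= 0.  Then the X norm
   controls the L2 norm and the completion embeds into L2(R x dtorus N), so an element
   is a function u that is the L2 limit of an X-Cauchy sequence of Schwartz
   functions.  Such a u is a representative, determined up to null sets in t. *)
definition X_approx :: "nat \<Rightarrow> real \<Rightarrow> real \<Rightarrow> real
    \<Rightarrow> (nat \<Rightarrow> real \<Rightarrow> real \<Rightarrow> complex) \<Rightarrow> (real \<Rightarrow> real \<Rightarrow> complex) \<Rightarrow> bool"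
  where "X_approx N sg s b \<phi> u \<longleftrightarrow>
    (\<forall>n. schwartz_in_time N (\<phi> n))
    \<and> (\<forall>e>0. \<exists>M. \<forall>m\<ge>M. \<forall>n\<ge>M.
          bourgain_norm N sg s b (\<lambda>t x. \<phi> m t x - \<phi> n t x) < ennreal e)
    \<and> (\<forall>x\<in>dtorus N. (\<lambda>t. u t x) \<in> borel_measurable lborel
        \<and> (\<lambda>n. \<integral>\<^sup>+t. ennreal ((cmod (\<phi> n t x - u t x))\<^sup>2) \<partial>lborel) \<longlonglongrightarrow> 0)"

definition X_space :: "nat \<Rightarrow> real \<Rightarrow> real \<Rightarrow> real \<Rightarrow> (real \<Rightarrow> real \<Rightarrow> complex) set"
  where "X_space N sg s b = {u. \<exists>\<phi>. X_approx N sg s b \<phi> u}"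

(* The completion norm is the limit of the norms along an approximating sequence.  The
   limit exists and does not depend on the sequence, so on X_space the infimum is over a
   singleton; off X_space it is infinite. *)
definition X_norm ::
    "nat \<Rightarrow> real \<Rightarrow> real \<Rightarrow> real \<Rightarrow> (real \<Rightarrow> real \<Rightarrow> complex) \<Rightarrow> ennreal"
  where "X_norm N sg s b u =
    Inf {L. \<exists>\<phi>. X_approx N sg s b \<phi> u \<and> (\<lambda>n. bourgain_norm N sg s b (\<phi> n)) \<longlonglongrightarrow> L}"

(* The Z norm of a function integrable in time, whose Fourier transform is the classical
   integral.  A function that is not integrable gets the value infinity, because its
   Bochner integral would be the default value 0 and an upper bound could then hold
   vacuously. *)
definition Z_norm :: "nat \<Rightarrow> real \<Rightarrow> real \<Rightarrow> (real \<Rightarrow> real \<Rightarrow> complex) \<Rightarrow> ennreal"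
  where "Z_norm N sg s u =
    (if \<forall>x\<in>dtorus N. integrable lborel (\<lambda>t. u t x) then
       bourgain_norm N sg s (- 1 / 2) u
       + esqrt (\<Sum>k\<in>dfreq N. (\<integral>\<^sup>+\<tau>. ennreal (cmod (of_real
            (jbracket (of_int k) powr s * jbracket (\<tau> - sg * dphase N k) powr (- 1))
              * stfourier N u \<tau> k)) \<partial>lborel)\<^sup>2)
     else top)"

end

theory Submission
  imports Defs "HOL-Probability.Characteristic_Functions"
begin

text \<open>
  On the Fourier side the product becomes a convolution over \<open>k1 + k2 = k (mod 2N)\<close>. With
  \<open>\<sigma>\<close>, \<open>\<sigma>1\<close>, \<open>\<sigma>2\<close> the modulations at the three frequencies, \<open>\<sigma> - \<sigma>1 - \<sigma>2\<close> is the resonance function,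
  whose modulus dominates \<open>|k k1 k2|\<close>: without aliasing it is a product of three sines, with
  aliasing it is at least \<open>(2 pi - 6) / h^3\<close>. Hence one of the brackets of the modulations
  absorbs the derivative. What remains is estimated by Cauchy--Schwarz and by
  \<open>\<Sum>j. <A - s(j) - s(K - j)>^(-3/4) \<le> C\<close> for \<open>K \<noteq> 0\<close>, which holds because \<open>j \<mapsto> s(j) + s(K - j)\<close>
  separates the integers on either side of \<open>K / 2\<close> quadratically. When the output modulation
  dominates, the \<open>l2 L1\<close> part of the \<open>Z\<close> norm is bounded by spending a small power of that
  modulation on both inputs, which makes them integrable in \<open>\<tau>\<close>.

  This proves the estimate for Schwartz functions; it passes to the completion by Fatou's
  lemma. The approximants need not have mean zero, but since the limits do, the interactions
  involving the zero mode can be dropped before the limit is taken.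
\<close>

section \<open>Japanese brackets\<close>

text \<open>All exponents follow from 9/8, the power at which brackets are integrated in time
  frequency. The L1 weight splits as 1 = 9/16 + 7/16: the square of the first part is integrable, so
  Cauchy-Schwarz turns an L1 bound into an L2 bound with weight -7/16, and the input-dominant
  estimate is proved with that weight to serve both halves of the Z norm. Its squared kernel decays
  like 7/8 + 1 = 9/8 + 3/4, which leaves 3/4 for the sum over frequencies. If the output modulation
  dominates, the derivative costs the power 1/2 of it, and the remaining weight -1/2 misses square
  integrability by a logarithm; this is why 1/16 is moved to each input, whose weight 1/2 + 1/16 =
  9/16 again has an integrable square. Elements of the completion are only L2 in time, so their
  classical transforms need not exist. Products of two of them are integrable, and the transform of
  a product is at every point the limit of those of the approximants; the passage to the limit
  therefore handles products of modes and never the transform of a single factor.\<close>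

lemma jbracket_sqrt: "jbracket x = sqrt (1 + x\<^sup>2)"
  unfolding jbracket_def by (rule powr_half_sqrt) simp

lemma jbracket_ge_1: "1 \<le> jbracket x"
  by (simp add: jbracket_sqrt)

lemma jbracket_pos [simp]: "0 < jbracket x"
  using jbracket_ge_1[of x] by linarith

lemma jbracket_nonneg [simp]: "0 \<le> jbracket x"
  by (simp add: less_imp_le)

lemma jbracket_nonzero [simp]: "jbracket x \<noteq> 0"
  using jbracket_pos[of x] by linarith

lemma jbracket_minus [simp]: "jbracket (- x) = jbracket x"
  by (simp add: jbracket_sqrt)

lemma jbracket_ge_abs: "\<bar>x\<bar> \<le> jbracket x"
  by (simp add: jbracket_sqrt real_le_rsqrt)

lemma jbracket_add_le:
  assumes "\<bar>z\<bar> \<le> \<bar>x\<bar> + \<bar>y\<bar>"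
  shows "jbracket z \<le> jbracket x + jbracket y"
proof -
  have "z\<^sup>2 \<le> (\<bar>x\<bar> + \<bar>y\<bar>)\<^sup>2"
    using assms abs_ge_zero[of z] by (metis abs_le_square_iff abs_of_nonneg order_trans)
  moreover have "\<bar>x\<bar> * \<bar>y\<bar> \<le> jbracket x * jbracket y"
    by (intro mult_mono jbracket_ge_abs) auto
  moreover have "(jbracket x)\<^sup>2 = 1 + x\<^sup>2" "(jbracket y)\<^sup>2 = 1 + y\<^sup>2"
    by (simp_all add: jbracket_sqrt)
  ultimately have "1 + z\<^sup>2 \<le> (jbracket x + jbracket y)\<^sup>2"
    by (simp add: power2_sum)
  then show ?thesis
    by (simp add: jbracket_sqrt[of z] real_le_lsqrt)
qed

text \<open>Distributes the weight of order \<open>s\<close> over two factors. Only absolute values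
  are compared, so an aliased frequency, which is not the sum of the other two, is covered as
  well.\<close>

lemma jbracket_add_le_mult:
  assumes "\<bar>z\<bar> \<le> \<bar>x\<bar> + \<bar>y\<bar>"
  shows "jbracket z \<le> 2 * (jbracket x * jbracket y)"
proof -
  have "jbracket x * 1 \<le> jbracket x * jbracket y" "1 * jbracket y \<le> jbracket x * jbracket y"
    using mult_left_mono[OF jbracket_ge_1[of y], of "jbracket x"]
      mult_right_mono[OF jbracket_ge_1[of x], of "jbracket y"] by simp_all
  with jbracket_add_le[OF assms] show ?thesis
    by linarith
qed

lemma borel_measurable_jbracket [measurable]: "jbracket \<in> borel_measurable borel"
  unfolding jbracket_def by measurable

lemma powr_mono_nonpos: "0 < x \<Longrightarrow> x \<le> y \<Longrightarrow> a \<le> 0 \<Longrightarrow> y powr a \<le> (x::real) powr a"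
  by (cases "a = 0") (auto intro: powr_mono2')

lemma nn_integral_jbracket_powr_finite:
  "(\<integral>\<^sup>+x. ennreal (jbracket x powr (- (9/8))) \<partial>lborel) < \<infinity>"
proof -
  have A: "(\<integral>\<^sup>+x. ennreal (x powr (- (9/8))) * indicator {1..} x \<partial>lborel) = ennreal (0 - (- 8 * 1 powr (-(1/8))))"
  proof (rule nn_integral_FTC_atLeast[where F="\<lambda>x. - 8 * x powr (-(1/8))" and T=0])
    fix x :: real assume "1 \<le> x"
    then show "DERIV (\<lambda>x. - 8 * x powr (-(1/8))) x :> x powr (- (9/8))"
      by (auto intro!: derivative_eq_intros simp flip: powr_minus_divide)
  next
    have "((\<lambda>x::real. - 8 * x powr (-(1/8))) \<longlongrightarrow> - 8 * 0) at_top"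
      by (intro tendsto_intros tendsto_neg_powr filterlim_ident) auto
    then show "((\<lambda>x::real. - 8 * x powr (-(1/8))) \<longlongrightarrow> 0) at_top"
      by simp
  qed auto
  have B: "(\<integral>\<^sup>+x. ennreal ((-x) powr (- (9/8))) * indicator {..-1} x \<partial>lborel)
     = (\<integral>\<^sup>+x. ennreal (x powr (- (9/8))) * indicator {1..} x \<partial>lborel)"
    by (subst nn_integral_real_affine[where c="-1" and t=0])
       (auto intro!: nn_integral_cong split: split_indicator)
  have "(\<integral>\<^sup>+x. ennreal (jbracket x powr (- (9/8))) \<partial>lborel)
    \<le> (\<integral>\<^sup>+x. indicator {-1..1} x + (ennreal (x powr (- (9/8))) * indicator {1..} x
          + ennreal ((-x) powr (- (9/8))) * indicator {..-1} x) \<partial>lborel)"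
  proof (intro nn_integral_mono)
    fix x :: real
    consider "x \<in> {-1..1}" | "x > 1" | "x < -1" by fastforce
    then show "ennreal (jbracket x powr (- (9/8))) \<le> indicator {-1..1} x
       + (ennreal (x powr (- (9/8))) * indicator {1..} x
          + ennreal ((-x) powr (- (9/8))) * indicator {..-1} x)"
    proof cases
      case 1
      have "jbracket x powr (- (9/8)) \<le> 1"
        using powr_mono_nonpos[of 1 "jbracket x" "-(9/8)"] jbracket_ge_1 by simp
      then have "ennreal (jbracket x powr (- (9/8))) \<le> 1"
        by (simp add: ennreal_le_1)
      with 1 show ?thesis by (simp add: add_increasing2)
    next
      case 2
      have "jbracket x powr (- (9/8)) \<le> x powr (- (9/8))"
        using 2 jbracket_ge_abs[of x] by (intro powr_mono_nonpos) auto
      with 2 show ?thesis by (simp add: ennreal_leI)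
    next
      case 3
      have "jbracket x powr (- (9/8)) \<le> (-x) powr (- (9/8))"
        using 3 jbracket_ge_abs[of x] by (intro powr_mono_nonpos) auto
      with 3 show ?thesis by (simp add: ennreal_leI)
    qed
  qed
  also have "\<dots> = emeasure lborel {-1..1::real} + (ennreal 8 + ennreal 8)"
    using A B by (subst nn_integral_add, simp, simp, subst nn_integral_add) auto
  also have "\<dots> < \<infinity>"
    by simp
  finally show ?thesis .
qed

text \<open>The preceding lemma makes the integral finite, so \<open>enn2real\<close> loses
  nothing.\<close>

definition jbracket_mass :: real
  where "jbracket_mass = enn2real (\<integral>\<^sup>+x. ennreal (jbracket x powr (- (9/8))) \<partial>lborel)"

lemma jbracket_mass_nonneg [simp]: "0 \<le> jbracket_mass"
  by (simp add: jbracket_mass_def)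

lemma nn_integral_jbracket_shift:
  "(\<integral>\<^sup>+x. ennreal (jbracket (x - a) powr (- (9/8))) \<partial>lborel) = ennreal jbracket_mass"
proof -
  have "(\<integral>\<^sup>+x. ennreal (jbracket (x - a) powr (- (9/8))) \<partial>lborel)
     = (\<integral>\<^sup>+x. ennreal (jbracket x powr (- (9/8))) \<partial>lborel)"
    by (subst nn_integral_real_affine[where c=1 and t=a]) auto
  then show ?thesis
    using nn_integral_jbracket_powr_finite by (simp add: jbracket_mass_def)
qed

text \<open>The decay 7/8 + 1 is split as 3/4 + 9/8. Since \<open>X + Y \<ge> D\<close>, the larger
  bracket is at least \<open>D / 2\<close> and pays the exponent 3/4; what it has left is
  transferred to the smaller one, where the exponents add up to 9/8.\<close>

lemma jbracket_kernel_pointwise: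
  "jbracket (x - a) powr (-(7/8)) * jbracket (x - b) powr (- 1)
    \<le> 2 * jbracket (a - b) powr (-(3/4))
        * (jbracket (x - a) powr (-(9/8)) + jbracket (x - b) powr (-(9/8)))"
proof -
  define X Y D where "X = jbracket (x - a)" and "Y = jbracket (x - b)" and "D = jbracket (a - b)"
  have pos: "0 < X" "0 < Y" "0 < D" and D1: "1 \<le> D"
    by (auto simp: X_def Y_def D_def jbracket_ge_1)
  have D: "D \<le> X + Y"
    unfolding X_def Y_def D_def by (rule jbracket_add_le) simp
  have half: "M powr (-(3/4)) \<le> 2 * D powr (-(3/4))" if "D / 2 \<le> M" for M
  proof -
    have "M powr (-(3/4)) \<le> (D / 2) powr (-(3/4))"
      using that pos by (intro powr_mono_nonpos) auto
    also have "\<dots> = 2 powr (3/4) * D powr (-(3/4))"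
      using pos by (simp add: powr_divide powr_minus divide_simps)
    also have "\<dots> \<le> 2 powr 1 * D powr (-(3/4))"
      by (intro mult_right_mono powr_mono) auto
    finally show ?thesis by simp
  qed
  have "X powr (-(7/8)) * Y powr (- 1) \<le> 2 * D powr (-(3/4)) * (X powr (-(9/8)) + Y powr (-(9/8)))"
  proof (cases "Y \<le> X")
    case True
    have "X powr (-(7/8)) * Y powr (- 1) = X powr (-(3/4)) * (X powr (-(1/8)) * Y powr (- 1))"
      by (simp del: powr_neg_one' flip: powr_add mult.assoc)
    also have "\<dots> \<le> X powr (-(3/4)) * (Y powr (-(1/8)) * Y powr (- 1))"
      using True pos by (intro mult_left_mono mult_right_mono powr_mono_nonpos) auto
    also have "\<dots> = X powr (-(3/4)) * Y powr (-(9/8))"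
      by (simp del: powr_neg_one' flip: powr_add)
    also have "\<dots> \<le> (2 * D powr (-(3/4))) * (X powr (-(9/8)) + Y powr (-(9/8)))"
      using True D by (intro mult_mono half) auto
    finally show ?thesis .
  next
    case False
    have "X powr (-(7/8)) * Y powr (- 1) = Y powr (-(3/4)) * (Y powr (-(1/4)) * X powr (-(7/8)))"
      by (simp del: powr_neg_one' flip: powr_add mult.assoc)
    also have "\<dots> \<le> Y powr (-(3/4)) * (X powr (-(1/4)) * X powr (-(7/8)))"
      using False pos by (intro mult_left_mono mult_right_mono powr_mono_nonpos) auto
    also have "\<dots> = Y powr (-(3/4)) * X powr (-(9/8))"
      by (simp del: powr_neg_one' flip: powr_add)
    also have "\<dots> \<le> (2 * D powr (-(3/4))) * (X powr (-(9/8)) + Y powr (-(9/8)))"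
      using False D by (intro mult_mono half) auto
    finally show ?thesis .
  qed
  then show ?thesis
    by (simp add: X_def Y_def D_def)
qed

lemma jbracket_kernel:
  "(\<integral>\<^sup>+x. ennreal (jbracket (x - a) powr (-(7/8)) * jbracket (x - b) powr (- 1)) \<partial>lborel)
    \<le> ennreal (4 * jbracket_mass * jbracket (a - b) powr (-(3/4)))"
proof -
  have "(\<integral>\<^sup>+x. ennreal (jbracket (x - a) powr (-(7/8)) * jbracket (x - b) powr (- 1)) \<partial>lborel)
    \<le> (\<integral>\<^sup>+x. ennreal (2 * jbracket (a - b) powr (-(3/4)))
        * (ennreal (jbracket (x - a) powr (-(9/8))) + ennreal (jbracket (x - b) powr (-(9/8)))) \<partial>lborel)"
    by (intro nn_integral_mono)
       (simp add: jbracket_kernel_pointwise ennreal_leI del: powr_neg_one' flip: ennreal_plus ennreal_mult)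
  also have "\<dots> = ennreal (2 * jbracket (a - b) powr (-(3/4))) * (ennreal jbracket_mass + ennreal jbracket_mass)"
    by (subst nn_integral_cmult, simp, subst nn_integral_add) (simp_all add: nn_integral_jbracket_shift)
  also have "\<dots> = ennreal (4 * jbracket_mass * jbracket (a - b) powr (-(3/4)))"
    by (simp flip: ennreal_plus ennreal_mult)
  finally show ?thesis .
qed

text \<open>Jordan's inequality: a concave function lies above its chord, here the one over
  \<open>[0, pi/2]\<close>.\<close>

lemma sin_ge_linear:
  assumes "0 \<le> x" "x \<le> pi / 2"
  shows "2 / pi * x \<le> sin x"
proof -
  have "convex_on {0..pi/2} (\<lambda>x. - sin x)"
  proof (rule f''_ge0_imp_convex)
    show "((\<lambda>x. - sin x) has_real_derivative - cos x) (at x)" for x :: real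
      by (auto intro!: derivative_eq_intros)
    show "((\<lambda>x. - cos x) has_real_derivative sin x) (at x)" for x :: real
      by (auto intro!: derivative_eq_intros)
    show "0 \<le> sin x" if "x \<in> {0..pi/2}" for x
      using that by (intro sin_ge_zero) auto
  qed simp
  then have "- sin ((1 - 2 * x / pi) *\<^sub>R 0 + (2 * x / pi) *\<^sub>R (pi / 2))
      \<le> (1 - 2 * x / pi) * - sin 0 + (2 * x / pi) * - sin (pi / 2)"
    using assms by (intro convex_onD) auto
  then show ?thesis
    by simp
qed

lemma abs_sin_ge_linear:
  assumes "\<bar>x\<bar> \<le> pi / 2"
  shows "2 / pi * \<bar>x\<bar> \<le> \<bar>sin x\<bar>"
proof (cases "0 \<le> x")
  case True
  with assms sin_ge_linear[of x] show ?thesis by simp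
next
  case False
  with assms sin_ge_linear[of "-x"] show ?thesis by simp
qed

section \<open>The phase function\<close>

text \<open>\<open>nat \<bar>j\<bar>\<close> is injective on each half line, so the series over the
  naturals counts twice. The term \<open>j = 0\<close> contributes nothing because
  \<open>0 powr - p\<close> is 0.\<close>

lemma int_powr_sum_bounded:
  assumes "1 < p"
  obtains C where "0 \<le> C" "\<And>S::int set. finite S \<Longrightarrow> (\<Sum>j\<in>S. \<bar>real_of_int j\<bar> powr (- p)) \<le> C"
proof
  let ?f = "\<lambda>n. real n powr (- p)"
  have sm: "summable ?f"
    using assms by (simp add: summable_real_powr_iff)
  show "0 \<le> 2 * suminf ?f"
    using sm by (simp add: suminf_nonneg)
  fix S :: "int set" assume S: "finite S"
  have half: "(\<Sum>j\<in>T. \<bar>real_of_int j\<bar> powr (- p)) \<le> suminf ?f"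
    if "finite T" "inj_on (\<lambda>j. nat \<bar>j\<bar>) T" for T :: "int set"
  proof -
    have "(\<Sum>j\<in>T. \<bar>real_of_int j\<bar> powr (- p)) = (\<Sum>n\<in>(\<lambda>j. nat \<bar>j\<bar>) ` T. ?f n)"
      using that by (subst sum.reindex) auto
    also have "\<dots> \<le> suminf ?f"
      using that sm by (intro sum_le_suminf) auto
    finally show ?thesis .
  qed
  have "(\<Sum>j\<in>S. \<bar>real_of_int j\<bar> powr (- p))
      = (\<Sum>j\<in>S \<inter> {0..}. \<bar>real_of_int j\<bar> powr (- p)) + (\<Sum>j\<in>S - {0..}. \<bar>real_of_int j\<bar> powr (- p))"
    using S by (rule sum.Int_Diff)
  also have "\<dots> \<le> suminf ?f + suminf ?f"
    using S by (intro add_mono half) (auto simp: inj_on_def)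
  finally show "(\<Sum>j\<in>S. \<bar>real_of_int j\<bar> powr (- p)) \<le> 2 * suminf ?f"
    by simp
qed

text \<open>A value of \<^term>\<open>A\<close> can be close to only one \<^term>\<open>\<phi> a\<close>; measured from the closest one, the
  distances grow quadratically, and \<^term>\<open>(3/4::real)\<close> exceeds the critical exponent one half.\<close>

lemma separated_sum_bounded:
  assumes "0 < c"
  obtains C where "0 \<le> C"
    "\<And>(S::int set) \<phi> A. finite S \<Longrightarrow>
       (\<And>a b. a \<in> S \<Longrightarrow> b \<in> S \<Longrightarrow> c * (real_of_int (a - b))\<^sup>2 \<le> \<bar>\<phi> a - \<phi> b\<bar>) \<Longrightarrow>
       (\<Sum>a\<in>S. jbracket (A - \<phi> a) powr (-(3/4))) \<le> C"
proof -
  obtain C0 where C0: "0 \<le> C0" "\<And>S::int set. finite S \<Longrightarrow> (\<Sum>j\<in>S. \<bar>real_of_int j\<bar> powr (-(3/2))) \<le> C0"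
    using int_powr_sum_bounded[of "3/2"] by auto
  define d where "d = (c / 2) powr (-(3/4))"
  show thesis
  proof (rule that)
    show "0 \<le> 1 + d * C0"
      using C0 by (simp add: d_def)
  next
    fix S :: "int set" and \<phi> and A :: real
    assume S: "finite S"
      and sep: "\<And>a b. a \<in> S \<Longrightarrow> b \<in> S \<Longrightarrow> c * (real_of_int (a - b))\<^sup>2 \<le> \<bar>\<phi> a - \<phi> b\<bar>"
    show "(\<Sum>a\<in>S. jbracket (A - \<phi> a) powr (-(3/4))) \<le> 1 + d * C0"
    proof (cases "S = {}")
      case True
      then show ?thesis using C0 by (simp add: d_def)
    next
      case False
      then obtain e where e: "e \<in> S" "\<And>a. a \<in> S \<Longrightarrow> \<bar>A - \<phi> e\<bar> \<le> \<bar>A - \<phi> a\<bar>"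
        using arg_min_if_finite[OF S, of "\<lambda>a. \<bar>A - \<phi> a\<bar>"] by (metis linorder_not_less)
      have bd: "jbracket (A - \<phi> a) powr (-(3/4)) \<le> (if a = e then 1 else 0)
          + d * \<bar>real_of_int (a - e)\<bar> powr (-(3/2))" if a: "a \<in> S" for a
      proof (cases "a = e")
        case True
        have "jbracket (A - \<phi> a) powr (-(3/4)) \<le> 1 powr (-(3/4))"
          by (intro powr_mono_nonpos jbracket_ge_1) auto
        with True show ?thesis by simp
      next
        case False
        \<comment> \<open>By minimality of \<open>e\<close>,
          \<open>\<bar>\<phi> a - \<phi> e\<bar>\<close> is at most twice
          \<open>\<bar>A - \<phi> a\<bar>\<close>; hence the \<open>c / 2\<close>.\<close>
        have "(c / 2) * (real_of_int (a - e))\<^sup>2 \<le> \<bar>A - \<phi> a\<bar>"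
          using sep[OF a e(1)] e(2)[OF a] by linarith
        also have "\<dots> \<le> jbracket (A - \<phi> a)"
          by (rule jbracket_ge_abs)
        finally have "jbracket (A - \<phi> a) powr (-(3/4)) \<le> ((c / 2) * (real_of_int (a - e))\<^sup>2) powr (-(3/4))"
          using False assms by (intro powr_mono_nonpos) auto
        also have "\<dots> = d * ((real_of_int (a - e))\<^sup>2) powr (-(3/4))"
          unfolding d_def by (rule powr_mult)
        also have "(real_of_int (a - e))\<^sup>2 = \<bar>real_of_int (a - e)\<bar> powr 2"
          using False by (simp del: of_int_diff)
        also have "d * \<dots> powr (-(3/4)) = d * \<bar>real_of_int (a - e)\<bar> powr (-(3/2))"
          unfolding powr_powr by simp
        finally show ?thesis using False by simp
      qed
      have "(\<Sum>a\<in>S. jbracket (A - \<phi> a) powr (-(3/4)))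
          \<le> (\<Sum>a\<in>S. (if a = e then 1 else 0) + d * \<bar>real_of_int (a - e)\<bar> powr (-(3/2)))"
        by (intro sum_mono bd)
      also have "\<dots> = 1 + d * (\<Sum>a\<in>S. \<bar>real_of_int (a - e)\<bar> powr (-(3/2)))"
        using S e by (simp add: sum.distrib sum_distrib_left)
      also have "(\<Sum>a\<in>S. \<bar>real_of_int (a - e)\<bar> powr (-(3/2)))
          = (\<Sum>j\<in>(\<lambda>a. a - e) ` S. \<bar>real_of_int j\<bar> powr (-(3/2)))"
        by (subst sum.reindex) (auto simp: inj_on_def)
      also have "1 + d * \<dots> \<le> 1 + d * C0"
        using S C0 by (intro add_mono mult_left_mono) (auto simp: d_def)
      finally show ?thesis .
    qed
  qed
qed

section \<open>Separation and resonance for the discrete phase\<close>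

lemma mesh_pos: "0 < N \<Longrightarrow> 0 < mesh N"
  by (simp add: mesh_def)

lemma mesh_mult_N: "0 < N \<Longrightarrow> mesh N * real N = pi"
  by (simp add: mesh_def)

lemma dphase_minus: "dphase N (- k) = - dphase N k"
  by (cases "mesh N = 0") (auto simp: dphase_def divide_simps)

text \<open>Sum-to-product: once \<open>a + b\<close> is fixed, the difference \<open>a - b\<close>
  enters through a single cosine, which makes the phase sums of different pairs comparable.\<close>

lemma dphase_add:
  "dphase N a + dphase N b = real_of_int (a + b) / (mesh N)\<^sup>2
     - 4 / (mesh N)^3 * sin (mesh N * real_of_int (a + b) / 4) * cos (mesh N * real_of_int (a - b) / 4)"
proof -
  define h where "h = mesh N"
  have "sin (h * a / 2) + sin (h * b / 2) = 2 * sin (h * real_of_int (a + b) / 4) * cos (h * real_of_int (a - b) / 4)"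
    by (subst sin_plus_sin) (simp add: field_simps)
  moreover have "dphase N a + dphase N b = real_of_int (a + b) / h\<^sup>2 - 2 / h^3 * (sin (h * a / 2) + sin (h * b / 2))"
    by (cases "h = 0") (simp_all add: dphase_def h_def field_simps power2_eq_square power3_eq_cube)
  ultimately show ?thesis
    by (simp add: h_def)
qed

text \<open>The difference of cosines is a product of the sines of the half sum and the half
  difference. Jordan's inequality bounds each from below, and the two arguments multiply to a
  multiple of \<open>x\<^sup>2 - y\<^sup>2\<close>.\<close>

lemma cos_diff_lower:
  assumes "0 \<le> x" "x \<le> pi / 2" "0 \<le> y" "y \<le> pi / 2"
  shows "2 / pi\<^sup>2 * \<bar>x\<^sup>2 - y\<^sup>2\<bar> \<le> \<bar>cos x - cos y\<bar>"
proof -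
  have "2 / pi * \<bar>(x + y) / 2\<bar> \<le> \<bar>sin ((x + y) / 2)\<bar>" "2 / pi * \<bar>(y - x) / 2\<bar> \<le> \<bar>sin ((y - x) / 2)\<bar>"
    using assms by (intro abs_sin_ge_linear; simp)+
  then have "(2 / pi * \<bar>(x + y) / 2\<bar>) * (2 / pi * \<bar>(y - x) / 2\<bar>) \<le> \<bar>sin ((x + y) / 2)\<bar> * \<bar>sin ((y - x) / 2)\<bar>"
    by (intro mult_mono) auto
  moreover have "\<bar>x\<^sup>2 - y\<^sup>2\<bar> = \<bar>x + y\<bar> * \<bar>y - x\<bar>"
    by (simp add: power2_eq_square square_diff_square_factored abs_mult abs_minus_commute)
  moreover have "\<bar>cos x - cos y\<bar> = 2 * (\<bar>sin ((x + y) / 2)\<bar> * \<bar>sin ((y - x) / 2)\<bar>)"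
    by (simp add: cos_diff_cos abs_mult)
  ultimately show ?thesis
    by (simp add: power2_eq_square field_simps)
qed

text \<open>Meant for the aliased case of \<open>abs_dphase_resonance\<close>, which needs
  \<open>pi ^ 3\<close> below \<open>125 * (2 * pi - 6)\<close>, about 35. That case dictates the
  size of the constant 125.\<close>

lemma pi_cube_le: "pi ^ 3 \<le> 125/4"
proof -
  have "pi \<le> 3.1416" using pi_approx by simp
  then have "pi ^ 3 \<le> 3.1416 ^ 3" by (intro power_mono) auto
  also have "\<dots> \<le> 125/4" by (simp add: power3_eq_cube)
  finally show ?thesis .
qed

text \<open>The three factors \<open>h\<close> from one sine and one difference of cosines cancel
  \<open>1 / h^3\<close>, leaving \<open>\<bar>K\<bar> * \<bar>p\<^sup>2 - p'\<^sup>2\<bar> / (4 *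
  pi^3)\<close>, uniform in the mesh. The sign condition excludes the swap of \<open>a\<close> and
  \<open>b\<close>, which leaves the phase sum unchanged. Under it the sum of \<open>a - b\<close>
  and \<open>a' - b'\<close> is in modulus no smaller than their difference, which is
  \<open>2 * (a - a')\<close>.\<close>

lemma dphase_separation:
  fixes a b a' b' :: int
  assumes N: "0 < N" and K: "a + b = K" "a' + b' = K" "K \<noteq> 0"
    and bd: "\<bar>a\<bar> \<le> N" "\<bar>b\<bar> \<le> N" "\<bar>a'\<bar> \<le> N" "\<bar>b'\<bar> \<le> N"
    and br: "0 \<le> (a - b) * (a' - b')"
  shows "1/125 * (real_of_int (a - a'))\<^sup>2 \<le> \<bar>(dphase N a + dphase N b) - (dphase N a' + dphase N b')\<bar>"
proof -
  define h where "h = mesh N"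
  have h: "0 < h" "h * real N = pi" using N by (simp_all add: h_def mesh_pos mesh_mult_N)
  define p p' where "p = \<bar>a - b\<bar>" and "p' = \<bar>a' - b'\<bar>"
  \<comment> \<open>\<open>2 * int N\<close> is the size that \<open>K\<close> and the differences
    can reach; after division by 4 the angle still lies in the range of Jordan's inequality.\<close>
  have le: "h * real_of_int q / 4 \<le> pi / 2" if "q \<le> 2 * int N" for q
  proof -
    have "h * real_of_int q \<le> h * (2 * real N)"
      using that h by (intro mult_left_mono) linarith+
    also have "\<dots> = 2 * pi" using h by simp
    finally show ?thesis by simp
  qed
  have cosabs: "cos (h * real_of_int d / 4) = cos (h * real_of_int \<bar>d\<bar> / 4)" for d
    by (simp add: abs_if)
  have "2 / pi\<^sup>2 * \<bar>(h * p / 4)\<^sup>2 - (h * p' / 4)\<^sup>2\<bar> \<le> \<bar>cos (h * p / 4) - cos (h * p' / 4)\<bar>"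
    using h bd by (intro cos_diff_lower le) (auto simp: p_def p'_def)
  moreover have "2 / pi * \<bar>h * K / 4\<bar> \<le> \<bar>sin (h * K / 4)\<bar>"
    using le[of "\<bar>K\<bar>"] K bd h by (intro abs_sin_ge_linear) (auto simp: abs_mult)
  ultimately have "(2 / pi * \<bar>h * K / 4\<bar>) * (2 / pi\<^sup>2 * \<bar>(h * p / 4)\<^sup>2 - (h * p' / 4)\<^sup>2\<bar>)
      \<le> \<bar>sin (h * K / 4)\<bar> * \<bar>cos (h * p / 4) - cos (h * p' / 4)\<bar>"
    by (intro mult_mono) auto
  then have "4 / h^3 * ((2 / pi * \<bar>h * K / 4\<bar>) * (2 / pi\<^sup>2 * \<bar>(h * p / 4)\<^sup>2 - (h * p' / 4)\<^sup>2\<bar>))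
      \<le> 4 / h^3 * (\<bar>sin (h * K / 4)\<bar> * \<bar>cos (h * p / 4) - cos (h * p' / 4)\<bar>)"
    using h by (intro mult_left_mono) auto
  also have "\<dots> = \<bar>(dphase N a + dphase N b) - (dphase N a' + dphase N b')\<bar>"
  proof -
    have "(dphase N a + dphase N b) - (dphase N a' + dphase N b')
        = - (4 / h^3 * (sin (h * K / 4) * (cos (h * p / 4) - cos (h * p' / 4))))"
      unfolding dphase_add K h_def[symmetric] cosabs[of "a - b"] cosabs[of "a' - b'"] p_def p'_def
      by (simp add: algebra_simps)
    then show ?thesis using h by (simp add: abs_mult)
  qed
  also have "4 / h^3 * ((2 / pi * \<bar>h * K / 4\<bar>) * (2 / pi\<^sup>2 * \<bar>(h * p / 4)\<^sup>2 - (h * p' / 4)\<^sup>2\<bar>))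
      = \<bar>real_of_int K\<bar> * \<bar>real_of_int (p\<^sup>2 - p'\<^sup>2)\<bar> / (4 * pi^3)"
  proof -
    have "(h * p / 4)\<^sup>2 - (h * p' / 4)\<^sup>2 = h\<^sup>2 / 16 * real_of_int (p\<^sup>2 - p'\<^sup>2)"
      by (simp add: field_simps)
    then have "\<bar>(h * p / 4)\<^sup>2 - (h * p' / 4)\<^sup>2\<bar> = h\<^sup>2 / 16 * \<bar>real_of_int (p\<^sup>2 - p'\<^sup>2)\<bar>"
      by (simp only: abs_mult) simp
    moreover have "\<bar>h * K / 4\<bar> = h * \<bar>real_of_int K\<bar> / 4"
      using h by (simp add: abs_mult)
    ultimately show ?thesis
      using h by (simp add: field_simps power2_eq_square power3_eq_cube del: of_int_diff)
  qed
  finally have main: "\<bar>real_of_int K\<bar> * \<bar>real_of_int (p\<^sup>2 - p'\<^sup>2)\<bar> / (4 * pi^3)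
      \<le> \<bar>(dphase N a + dphase N b) - (dphase N a' + dphase N b')\<bar>" .
  have "4 * (a - a')\<^sup>2 \<le> \<bar>p\<^sup>2 - p'\<^sup>2\<bar>"
  proof -
    have e: "p\<^sup>2 - p'\<^sup>2 = ((a - b) - (a' - b')) * ((a - b) + (a' - b'))"
      by (simp add: p_def p'_def power2_eq_square algebra_simps)
    have "\<bar>(a - b) - (a' - b')\<bar> \<le> \<bar>(a - b) + (a' - b')\<bar>"
      using br by (auto simp: zero_le_mult_iff)
    then have "\<bar>(a - b) - (a' - b')\<bar> * \<bar>(a - b) - (a' - b')\<bar> \<le> \<bar>p\<^sup>2 - p'\<^sup>2\<bar>"
      unfolding e abs_mult by (intro mult_left_mono) auto
    moreover have "(a - b) - (a' - b') = 2 * (a - a')"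
    proof -
      have "b = K - a" "b' = K - a'" using K by auto
      then show ?thesis by simp
    qed
    ultimately have "\<bar>2 * (a - a')\<bar> * \<bar>2 * (a - a')\<bar> \<le> \<bar>p\<^sup>2 - p'\<^sup>2\<bar>"
      by simp
    then show ?thesis
      unfolding abs_mult_self_eq by (simp add: power2_eq_square algebra_simps)
  qed
  then have "4 * (real_of_int (a - a'))\<^sup>2 \<le> \<bar>real_of_int (p\<^sup>2 - p'\<^sup>2)\<bar>"
    by (subst (asm) of_int_le_iff[where ?'a=real, symmetric]) simp
  moreover have "1 \<le> \<bar>real_of_int K\<bar>"
    using K by linarith
  ultimately have "1 * (4 * (real_of_int (a - a'))\<^sup>2) \<le> \<bar>real_of_int K\<bar> * \<bar>real_of_int (p\<^sup>2 - p'\<^sup>2)\<bar>"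
    by (intro mult_mono) auto
  then have "1 * (4 * (real_of_int (a - a'))\<^sup>2) / (4 * pi^3) \<le> \<bar>real_of_int K\<bar> * \<bar>real_of_int (p\<^sup>2 - p'\<^sup>2)\<bar> / (4 * pi^3)"
    by (intro divide_right_mono) auto
  moreover have "1/125 * (real_of_int (a - a'))\<^sup>2 \<le> 1 * (4 * (real_of_int (a - a'))\<^sup>2) / (4 * pi^3)"
  proof -
    have "(real_of_int (a - a'))\<^sup>2 * pi ^ 3 \<le> (real_of_int (a - a'))\<^sup>2 * 125"
      using pi_cube_le by (intro mult_left_mono) auto
    then show ?thesis
      by (simp add: field_simps del: of_int_diff)
  qed
  ultimately show ?thesis
    using main by linarith
qed

text \<open>The three admissible values of \<^term>\<open>j + m j\<close> account for aliasing on \<open>\<int>/2N\<int>\<close>.\<close>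

lemma dphase_pair_sum_bounded:
  obtains C where "0 \<le> C"
    "\<And>N S (m::int \<Rightarrow> int) K A. 0 < N \<Longrightarrow> S \<subseteq> {- int N..int N} \<Longrightarrow> K \<noteq> 0 \<Longrightarrow> \<bar>K\<bar> \<le> int N \<Longrightarrow>
       (\<And>j. j \<in> S \<Longrightarrow> \<bar>m j\<bar> \<le> int N \<and> j + m j \<in> {K, K + 2 * int N, K - 2 * int N}) \<Longrightarrow>
       (\<Sum>j\<in>S. jbracket (A - (dphase N j + dphase N (m j))) powr (-(3/4))) \<le> C"
proof -
  obtain C where C: "0 \<le> C"
    "\<And>(S::int set) \<phi> A. finite S \<Longrightarrow>
       (\<And>a b. a \<in> S \<Longrightarrow> b \<in> S \<Longrightarrow> 1/125 * (real_of_int (a - b))\<^sup>2 \<le> \<bar>\<phi> a - \<phi> b\<bar>) \<Longrightarrow>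
       (\<Sum>a\<in>S. jbracket (A - \<phi> a) powr (-(3/4))) \<le> C"
    using separated_sum_bounded[of "1/125"] by auto
  show thesis
  proof (rule that)
    \<comment> \<open>Six branches: three values of \<open>j + m j\<close>, each split into
      \<open>m j \<le> j\<close> and its complement so that the sign condition of
      \<open>dphase_separation\<close> holds.\<close>
    show "0 \<le> 6 * C" using C by simp
  next
    fix N :: nat and S and m :: "int \<Rightarrow> int" and K A
    assume N: "0 < N" and S: "S \<subseteq> {- int N..int N}" and K: "K \<noteq> 0" "\<bar>K\<bar> \<le> int N"
      and m: "\<And>j. j \<in> S \<Longrightarrow> \<bar>m j\<bar> \<le> int N \<and> j + m j \<in> {K, K + 2 * int N, K - 2 * int N}"
    let ?E = "{K, K + 2 * int N, K - 2 * int N}"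
    let ?w = "\<lambda>j. jbracket (A - (dphase N j + dphase N (m j))) powr (-(3/4))"
    have fin: "finite S" using S finite_subset by blast
    have branch: "(\<Sum>j\<in>T. ?w j) \<le> C"
      if T: "T \<subseteq> S" "\<And>j. j \<in> T \<Longrightarrow> j + m j = K'" "K' \<in> ?E"
        "\<And>i j. i \<in> T \<Longrightarrow> j \<in> T \<Longrightarrow> 0 \<le> (i - m i) * (j - m j)" for T K'
    proof (rule C(2))
      show "finite T" using T fin finite_subset by blast
      fix a b assume ab: "a \<in> T" "b \<in> T"
      \<comment> \<open>The shifts by \<open>2 * int N\<close> cannot produce zero because
        \<open>\<bar>K\<bar> \<le> int N\<close>.\<close>
      have "K' \<noteq> 0" using T(3) K N by auto
      have "a \<in> S" "b \<in> S" using ab T(1) by auto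
      then have "\<bar>a\<bar> \<le> int N" "\<bar>b\<bar> \<le> int N" "\<bar>m a\<bar> \<le> int N" "\<bar>m b\<bar> \<le> int N"
        using S m[of a] m[of b] by (auto simp: abs_le_iff subset_iff)
      with \<open>K' \<noteq> 0\<close> show "1/125 * (real_of_int (a - b))\<^sup>2
          \<le> \<bar>(dphase N a + dphase N (m a)) - (dphase N b + dphase N (m b))\<bar>"
        using ab T(2)[OF ab(1)] T(2)[OF ab(2)] T(4)[OF ab]
        by (intro dphase_separation[where K=K'] N) auto
    qed
    have "(\<Sum>j\<in>S. ?w j) = (\<Sum>K'\<in>?E. \<Sum>j\<in>{j\<in>S. j + m j = K'}. ?w j)"
      using fin m by (intro sum.group[symmetric]) auto
    also have "\<dots> \<le> (\<Sum>K'\<in>?E. 2 * C)"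
    proof (rule sum_mono)
      fix K' assume K': "K' \<in> ?E"
      let ?T = "{j\<in>S. j + m j = K'}"
      have "(\<Sum>j\<in>?T. ?w j) = (\<Sum>j\<in>?T \<inter> {j. m j \<le> j}. ?w j) + (\<Sum>j\<in>?T - {j. m j \<le> j}. ?w j)"
        using fin by (intro sum.Int_Diff) auto
      also have "\<dots> \<le> C + C"
        using K' by (intro add_mono branch[where K'=K']) (auto intro: mult_nonneg_nonneg mult_nonpos_nonpos)
      finally show "(\<Sum>j\<in>?T. ?w j) \<le> 2 * C" by simp
    qed
    also have "\<dots> \<le> 6 * C"
    proof -
      have "real (card ?E) \<le> 3"
        by (simp add: card_insert_if)
      then have "real (card ?E) * (2 * C) \<le> 3 * (2 * C)"
        using C by (intro mult_right_mono) auto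
      then show ?thesis by simp
    qed
    finally show "(\<Sum>j\<in>S. ?w j) \<le> 6 * C" .
  qed
qed

text \<open>Without aliasing the linear parts of the phases cancel and only sines remain. With
  aliasing they differ by \<open>2 * N / h\<^sup>2 = 2 * pi / h^3\<close>, too much to be cancelled
  by three sines worth at most \<open>6 / h^3\<close> together; and
  \<open>\<bar>k * k1 * k2\<bar>\<close> never exceeds \<open>N^3 = (pi / h)^3\<close>.\<close>

lemma abs_dphase_resonance:
  fixes k k1 k2 :: int
  assumes N: "0 < N" and bd: "\<bar>k\<bar> \<le> int N" "\<bar>k1\<bar> \<le> int N" "\<bar>k2\<bar> \<le> int N"
    and sum: "k1 + k2 \<in> {k, k + 2 * int N, k - 2 * int N}"
  shows "1/125 * (\<bar>real_of_int k\<bar> * \<bar>real_of_int k1\<bar> * \<bar>real_of_int k2\<bar>)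
    \<le> \<bar>dphase N k - dphase N k1 - dphase N k2\<bar>"
proof -
  define h where "h = mesh N"
  have h: "0 < h" "h * real N = pi" using N by (simp_all add: h_def mesh_pos mesh_mult_N)
  define P where "P = \<bar>real_of_int k\<bar> * \<bar>real_of_int k1\<bar> * \<bar>real_of_int k2\<bar>"
  have le: "\<bar>h * real_of_int q\<bar> \<le> pi" if "\<bar>q\<bar> \<le> int N" for q
  proof -
    have "h * \<bar>real_of_int q\<bar> \<le> h * real N"
      using that h by (intro mult_left_mono) linarith+
    then show ?thesis using h by (simp add: abs_mult)
  qed
  have H: "dphase N k - dphase N k1 - dphase N k2 = real_of_int (k - k1 - k2) / h\<^sup>2
      - 2 / h^3 * (sin (h * k / 2) - sin (h * k1 / 2) - sin (h * k2 / 2))"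
    using h by (simp add: dphase_def h_def[symmetric] field_simps power2_eq_square power3_eq_cube)
  show ?thesis
  proof (cases "k1 + k2 = k")
    case True
    have quarter: "1 / (2 * pi) * (h * \<bar>real_of_int q\<bar>) \<le> \<bar>sin (h * q / 4)\<bar>" if "\<bar>q\<bar> \<le> int N" for q
    proof -
      have "2 / pi * \<bar>h * q / 4\<bar> \<le> \<bar>sin (h * q / 4)\<bar>"
        using le[OF that] by (intro abs_sin_ge_linear) (auto simp: abs_le_iff)
      then show ?thesis using h by (simp add: abs_mult)
    qed
    define x y where "x = h * k1 / 4" and "y = h * k2 / 4"
    \<comment> \<open>\<open>sin (2 * x) + sin (2 * y)\<close> and \<open>sin (2 * (x + y))\<close>
      share the factor \<open>2 * sin (x + y)\<close>; the difference of cosines that remains is a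
      product of two sines.\<close>
    have "sin (2 * (x + y)) - sin (2 * x) - sin (2 * y) = - 4 * (sin x * sin y * sin (x + y))"
    proof -
      have "sin (2 * x) + sin (2 * y) = 2 * sin (x + y) * cos (x - y)"
      proof -
        have "(2 * x + 2 * y) / 2 = x + y" "(2 * x - 2 * y) / 2 = x - y"
          by (simp_all add: field_simps)
        then show ?thesis
          using sin_plus_sin[of "2 * x" "2 * y"] by (simp only:)
      qed
      moreover have "sin (2 * (x + y)) = 2 * sin (x + y) * cos (x + y)"
        by (rule sin_double)
      ultimately have "sin (2 * (x + y)) - sin (2 * x) - sin (2 * y) = 2 * sin (x + y) * (cos (x + y) - cos (x - y))"
        by (simp only: right_diff_distrib)
      also have "cos (x + y) - cos (x - y) = - 2 * sin x * sin y"
        by (simp add: cos_add cos_diff)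
      finally show ?thesis by simp
    qed
    moreover have e: "x + y = h * k / 4" "2 * (x + y) = h * k / 2" "2 * x = h * k1 / 2" "2 * y = h * k2 / 2"
      using True by (auto simp: x_def y_def algebra_simps)
    ultimately have "sin (h * k / 2) - sin (h * k1 / 2) - sin (h * k2 / 2)
        = - 4 * (sin (h * k1 / 4) * sin (h * k2 / 4) * sin (h * k / 4))"
      unfolding e x_def[symmetric] y_def[symmetric] by simp
    then have "dphase N k - dphase N k1 - dphase N k2 = 8 / h^3 * (sin (h * k1 / 4) * sin (h * k2 / 4) * sin (h * k / 4))"
      unfolding H using True by (simp flip: of_int_add)
    then have "\<bar>dphase N k - dphase N k1 - dphase N k2\<bar> = 8 / h^3 * (\<bar>sin (h * k1 / 4)\<bar> * \<bar>sin (h * k2 / 4)\<bar> * \<bar>sin (h * k / 4)\<bar>)"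
      using h by (simp add: abs_mult)
    also have "\<dots> \<ge> 8 / h^3 * ((1 / (2 * pi) * (h * \<bar>real_of_int k1\<bar>)) * (1 / (2 * pi) * (h * \<bar>real_of_int k2\<bar>)) * (1 / (2 * pi) * (h * \<bar>real_of_int k\<bar>)))"
      using h bd by (intro mult_left_mono mult_mono quarter) auto
    also have "8 / h^3 * ((1 / (2 * pi) * (h * \<bar>real_of_int k1\<bar>)) * (1 / (2 * pi) * (h * \<bar>real_of_int k2\<bar>)) * (1 / (2 * pi) * (h * \<bar>real_of_int k\<bar>)))
        = P / pi^3"
      using h by (simp add: P_def field_simps power3_eq_cube)
    finally have "P / pi^3 \<le> \<bar>dphase N k - dphase N k1 - dphase N k2\<bar>" .
    moreover have "1/125 * P \<le> P / pi^3"
    proof -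
      have "P * pi ^ 3 \<le> P * 125"
        using pi_cube_le by (intro mult_left_mono) (auto simp: P_def)
      then show ?thesis by (simp add: field_simps)
    qed
    ultimately show ?thesis unfolding P_def[symmetric] by linarith
  next
    case False
    define Q where "Q = sin (h * k / 2) - sin (h * k1 / 2) - sin (h * k2 / 2)"
    have "\<bar>Q\<bar> \<le> 3"
      unfolding Q_def
      using abs_sin_le_one[of "h * k / 2"] abs_sin_le_one[of "h * k1 / 2"] abs_sin_le_one[of "h * k2 / 2"]
      by linarith
    have "\<bar>real_of_int (k - k1 - k2)\<bar> = 2 * real N"
      using False sum by auto
    then have "\<bar>real_of_int (k - k1 - k2) / h\<^sup>2\<bar> = 2 * pi / h^3"
      using h by (simp add: field_simps power2_eq_square power3_eq_cube del: of_int_diff)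
    moreover have "\<bar>2 / h^3 * Q\<bar> \<le> 2 / h^3 * 3"
      using h \<open>\<bar>Q\<bar> \<le> 3\<close> by (simp add: abs_mult divide_right_mono)
    ultimately have "2 * pi / h^3 - 2 / h^3 * 3 \<le> \<bar>dphase N k - dphase N k1 - dphase N k2\<bar>"
      unfolding H Q_def[symmetric] by linarith
    moreover have "2 * pi / h^3 - 2 / h^3 * 3 = (2 * pi - 6) / h^3"
      by (simp add: diff_divide_distrib)
    moreover have "1/125 * P \<le> (2 * pi - 6) / h^3"
    proof -
      have "P \<le> real N * real N * real N"
        unfolding P_def using bd by (intro mult_mono) auto
      then have "P * h^3 \<le> real N * real N * real N * h^3"
        using h by (intro mult_right_mono) auto
      also have "\<dots> = (h * real N)^3"
        by (simp add: power3_eq_cube)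
      also have "\<dots> = pi^3" using h by simp
      also have "\<dots> \<le> 125/4" by (rule pi_cube_le)
      also have "\<dots> \<le> 125 * (2 * pi - 6)" using pi_approx by simp
      finally show ?thesis using h by (simp add: field_simps)
    qed
    ultimately show ?thesis unfolding P_def[symmetric] by linarith
  qed
qed

section \<open>Representatives modulo 2N and reindexing of sums over them\<close>

definition cyc :: "nat \<Rightarrow> int \<Rightarrow> int"
  where "cyc N j = (j + int N) mod (2 * int N) - int N"

lemma cyc_in_dfreq [simp]: "0 < N \<Longrightarrow> cyc N j \<in> dfreq N"
  by (simp add: cyc_def dfreq_def)

lemma cyc_eq: "\<exists>q. cyc N j = j + 2 * int N * q"
  by (rule exI[of _ "- ((j + int N) div (2 * int N))"])
     (simp add: cyc_def minus_div_mult_eq_mod[symmetric] algebra_simps)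

lemma cyc_unique:
  assumes "j \<in> dfreq N" "j = i + 2 * int N * q"
  shows "cyc N i = j"
proof -
  have "(i + int N) mod (2 * int N) = (j + int N) mod (2 * int N)"
    unfolding assms(2) by (metis add.assoc add.commute mod_mult_self2)
  also have "\<dots> = j + int N"
    using assms(1) by (intro mod_pos_pos_trivial) (auto simp: dfreq_def)
  finally show ?thesis by (simp add: cyc_def)
qed

text \<open>This and the two following identities make reflection and translation bijections of
  \<open>dfreq N\<close>, with explicit inverses for reindexing.\<close>

lemma cyc_diff_cyc_diff:
  assumes "k1 \<in> dfreq N"
  shows "cyc N (k - cyc N (k - k1)) = k1"
proof -
  obtain q where "cyc N (k - k1) = k - k1 + 2 * int N * q" using cyc_eq by blast
  then show ?thesis using assms by (intro cyc_unique[where q=q]) (auto simp: algebra_simps)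
qed

lemma cyc_diff_add_cyc:
  assumes "k \<in> dfreq N"
  shows "cyc N (cyc N (k - k1) + k1) = k"
proof -
  obtain q where "cyc N (k - k1) = k - k1 + 2 * int N * q" using cyc_eq by blast
  then show ?thesis using assms by (intro cyc_unique[where q="-q"]) (auto simp: algebra_simps)
qed

lemma cyc_add_diff_cyc:
  assumes "k \<in> dfreq N"
  shows "cyc N (cyc N (k + k1) - k1) = k"
proof -
  obtain q where "cyc N (k + k1) = k + k1 + 2 * int N * q" using cyc_eq by blast
  then show ?thesis using assms by (intro cyc_unique[where q="-q"]) (auto simp: algebra_simps)
qed

text \<open>The defect is \<open>2 * int N * q\<close>, and three representatives of modulus at most
  N force \<open>\<bar>q\<bar> < 2\<close>.\<close>

lemma cyc_diff_aliases:
  assumes "0 < N" "k \<in> dfreq N" "k1 \<in> dfreq N"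
  shows "k1 + cyc N (k - k1) \<in> {k, k + 2 * int N, k - 2 * int N}"
proof -
  obtain q where q: "cyc N (k - k1) = k - k1 + 2 * int N * q" using cyc_eq by blast
  have "cyc N (k - k1) \<in> {- int N..<int N}" "k \<in> {- int N..<int N}" "k1 \<in> {- int N..<int N}"
    using assms cyc_in_dfreq[of N] by (simp_all add: dfreq_def)
  then have "int N * (- 2) < int N * q" "int N * q < int N * 2"
    using q unfolding atLeastLessThan_iff by linarith+
  then have "- 2 < q" "q < 2"
    using assms(1) by (simp_all only: mult_less_cancel_left_pos of_nat_0_less_iff)
  then have "q = -1 \<or> q = 0 \<or> q = 1" by linarith
  then show ?thesis using q by auto
qed

lemma finite_dfreq [simp]: "finite (dfreq N)"
  by (simp add: dfreq_def)

lemma dfreq_abs_le: "k \<in> dfreq N \<Longrightarrow> \<bar>k\<bar> \<le> int N"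
  by (auto simp: dfreq_def)

lemma sum_dfreq_reflect:
  fixes g :: "int \<Rightarrow> 'a::comm_monoid_add"
  assumes "0 < N"
  shows "(\<Sum>j\<in>dfreq N. g (cyc N (k - j))) = (\<Sum>j\<in>dfreq N. g j)"
  using assms
  by (intro sum.reindex_bij_witness[where i="\<lambda>j. cyc N (k - j)" and j="\<lambda>j. cyc N (k - j)"])
     (auto simp: cyc_diff_cyc_diff)

lemma sum_dfreq_shift:
  fixes g :: "int \<Rightarrow> 'a::comm_monoid_add"
  assumes "0 < N"
  shows "(\<Sum>k\<in>dfreq N. g (cyc N (k - j))) = (\<Sum>k\<in>dfreq N. g k)"
  using assms
  by (intro sum.reindex_bij_witness[where i="\<lambda>k. cyc N (k + j)" and j="\<lambda>k. cyc N (k - j)"])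
     (auto simp: cyc_diff_add_cyc cyc_add_diff_cyc)

section \<open>Cauchy--Schwarz inequalities and symbol bounds\<close>

text \<open>From \<open>(y + z)^2 \<ge> 4 * y * z\<close>. The square in the hypothesis keeps square
  roots of \<open>ennreal\<close> out of the Cauchy-Schwarz arguments.\<close>

lemma ennreal_amgm:
  fixes x y z :: ennreal
  assumes "x\<^sup>2 \<le> y * z"
  shows "2 * x \<le> y + z"
proof (cases "y = top \<or> z = top")
  case True
  then show ?thesis by auto
next
  case False
  then obtain p q where p: "0 \<le> p" "y = ennreal p" and q: "0 \<le> q" "z = ennreal q"
    by (metis ennreal_cases)
  have "x \<noteq> top"
    using assms p q by (auto simp: power2_eq_square top_unique simp flip: ennreal_mult)
  then obtain r where r: "0 \<le> r" "x = ennreal r"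
    by (metis ennreal_cases)
  have "r\<^sup>2 \<le> p * q"
    using assms p q r by (simp add: ennreal_power flip: ennreal_mult)
  then have "(2 * r)\<^sup>2 \<le> (p + q)\<^sup>2"
    using zero_le_power2[of "p - q"] by (simp add: power2_eq_square algebra_simps)
  then have "2 * r \<le> p + q"
    using p q by (meson add_nonneg_nonneg power2_le_imp_le)
  then show ?thesis
    using p q r by (simp add: ennreal_leI flip: ennreal_plus ennreal_mult'' ennreal_numeral)
qed

text \<open>Stated for terms that already satisfy \<open>x^2 \<le> p * q\<close>, so that an
  integral Cauchy-Schwarz inequality can be inserted termwise. In the induction
  \<open>ennreal_amgm\<close> handles the cross terms.\<close>

lemma ennreal_sum_Cauchy_Schwarz:
  fixes x p q :: "'a \<Rightarrow> ennreal"
  assumes "finite I" "\<And>i. i \<in> I \<Longrightarrow> (x i)\<^sup>2 \<le> p i * q i"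
  shows "(\<Sum>i\<in>I. x i)\<^sup>2 \<le> (\<Sum>i\<in>I. p i) * (\<Sum>i\<in>I. q i)"
  using assms
proof (induction rule: finite_induct)
  case (insert i I)
  let ?x = "\<Sum>i\<in>I. x i" and ?p = "\<Sum>i\<in>I. p i" and ?q = "\<Sum>i\<in>I. q i"
  have IH: "?x\<^sup>2 \<le> ?p * ?q" and i: "(x i)\<^sup>2 \<le> p i * q i"
    using insert by auto
  have "(x i * ?x)\<^sup>2 \<le> (p i * q i) * (?p * ?q)"
    unfolding power_mult_distrib using i IH by (rule mult_mono) auto
  also have "\<dots> = (p i * ?q) * (?p * q i)"
    by (simp add: ac_simps)
  finally have "2 * (x i * ?x) \<le> p i * ?q + ?p * q i"
    by (rule ennreal_amgm)
  then have "(x i)\<^sup>2 + 2 * (x i * ?x) + ?x\<^sup>2 \<le> p i * q i + (p i * ?q + ?p * q i) + ?p * ?q"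
    by (intro add_mono i IH)
  then show ?case
    using insert by (simp add: power2_eq_square algebra_simps mult_2 mult_2_right)
qed simp

lemma nn_integral_sum_Cauchy_Schwarz:
  fixes f g :: "'a \<Rightarrow> 'b \<Rightarrow> ennreal"
  assumes "finite I" "\<And>i. i \<in> I \<Longrightarrow> f i \<in> borel_measurable M" "\<And>i. i \<in> I \<Longrightarrow> g i \<in> borel_measurable M"
  shows "(\<Sum>i\<in>I. \<integral>\<^sup>+x. f i x * g i x \<partial>M)\<^sup>2
    \<le> (\<Sum>i\<in>I. \<integral>\<^sup>+x. (f i x)\<^sup>2 \<partial>M) * (\<Sum>i\<in>I. \<integral>\<^sup>+x. (g i x)\<^sup>2 \<partial>M)"
  using assms by (intro ennreal_sum_Cauchy_Schwarz Cauchy_Schwarz_nn_integral) auto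

lemma ennreal_square_sum3:
  fixes x y z :: ennreal
  shows "(x + y + z)\<^sup>2 \<le> 3 * (x\<^sup>2 + y\<^sup>2 + z\<^sup>2)"
proof -
  have "2 * (x * y) \<le> x\<^sup>2 + y\<^sup>2" "2 * (x * z) \<le> x\<^sup>2 + z\<^sup>2" "2 * (y * z) \<le> y\<^sup>2 + z\<^sup>2"
    by (rule ennreal_amgm; simp add: power_mult_distrib)+
  then have "x\<^sup>2 + y\<^sup>2 + z\<^sup>2 + (2 * (x * y) + 2 * (x * z) + 2 * (y * z))
      \<le> x\<^sup>2 + y\<^sup>2 + z\<^sup>2 + ((x\<^sup>2 + y\<^sup>2) + (x\<^sup>2 + z\<^sup>2) + (y\<^sup>2 + z\<^sup>2))"
    by (intro add_mono order_refl)
  also have "\<dots> = 3 * (x\<^sup>2 + y\<^sup>2 + z\<^sup>2)"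
  proof -
    have "3 * t = t + t + t" for t :: ennreal
    proof -
      have "(3::ennreal) = 1 + 1 + 1" by simp
      then show ?thesis by (simp only: distrib_right mult_1)
    qed
    from this[of "x\<^sup>2 + y\<^sup>2 + z\<^sup>2"] show ?thesis
      by (simp only: ac_simps)
  qed
  finally show ?thesis
    by (simp add: power2_eq_square algebra_simps mult_2 mult_2_right)
qed

section \<open>Pointwise symbol bounds: frequencies \<open>n\<close>, \<open>n1\<close>,
  \<open>n2\<close>, output modulation \<open>x\<close>, input modulations \<open>y\<close>,
  \<open>z\<close>\<close>

context
  fixes n n1 n2 x y z :: real
  assumes n: "0 \<le> n" "1 \<le> n1" "1 \<le> n2" "n \<le> n1 + n2"
    and xyz: "1 \<le> x" "1 \<le> y" "1 \<le> z"
    and resonance: "n * n1 * n2 \<le> 125 * (x + y + z)"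
begin

lemma frequency_le_product: "n \<le> 2 * (n1 * n2)"
proof -
  have "n1 * 1 \<le> n1 * n2" "1 * n2 \<le> n1 * n2"
    using n by (intro mult_mono; simp)+
  then show ?thesis using n by linarith
qed

text \<open>Inserting \<open>n \<le> 2 * (n1 * n2)\<close> in the resonance bound gives
  \<open>n^2 \<le> 250 * (x + y + z)\<close>; 250 is rounded up to \<open>16^2\<close>.\<close>

lemma frequency_le_modulations: "n \<le> 16 * (x powr (1/2) + y powr (1/2) + z powr (1/2))"
proof -
  have "n * n \<le> n * (2 * (n1 * n2))"
    using n by (intro mult_left_mono frequency_le_product)
  also have "\<dots> \<le> 256 * (x + y + z)"
    using resonance xyz by (simp add: ac_simps)
  finally have "n\<^sup>2 \<le> 256 * (x + y + z)"
    by (simp add: power2_eq_square)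
  then have "n \<le> sqrt (256 * (x + y + z))"
    by (rule real_le_rsqrt)
  also have "\<dots> = 16 * sqrt (x + y + z)"
    by (simp only: real_sqrt_mult) simp
  also have "sqrt (x + y + z) \<le> sqrt x + sqrt y + sqrt z"
    using xyz by (meson add_mono_thms_linordered_semiring(3) add_nonneg_nonneg order_trans sqrt_add_le_add_sqrt zero_le_one)
  finally show ?thesis
    using xyz by (simp add: powr_half_sqrt)
qed

text \<open>One term for each modulation that can absorb the derivative. In the last two the weight
  of \<open>x\<close> is relaxed from 1/2 to 7/16 to meet \<open>conv_input_dominant\<close>; the
  constant 750 is the one of \<open>symbol_bound_L1\<close>.\<close>

lemma symbol_bound_L2:
  "n * x powr (-(1/2)) \<le> 750 * (1 + x powr (-(7/16)) * y powr (1/2) + x powr (-(7/16)) * z powr (1/2))"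
proof -
  have "n * x powr (-(1/2)) \<le> 16 * (x powr (1/2) + y powr (1/2) + z powr (1/2)) * x powr (-(1/2))"
    by (intro mult_right_mono frequency_le_modulations) auto
  also have "\<dots> = 16 * (x powr (1/2) * x powr (-(1/2)) + x powr (-(1/2)) * y powr (1/2) + x powr (-(1/2)) * z powr (1/2))"
    by (simp add: algebra_simps)
  also have "x powr (1/2) * x powr (-(1/2)) = 1"
    using xyz by (simp flip: powr_add)
  also have "16 * (1 + x powr (-(1/2)) * y powr (1/2) + x powr (-(1/2)) * z powr (1/2))
      \<le> 750 * (1 + x powr (-(7/16)) * y powr (1/2) + x powr (-(7/16)) * z powr (1/2))"
    using xyz by (intro mult_mono add_mono mult_right_mono powr_mono order_refl) auto
  finally show ?thesis .
qed

text \<open>Dominance of \<open>y\<close> or \<open>z\<close> is settled by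
  \<open>frequency_le_modulations\<close>. When \<open>x\<close> dominates, the full product
  \<open>n * n1 * n2\<close> is used: its power 7/8 pays for \<open>n\<close> up to
  \<open>n powr (1/8)\<close> and still leaves decay in both input frequencies.\<close>

lemma symbol_bound_L1:
  "n * x powr (- 1) \<le> 750 * ((n1 powr (-(3/4)) * y powr (-(1/16))) * (n2 powr (-(3/4)) * z powr (-(1/16)))
      + x powr (- 1) * y powr (1/2) + x powr (- 1) * z powr (1/2))" (is "_ \<le> 750 * (?A + ?B + ?C)")
proof -
  have nonneg: "0 \<le> ?A" "0 \<le> ?B" "0 \<le> ?C" by auto
  consider "n = 0" | "0 < n" "y \<le> x" "z \<le> x" | "x \<le> y" "z \<le> y" | "x \<le> z" "y \<le> z"
    using n by fastforce
  then show ?thesis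
  proof cases
    case 1
    with nonneg show ?thesis by simp
  next
    case 2
    let ?P = "n * n1 * n2"
    have P: "0 < ?P" "?P / 375 \<le> x"
      using 2 n resonance by auto
    \<comment> \<open>The exponent 1 is cut into 7/8 for the resonance, where
      \<open>x \<ge> ?P / 375\<close> because \<open>3 * 125 = 375\<close>, and two pieces 1/16, one
      for each input.\<close>
    have "n * x powr (- 1) = n * x powr (-(7/8)) * (x powr (-(1/16)) * x powr (-(1/16)))"
      by (simp add: mult.assoc del: powr_neg_one' flip: powr_add)
    also have "\<dots> \<le> n * (?P / 375) powr (-(7/8)) * (y powr (-(1/16)) * z powr (-(1/16)))"
      using 2 P xyz by (intro mult_mono powr_mono_nonpos) auto
    also have "n * (?P / 375) powr (-(7/8)) \<le> 750 * (n1 powr (-(3/4)) * n2 powr (-(3/4)))"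
    proof -
      have "n * (?P / 375) powr (-(7/8)) = 375 powr (7/8) * (n powr 1 * n powr (-(7/8))) * (n1 * n2) powr (-(7/8))"
        using 2 n by (simp add: powr_divide powr_mult powr_minus divide_simps)
      also have "n powr 1 * n powr (-(7/8)) = n powr (1/8)"
        by (simp only: powr_add[symmetric]) simp
      \<comment> \<open>The leftover \<open>n powr (1/8)\<close> is traded for a power of
        \<open>n1 * n2\<close>, which weakens the exponent 7/8 to 3/4, still square summable.
        Rounding the powers of 375 and 2 up to the first power gives 750.\<close>
      also have "375 powr (7/8) * n powr (1/8) * (n1 * n2) powr (-(7/8))
          \<le> 375 powr 1 * (2 * (n1 * n2)) powr (1/8) * (n1 * n2) powr (-(7/8))"
        using n by (intro mult_right_mono mult_mono powr_mono powr_mono2 frequency_le_product) auto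
      also have "\<dots> = 375 * 2 powr (1/8) * ((n1 * n2) powr (1/8) * (n1 * n2) powr (-(7/8)))"
        using n by (simp add: powr_mult)
      also have "(n1 * n2) powr (1/8) * (n1 * n2) powr (-(7/8)) = (n1 * n2) powr (-(3/4))"
        by (simp flip: powr_add)
      also have "375 * 2 powr (1/8) * (n1 * n2) powr (-(3/4)) \<le> 375 * 2 powr 1 * (n1 * n2) powr (-(3/4))"
        by (intro mult_right_mono mult_left_mono powr_mono) auto
      finally show ?thesis
        using n by (simp add: powr_mult)
    qed
    then have "n * (?P / 375) powr (-(7/8)) * (y powr (-(1/16)) * z powr (-(1/16))) 
        \<le> 750 * (n1 powr (-(3/4)) * n2 powr (-(3/4))) * (y powr (-(1/16)) * z powr (-(1/16)))"
      by (rule mult_right_mono) auto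
    also have "\<dots> = 750 * ?A"
      by (simp add: ac_simps)
    also have "\<dots> \<le> 750 * (?A + ?B + ?C)"
      by (intro mult_left_mono) auto
    finally show ?thesis .
  next
    case 3
    have "n \<le> 16 * (y powr (1/2) + y powr (1/2) + y powr (1/2))"
      using 3 xyz by (intro order_trans[OF frequency_le_modulations] mult_left_mono add_mono powr_mono2) auto
    then have "n * x powr (- 1) \<le> (16 * (y powr (1/2) + y powr (1/2) + y powr (1/2))) * x powr (- 1)"
      by (rule mult_right_mono) auto
    also have "\<dots> = 48 * ?B"
      by (simp del: powr_neg_one')
    also have "\<dots> \<le> 750 * (?A + ?B + ?C)"
      using nonneg by argo
    finally show ?thesis .
  next
    case 4
    have "n \<le> 16 * (z powr (1/2) + z powr (1/2) + z powr (1/2))"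
      using 4 xyz by (intro order_trans[OF frequency_le_modulations] mult_left_mono add_mono powr_mono2) auto
    then have "n * x powr (- 1) \<le> (16 * (z powr (1/2) + z powr (1/2) + z powr (1/2))) * x powr (- 1)"
      by (rule mult_right_mono) auto
    also have "\<dots> = 48 * ?C"
      by (simp del: powr_neg_one')
    also have "\<dots> \<le> 750 * (?A + ?B + ?C)"
      using nonneg by argo
    finally show ?thesis .
  qed
qed

end

section \<open>Convolution estimates\<close>

definition modweight :: "nat \<Rightarrow> real \<Rightarrow> real \<Rightarrow> int \<Rightarrow> real \<Rightarrow> ennreal"
  where "modweight N sg p k \<tau> = ennreal (jbracket (\<tau> - sg * dphase N k) powr p)"

lemma measurable_modweight [measurable]: "modweight N sg p k \<in> borel_measurable borel"
  unfolding modweight_def by measurable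

lemma modweight_add: "modweight N sg p k \<tau> * modweight N sg q k \<tau> = modweight N sg (p + q) k \<tau>"
  by (simp add: modweight_def powr_add flip: ennreal_mult)

lemma modweight_sq: "(modweight N sg p k \<tau>)\<^sup>2 = modweight N sg (2 * p) k \<tau>"
  by (simp add: power2_eq_square modweight_add)

lemma modweight_mono: "p \<le> q \<Longrightarrow> modweight N sg p k \<tau> \<le> modweight N sg q k \<tau>"
  unfolding modweight_def by (intro ennreal_leI powr_mono jbracket_ge_1)

lemma nn_integral_modweight: "(\<integral>\<^sup>+\<tau>. modweight N sg (-(9/8)) k \<tau> \<partial>lborel) = ennreal jbracket_mass"
  unfolding modweight_def by (rule nn_integral_jbracket_shift)

text \<open>Convolution on the dual group times the line, for nonnegative extended functions, so
  that Tonelli applies without integrability conditions.\<close>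

definition cyc_conv :: "nat \<Rightarrow> (int \<Rightarrow> real \<Rightarrow> ennreal) \<Rightarrow> (int \<Rightarrow> real \<Rightarrow> ennreal) \<Rightarrow> int \<Rightarrow> real \<Rightarrow> ennreal"
  where "cyc_conv N f g k \<tau> = (\<Sum>k1\<in>dfreq N. \<integral>\<^sup>+\<tau>1. f k1 \<tau>1 * g (cyc N (k - k1)) (\<tau> - \<tau>1) \<partial>lborel)"

lemma measurable_cyc_conv [measurable]:
  assumes [measurable]: "\<And>k. f k \<in> borel_measurable borel" "\<And>k. g k \<in> borel_measurable borel"
  shows "cyc_conv N f g k \<in> borel_measurable borel"
  unfolding cyc_conv_def by measurable

lemma nn_integral_reflect:
  fixes f :: "real \<Rightarrow> ennreal"
  assumes [measurable]: "f \<in> borel_measurable borel"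
  shows "(\<integral>\<^sup>+x. f (t - x) \<partial>lborel) = (\<integral>\<^sup>+x. f x \<partial>lborel)"
  by (subst nn_integral_real_affine[where f=f and c="-1" and t=t]) auto

lemma nn_integral_translate:
  fixes f :: "real \<Rightarrow> ennreal"
  assumes [measurable]: "f \<in> borel_measurable borel"
  shows "(\<integral>\<^sup>+x. f (x - t) \<partial>lborel) = (\<integral>\<^sup>+x. f x \<partial>lborel)"
  by (subst nn_integral_real_affine[where c=1 and t=t]) auto

lemma cyc_conv_commute:
  assumes "0 < N" and [measurable]: "\<And>k. f k \<in> borel_measurable borel" "\<And>k. g k \<in> borel_measurable borel"
  shows "cyc_conv N f g k \<tau> = cyc_conv N g f k \<tau>"
proof -
  have "cyc_conv N f g k \<tau> = (\<Sum>j\<in>dfreq N. \<integral>\<^sup>+\<tau>1. f (cyc N (k - j)) \<tau>1 * g (cyc N (k - cyc N (k - j))) (\<tau> - \<tau>1) \<partial>lborel)"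
    unfolding cyc_conv_def using assms(1) by (rule sum_dfreq_reflect[symmetric])
  also have "\<dots> = (\<Sum>j\<in>dfreq N. \<integral>\<^sup>+\<tau>1. f (cyc N (k - j)) \<tau>1 * g j (\<tau> - \<tau>1) \<partial>lborel)"
    by (intro sum.cong refl) (simp add: cyc_diff_cyc_diff)
  also have "\<dots> = cyc_conv N g f k \<tau>"
    unfolding cyc_conv_def
    by (intro sum.cong refl, subst nn_integral_reflect[where t=\<tau>, symmetric]) (auto simp: ac_simps)
  finally show ?thesis .
qed

lemma nn_integral_cyc_conv:
  assumes [measurable]: "\<And>k. f k \<in> borel_measurable borel" "\<And>k. g k \<in> borel_measurable borel"
  shows "(\<integral>\<^sup>+\<tau>. cyc_conv N f g k \<tau> \<partial>lborel)
    = (\<Sum>k1\<in>dfreq N. (\<integral>\<^sup>+\<tau>. f k1 \<tau> \<partial>lborel) * (\<integral>\<^sup>+\<tau>. g (cyc N (k - k1)) \<tau> \<partial>lborel))"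
proof -
  have "(\<integral>\<^sup>+\<tau>. cyc_conv N f g k \<tau> \<partial>lborel)
    = (\<Sum>k1\<in>dfreq N. \<integral>\<^sup>+\<tau>. \<integral>\<^sup>+\<tau>1. f k1 \<tau>1 * g (cyc N (k - k1)) (\<tau> - \<tau>1) \<partial>lborel \<partial>lborel)"
    unfolding cyc_conv_def by (subst nn_integral_sum) auto
  also have "\<dots> = (\<Sum>k1\<in>dfreq N. \<integral>\<^sup>+\<tau>1. \<integral>\<^sup>+\<tau>. f k1 \<tau>1 * g (cyc N (k - k1)) (\<tau> - \<tau>1) \<partial>lborel \<partial>lborel)"
    by (intro sum.cong refl lborel_pair.Fubini') auto
  also have "\<dots> = (\<Sum>k1\<in>dfreq N. (\<integral>\<^sup>+\<tau>. f k1 \<tau> \<partial>lborel) * (\<integral>\<^sup>+\<tau>. g (cyc N (k - k1)) \<tau> \<partial>lborel))"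
    by (intro sum.cong refl) (simp add: nn_integral_cmult nn_integral_multc nn_integral_translate)
  finally show ?thesis .
qed

lemma sum_cyc_mult:
  fixes p q :: "int \<Rightarrow> ennreal"
  assumes "0 < N"
  shows "(\<Sum>k\<in>dfreq N. \<Sum>k1\<in>dfreq N. p k1 * q (cyc N (k - k1))) = (\<Sum>k\<in>dfreq N. p k) * (\<Sum>k\<in>dfreq N. q k)"
  by (subst sum.swap) (simp add: assms sum_dfreq_shift sum_distrib_right flip: sum_distrib_left)

lemma sum_nn_integral_cyc_conv:
  assumes "0 < N" and [measurable]: "\<And>k. f k \<in> borel_measurable borel" "\<And>k. g k \<in> borel_measurable borel"
  shows "(\<Sum>k\<in>dfreq N. \<integral>\<^sup>+\<tau>. cyc_conv N f g k \<tau> \<partial>lborel)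
    = (\<Sum>k\<in>dfreq N. \<integral>\<^sup>+\<tau>. f k \<tau> \<partial>lborel) * (\<Sum>k\<in>dfreq N. \<integral>\<^sup>+\<tau>. g k \<tau> \<partial>lborel)"
  using sum_cyc_mult[OF assms(1), of "\<lambda>k. \<integral>\<^sup>+\<tau>. f k \<tau> \<partial>lborel" "\<lambda>k. \<integral>\<^sup>+\<tau>. g k \<tau> \<partial>lborel"]
  by (simp add: nn_integral_cyc_conv)

text \<open>\<open>Cp\<close> and \<open>Cz\<close> are parameters next to \<open>N\<close> and
  \<open>sg\<close>: the constants derived here depend on them and on \<open>s\<close> alone, which
  carries the uniformity in the mesh to the end.\<close>

locale dispersion =
  fixes N :: nat and sg Cp Cz :: real
  assumes N: "0 < N" and sg: "sg = 1 \<or> sg = - 1" and Cp: "0 \<le> Cp" and Cz: "0 \<le> Cz"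
    and pair_sum: "\<And>S (m::int \<Rightarrow> int) K A. S \<subseteq> {- int N..int N} \<Longrightarrow> K \<noteq> 0 \<Longrightarrow> \<bar>K\<bar> \<le> int N \<Longrightarrow>
       (\<And>j. j \<in> S \<Longrightarrow> \<bar>m j\<bar> \<le> int N \<and> j + m j \<in> {K, K + 2 * int N, K - 2 * int N}) \<Longrightarrow>
       (\<Sum>j\<in>S. jbracket (A - (dphase N j + dphase N (m j))) powr (-(3/4))) \<le> Cp"
    and powr_sum: "\<And>S::int set. finite S \<Longrightarrow> (\<Sum>j\<in>S. \<bar>real_of_int j\<bar> powr (-(3/2))) \<le> Cz"
begin

abbreviation "D \<equiv> dfreq N"
abbreviation "W \<equiv> modweight N sg"
abbreviation "conv \<equiv> cyc_conv N"
abbreviation "C0 \<equiv> ennreal (4 * jbracket_mass * Cp)"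

lemma jbracket_sg: "jbracket (sg * x - y) = jbracket (x - sg * y)"
  using sg by (auto simp: jbracket_sqrt power2_eq_square algebra_simps)

text \<open>Integration in \<open>x\<close> leaves the bracket of the distance between the two
  centres, which is the distance from \<open>sg * A\<close> to the phase sum of \<open>j\<close> and
  \<open>m j\<close>; then \<open>pair_sum\<close> applies. The map \<open>m\<close> is kept general
  because fixing the output and fixing an input lead to different partners of
  \<open>j\<close>.\<close>

lemma kernel_sum:
  assumes "K \<noteq> 0" "\<bar>K\<bar> \<le> int N"
    and m: "\<And>j. j \<in> D \<Longrightarrow> \<bar>m j\<bar> \<le> int N \<and> j + m j \<in> {K, K + 2 * int N, K - 2 * int N}"
  shows "(\<Sum>j\<in>D. \<integral>\<^sup>+x. ennreal (jbracket (x - sg * dphase N j) powr (-(7/8))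
        * jbracket (x - (A - sg * dphase N (m j))) powr (- 1)) \<partial>lborel) \<le> C0"
proof -
  have "(\<Sum>j\<in>D. \<integral>\<^sup>+x. ennreal (jbracket (x - sg * dphase N j) powr (-(7/8))
        * jbracket (x - (A - sg * dphase N (m j))) powr (- 1)) \<partial>lborel)
    \<le> (\<Sum>j\<in>D. ennreal (4 * jbracket_mass * jbracket (sg * dphase N j - (A - sg * dphase N (m j))) powr (-(3/4))))"
    by (intro sum_mono jbracket_kernel)
  also have "\<dots> = ennreal (4 * jbracket_mass * (\<Sum>j\<in>D. jbracket (sg * dphase N j - (A - sg * dphase N (m j))) powr (-(3/4))))"
    by (simp add: sum_distrib_left)
  also have "(\<Sum>j\<in>D. jbracket (sg * dphase N j - (A - sg * dphase N (m j))) powr (-(3/4)))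
      = (\<Sum>j\<in>D. jbracket (sg * A - (dphase N j + dphase N (m j))) powr (-(3/4)))"
  proof (intro sum.cong refl)
    fix j
    have "jbracket (sg * A - (dphase N j + dphase N (m j))) = jbracket (- (A - sg * (dphase N j + dphase N (m j))))"
      by (simp only: jbracket_sg jbracket_minus)
    then show "jbracket (sg * dphase N j - (A - sg * dphase N (m j))) powr (-(3/4))
      = jbracket (sg * A - (dphase N j + dphase N (m j))) powr (-(3/4))"
      by (simp add: algebra_simps)
  qed
  also have "ennreal (4 * jbracket_mass * \<dots>) \<le> C0"
    using assms by (intro ennreal_leI mult_left_mono pair_sum[where K=K]) (auto simp: dfreq_def)
  finally show ?thesis .
qed

lemma kernel_sum_output:
  assumes k: "k \<in> D" "k \<noteq> 0"
  shows "(\<Sum>k1\<in>D. \<integral>\<^sup>+\<tau>1. W (- 1) k1 \<tau>1 * W (- 1) (cyc N (k - k1)) (\<tau> - \<tau>1) \<partial>lborel) \<le> C0"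
proof -
  have "(\<Sum>k1\<in>D. \<integral>\<^sup>+\<tau>1. W (- 1) k1 \<tau>1 * W (- 1) (cyc N (k - k1)) (\<tau> - \<tau>1) \<partial>lborel)
    \<le> (\<Sum>k1\<in>D. \<integral>\<^sup>+x. ennreal (jbracket (x - sg * dphase N k1) powr (-(7/8))
        * jbracket (x - (\<tau> - sg * dphase N (cyc N (k - k1)))) powr (- 1)) \<partial>lborel)"
  proof (intro sum_mono nn_integral_mono)
    fix k1 x
    \<comment> \<open>The first weight is relaxed to 7/8 so that one kernel bound serves here and in
      \<open>kernel_sum_input\<close>.\<close>
    have "W (- 1) k1 x * W (- 1) (cyc N (k - k1)) (\<tau> - x)
        \<le> W (-(7/8)) k1 x * W (- 1) (cyc N (k - k1)) (\<tau> - x)"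
      by (intro mult_right_mono modweight_mono) auto
    also have "\<dots> = ennreal (jbracket (x - sg * dphase N k1) powr (-(7/8))
        * jbracket (- (x - (\<tau> - sg * dphase N (cyc N (k - k1))))) powr (- 1))"
      unfolding modweight_def by (simp add: algebra_simps flip: ennreal_mult)
    finally show "W (- 1) k1 x * W (- 1) (cyc N (k - k1)) (\<tau> - x)
        \<le> ennreal (jbracket (x - sg * dphase N k1) powr (-(7/8))
        * jbracket (x - (\<tau> - sg * dphase N (cyc N (k - k1)))) powr (- 1))"
      by (simp only: jbracket_minus)
  qed
  also have "\<dots> \<le> C0"
    using k N cyc_diff_aliases[OF N k(1)]
    by (intro kernel_sum[where K=k]) (auto simp: dfreq_abs_le)
  finally show ?thesis .
qed

text \<open>Up to aliasing \<open>k - cyc N (k - k1)\<close> equals \<open>k1\<close>, so the input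
  now plays the part of the fixed sum. The partner of \<open>k\<close> is a negated frequency,
  brought in by the oddness of the phase.\<close>

lemma kernel_sum_input:
  assumes k1: "k1 \<in> D" "k1 \<noteq> 0"
  shows "(\<Sum>k\<in>D. \<integral>\<^sup>+\<tau>. W (-(7/8)) k \<tau> * W (- 1) (cyc N (k - k1)) (\<tau> - \<tau>1) \<partial>lborel) \<le> C0"
proof -
  have "(\<Sum>k\<in>D. \<integral>\<^sup>+\<tau>. W (-(7/8)) k \<tau> * W (- 1) (cyc N (k - k1)) (\<tau> - \<tau>1) \<partial>lborel)
    = (\<Sum>k\<in>D. \<integral>\<^sup>+x. ennreal (jbracket (x - sg * dphase N k) powr (-(7/8))
        * jbracket (x - (\<tau>1 - sg * dphase N (- cyc N (k - k1)))) powr (- 1)) \<partial>lborel)"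
    unfolding modweight_def
    by (intro sum.cong refl nn_integral_cong)
       (simp add: dphase_minus algebra_simps flip: ennreal_mult)
  also have "\<dots> \<le> C0"
  proof (rule kernel_sum[where K=k1])
    fix j assume j: "j \<in> D"
    from cyc_diff_aliases[OF N j k1(1)] dfreq_abs_le[OF cyc_in_dfreq[OF N, of "j - k1"]]
    show "\<bar>- cyc N (j - k1)\<bar> \<le> int N \<and> j + - cyc N (j - k1) \<in> {k1, k1 + 2 * int N, k1 - 2 * int N}"
      by auto
  qed (use k1 dfreq_abs_le in auto)
  finally show ?thesis .
qed

context
  fixes a b :: "int \<Rightarrow> real \<Rightarrow> ennreal"
  assumes [measurable]: "\<And>k. a k \<in> borel_measurable borel" "\<And>k. b k \<in> borel_measurable borel"
begin

abbreviation "mass f \<equiv> (\<Sum>k\<in>D. \<integral>\<^sup>+\<tau>. (f k \<tau>)\<^sup>2 \<partial>lborel)"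

text \<open>Cauchy-Schwarz puts both modulation weights into one kernel, bounded uniformly in the
  output, and leaves a convolution of squares whose mass factors. Output zero is excluded because
  there all pairs \<open>j\<close>, \<open>- j\<close> have phase sum zero and nothing separates
  them.\<close>

lemma conv_output_dominant:
  "(\<Sum>k\<in>D - {0}. \<integral>\<^sup>+\<tau>. (conv (\<lambda>k \<tau>. a k \<tau> * W (-(1/2)) k \<tau>) (\<lambda>k \<tau>. b k \<tau> * W (-(1/2)) k \<tau>) k \<tau>)\<^sup>2 \<partial>lborel)
    \<le> C0 * (mass a * mass b)"
proof -
  let ?a2 = "\<lambda>k \<tau>. (a k \<tau>)\<^sup>2" and ?b2 = "\<lambda>k \<tau>. (b k \<tau>)\<^sup>2"
  have pt: "(conv (\<lambda>k \<tau>. a k \<tau> * W (-(1/2)) k \<tau>) (\<lambda>k \<tau>. b k \<tau> * W (-(1/2)) k \<tau>) k \<tau>)\<^sup>2 \<le> C0 * conv ?a2 ?b2 k \<tau>"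
    if k: "k \<in> D" "k \<noteq> 0" for k \<tau>
  proof -
    have "(conv (\<lambda>k \<tau>. a k \<tau> * W (-(1/2)) k \<tau>) (\<lambda>k \<tau>. b k \<tau> * W (-(1/2)) k \<tau>) k \<tau>)\<^sup>2
      = (\<Sum>k1\<in>D. \<integral>\<^sup>+\<tau>1. (W (-(1/2)) k1 \<tau>1 * W (-(1/2)) (cyc N (k - k1)) (\<tau> - \<tau>1))
            * (a k1 \<tau>1 * b (cyc N (k - k1)) (\<tau> - \<tau>1)) \<partial>lborel)\<^sup>2"
      by (simp add: cyc_conv_def ac_simps)
    also have "\<dots> \<le> (\<Sum>k1\<in>D. \<integral>\<^sup>+\<tau>1. (W (-(1/2)) k1 \<tau>1 * W (-(1/2)) (cyc N (k - k1)) (\<tau> - \<tau>1))\<^sup>2 \<partial>lborel)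
        * (\<Sum>k1\<in>D. \<integral>\<^sup>+\<tau>1. (a k1 \<tau>1 * b (cyc N (k - k1)) (\<tau> - \<tau>1))\<^sup>2 \<partial>lborel)"
      by (rule nn_integral_sum_Cauchy_Schwarz) auto
    also have "\<dots> \<le> C0 * conv ?a2 ?b2 k \<tau>"
      using kernel_sum_output[OF k, of \<tau>]
      by (intro mult_mono) (simp_all add: power_mult_distrib modweight_sq cyc_conv_def)
    finally show ?thesis .
  qed
  have "(\<Sum>k\<in>D - {0}. \<integral>\<^sup>+\<tau>. (conv (\<lambda>k \<tau>. a k \<tau> * W (-(1/2)) k \<tau>) (\<lambda>k \<tau>. b k \<tau> * W (-(1/2)) k \<tau>) k \<tau>)\<^sup>2 \<partial>lborel)
    \<le> (\<Sum>k\<in>D - {0}. \<integral>\<^sup>+\<tau>. C0 * conv ?a2 ?b2 k \<tau> \<partial>lborel)"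
    by (intro sum_mono nn_integral_mono pt) auto
  also have "\<dots> \<le> (\<Sum>k\<in>D. \<integral>\<^sup>+\<tau>. C0 * conv ?a2 ?b2 k \<tau> \<partial>lborel)"
    by (intro sum_mono2) auto
  also have "\<dots> = C0 * (mass a * mass b)"
    using sum_nn_integral_cyc_conv[OF N, of ?a2 ?b2]
    by (simp add: nn_integral_cmult flip: sum_distrib_left)
  finally show ?thesis .
qed

text \<open>The weight of the dominant input factor is not available; integrating in the output variable
  first lets the output modulation take its place.\<close>

lemma conv_input_dominant:
  assumes a0: "\<And>\<tau>. a 0 \<tau> = 0"
  shows "(\<Sum>k\<in>D. \<integral>\<^sup>+\<tau>. (W (-(7/16)) k \<tau> * conv a (\<lambda>k \<tau>. b k \<tau> * W (-(1/2)) k \<tau>) k \<tau>)\<^sup>2 \<partial>lborel)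
    \<le> C0 * (mass a * mass b)"
proof -
  have pt: "(W (-(7/16)) k \<tau> * conv a (\<lambda>k \<tau>. b k \<tau> * W (-(1/2)) k \<tau>) k \<tau>)\<^sup>2
      \<le> (\<Sum>k1\<in>D. \<integral>\<^sup>+\<tau>1. (a k1 \<tau>1)\<^sup>2 * (W (-(7/8)) k \<tau> * W (- 1) (cyc N (k - k1)) (\<tau> - \<tau>1)) \<partial>lborel) * mass b"
    if "k \<in> D" for k \<tau>
  proof -
    have "W (-(7/16)) k \<tau> * conv a (\<lambda>k \<tau>. b k \<tau> * W (-(1/2)) k \<tau>) k \<tau>
      = (\<Sum>k1\<in>D. \<integral>\<^sup>+\<tau>1. (a k1 \<tau>1 * (W (-(7/16)) k \<tau> * W (-(1/2)) (cyc N (k - k1)) (\<tau> - \<tau>1)))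
            * b (cyc N (k - k1)) (\<tau> - \<tau>1) \<partial>lborel)"
      unfolding cyc_conv_def sum_distrib_left
      by (intro sum.cong refl, subst nn_integral_cmult[symmetric]) (auto simp: ac_simps)
    then have "(W (-(7/16)) k \<tau> * conv a (\<lambda>k \<tau>. b k \<tau> * W (-(1/2)) k \<tau>) k \<tau>)\<^sup>2
      \<le> (\<Sum>k1\<in>D. \<integral>\<^sup>+\<tau>1. (a k1 \<tau>1 * (W (-(7/16)) k \<tau> * W (-(1/2)) (cyc N (k - k1)) (\<tau> - \<tau>1)))\<^sup>2 \<partial>lborel)
        * (\<Sum>k1\<in>D. \<integral>\<^sup>+\<tau>1. (b (cyc N (k - k1)) (\<tau> - \<tau>1))\<^sup>2 \<partial>lborel)"
      by (simp only:) (rule nn_integral_sum_Cauchy_Schwarz; measurable)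
    also have "(\<Sum>k1\<in>D. \<integral>\<^sup>+\<tau>1. (b (cyc N (k - k1)) (\<tau> - \<tau>1))\<^sup>2 \<partial>lborel) = mass b"
      by (subst sum_dfreq_reflect[OF N]) (simp add: nn_integral_reflect[where f="\<lambda>x. (b _ x)\<^sup>2"])
    finally show ?thesis
      by (simp add: power_mult_distrib modweight_sq)
  qed
  have "(\<Sum>k\<in>D. \<integral>\<^sup>+\<tau>. (W (-(7/16)) k \<tau> * conv a (\<lambda>k \<tau>. b k \<tau> * W (-(1/2)) k \<tau>) k \<tau>)\<^sup>2 \<partial>lborel)
    \<le> (\<Sum>k\<in>D. \<integral>\<^sup>+\<tau>. (\<Sum>k1\<in>D. \<integral>\<^sup>+\<tau>1. (a k1 \<tau>1)\<^sup>2 * (W (-(7/8)) k \<tau> * W (- 1) (cyc N (k - k1)) (\<tau> - \<tau>1)) \<partial>lborel) * mass b \<partial>lborel)"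
    by (intro sum_mono nn_integral_mono pt)
  also have "\<dots> = (\<Sum>k\<in>D. \<Sum>k1\<in>D. \<integral>\<^sup>+\<tau>. \<integral>\<^sup>+\<tau>1. (a k1 \<tau>1)\<^sup>2 * (W (-(7/8)) k \<tau> * W (- 1) (cyc N (k - k1)) (\<tau> - \<tau>1)) \<partial>lborel \<partial>lborel) * mass b"
    by (simp add: nn_integral_multc nn_integral_sum sum_distrib_right)
  also have "(\<Sum>k\<in>D. \<Sum>k1\<in>D. \<integral>\<^sup>+\<tau>. \<integral>\<^sup>+\<tau>1. (a k1 \<tau>1)\<^sup>2 * (W (-(7/8)) k \<tau> * W (- 1) (cyc N (k - k1)) (\<tau> - \<tau>1)) \<partial>lborel \<partial>lborel)
    = (\<Sum>k\<in>D. \<Sum>k1\<in>D. \<integral>\<^sup>+\<tau>1. \<integral>\<^sup>+\<tau>. (a k1 \<tau>1)\<^sup>2 * (W (-(7/8)) k \<tau> * W (- 1) (cyc N (k - k1)) (\<tau> - \<tau>1)) \<partial>lborel \<partial>lborel)"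
    by (intro sum.cong refl lborel_pair.Fubini') auto
  also have "\<dots> = (\<Sum>k1\<in>D. \<integral>\<^sup>+\<tau>1. (a k1 \<tau>1)\<^sup>2 * (\<Sum>k\<in>D. \<integral>\<^sup>+\<tau>. W (-(7/8)) k \<tau> * W (- 1) (cyc N (k - k1)) (\<tau> - \<tau>1) \<partial>lborel) \<partial>lborel)"
    by (subst sum.swap) (simp add: nn_integral_cmult nn_integral_sum sum_distrib_left)
  also have "\<dots> \<le> (\<Sum>k1\<in>D. \<integral>\<^sup>+\<tau>1. (a k1 \<tau>1)\<^sup>2 * C0 \<partial>lborel)"
  proof (intro sum_mono nn_integral_mono)
    \<comment> \<open>The kernel bound requires a nonzero input frequency; at zero \<open>a\<close>
      vanishes.\<close>
    fix k1 \<tau>1 assume "k1 \<in> D"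
    then show "(a k1 \<tau>1)\<^sup>2 * (\<Sum>k\<in>D. \<integral>\<^sup>+\<tau>. W (-(7/8)) k \<tau> * W (- 1) (cyc N (k - k1)) (\<tau> - \<tau>1) \<partial>lborel)
      \<le> (a k1 \<tau>1)\<^sup>2 * C0"
      by (cases "k1 = 0") (auto simp: a0 intro!: mult_left_mono kernel_sum_input)
  qed
  also have "\<dots> = C0 * mass a"
    by (simp add: nn_integral_multc ac_simps flip: sum_distrib_left)
  finally show ?thesis
    by (simp add: ac_simps mult_right_mono)
qed

text \<open>In L1 the convolution in time decouples into products of integrals, each controlled in
  L2 by Cauchy-Schwarz against the exponent 9/8. A discrete convolution remains, in which the
  frequency weight of the first factor is square summable.\<close>

lemma conv_L1:
  "(\<Sum>k\<in>D. (\<integral>\<^sup>+\<tau>. conv (\<lambda>k \<tau>. ennreal (\<bar>real_of_int k\<bar> powr (-(3/4))) * (a k \<tau> * W (-(9/16)) k \<tau>))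
       (\<lambda>k \<tau>. ennreal (\<bar>real_of_int k\<bar> powr (-(3/4))) * (b k \<tau> * W (-(9/16)) k \<tau>)) k \<tau> \<partial>lborel)\<^sup>2)
    \<le> ennreal (Cz * jbracket_mass\<^sup>2) * (mass a * mass b)"
proof -
  define z where "z k = ennreal (\<bar>real_of_int k\<bar> powr (-(3/4)))" for k :: int
  define I where "I f k = (\<integral>\<^sup>+\<tau>. f k \<tau> * W (-(9/16)) k \<tau> \<partial>lborel)" for f :: "int \<Rightarrow> real \<Rightarrow> ennreal" and k
  \<comment> \<open>Applied to the second frequency weight; at \<open>k = 0\<close> the weight is 0,
    being a power of 0.\<close>
  have z1: "z k \<le> 1" for k
  proof (cases "k = 0")
    case False
    then have "1 \<le> \<bar>real_of_int k\<bar>" by linarith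
    then have "\<bar>real_of_int k\<bar> powr (-(3/4)) \<le> 1 powr (-(3/4))"
      by (intro powr_mono_nonpos) auto
    then show ?thesis by (simp add: z_def)
  qed (simp add: z_def)
  have I: "(I f k)\<^sup>2 \<le> (\<integral>\<^sup>+\<tau>. (f k \<tau>)\<^sup>2 \<partial>lborel) * ennreal jbracket_mass"
    if [measurable]: "\<And>k. f k \<in> borel_measurable borel" for f k
  proof -
    have "(I f k)\<^sup>2 \<le> (\<integral>\<^sup>+\<tau>. (f k \<tau>)\<^sup>2 \<partial>lborel) * (\<integral>\<^sup>+\<tau>. (W (-(9/16)) k \<tau>)\<^sup>2 \<partial>lborel)"
      unfolding I_def by (rule Cauchy_Schwarz_nn_integral) auto
    then show ?thesis
      using nn_integral_modweight[of N sg k] by (simp add: modweight_sq)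
  qed
  have "(\<Sum>k\<in>D. (\<integral>\<^sup>+\<tau>. conv (\<lambda>k \<tau>. z k * (a k \<tau> * W (-(9/16)) k \<tau>)) (\<lambda>k \<tau>. z k * (b k \<tau> * W (-(9/16)) k \<tau>)) k \<tau> \<partial>lborel)\<^sup>2)
    = (\<Sum>k\<in>D. (\<Sum>k1\<in>D. (z k1 * I a k1) * (z (cyc N (k - k1)) * I b (cyc N (k - k1))))\<^sup>2)"
    by (simp add: nn_integral_cyc_conv I_def nn_integral_cmult)
  also have "\<dots> \<le> (\<Sum>k\<in>D. (\<Sum>k1\<in>D. (z k1)\<^sup>2) * (\<Sum>k1\<in>D. (I a k1)\<^sup>2 * (I b (cyc N (k - k1)))\<^sup>2))"
  proof (intro sum_mono ennreal_sum_Cauchy_Schwarz finite_dfreq)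
    fix k k1
    have "((z k1 * I a k1) * (z (cyc N (k - k1)) * I b (cyc N (k - k1))))\<^sup>2
        \<le> ((z k1 * I a k1) * (1 * I b (cyc N (k - k1))))\<^sup>2"
      by (intro power_mono mult_left_mono mult_right_mono z1) auto
    then show "((z k1 * I a k1) * (z (cyc N (k - k1)) * I b (cyc N (k - k1))))\<^sup>2
        \<le> (z k1)\<^sup>2 * ((I a k1)\<^sup>2 * (I b (cyc N (k - k1)))\<^sup>2)"
      by (simp add: power_mult_distrib ac_simps)
  qed
  also have "\<dots> = (\<Sum>k1\<in>D. (z k1)\<^sup>2) * ((\<Sum>k\<in>D. (I a k)\<^sup>2) * (\<Sum>k\<in>D. (I b k)\<^sup>2))"
    using sum_cyc_mult[OF N, of "\<lambda>k. (I a k)\<^sup>2" "\<lambda>k. (I b k)\<^sup>2"]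
    by (simp flip: sum_distrib_left)
  also have "\<dots> \<le> ennreal Cz * ((mass a * ennreal jbracket_mass) * (mass b * ennreal jbracket_mass))"
  proof (intro mult_mono)
    have "(\<Sum>k1\<in>D. (z k1)\<^sup>2) = ennreal (\<Sum>k1\<in>D. \<bar>real_of_int k1\<bar> powr (-(3/2)))"
      by (simp add: z_def power2_eq_square flip: ennreal_mult powr_add)
    also have "\<dots> \<le> ennreal Cz"
      by (intro ennreal_leI powr_sum) simp
    finally show "(\<Sum>k1\<in>D. (z k1)\<^sup>2) \<le> ennreal Cz" .
  qed (auto simp: sum_distrib_right intro!: sum_mono I)
  also have "\<dots> = ennreal (Cz * jbracket_mass\<^sup>2) * (mass a * mass b)"
    using Cz by (simp add: ennreal_mult power2_eq_square ac_simps)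
  finally show ?thesis by (simp only: z_def)
qed

end

end

section \<open>The bilinear estimate for Fourier transforms\<close>

lemma modweight_0 [simp]: "modweight N sg 0 k \<tau> = 1"
  by (simp add: modweight_def)

lemma ennreal_collect:
  fixes m :: ennreal
  shows "k * (c * (p * m + q * m + r * m)) = k * (c * (p + q + r)) * m"
  by (simp add: distrib_left distrib_right ac_simps)

context dispersion
begin

text \<open>The constants of \<open>bilinear_L2\<close> and \<open>bilinear_L1\<close> added, so
  that one value bounds both. The leading 3 stems from \<open>ennreal_square_sum3\<close>, 750 from
  the symbol bounds and \<open>2 powr s\<close> from the weight of order \<open>s\<close>.\<close>

definition bilinear_const :: "real \<Rightarrow> real"
  where "bilinear_const s = 3 * (750 * 2 powr s)\<^sup>2
    * (3 * (4 * jbracket_mass * Cp) + Cz * jbracket_mass\<^sup>2 + 2 * (jbracket_mass * (4 * jbracket_mass * Cp)))"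

context
  fixes s :: real and F G :: "int \<Rightarrow> real \<Rightarrow> ennreal"
  assumes s: "0 \<le> s"
    and FG [measurable]: "\<And>k. F k \<in> borel_measurable borel" "\<And>k. G k \<in> borel_measurable borel"
    and FG0: "\<And>\<tau>. F 0 \<tau> = 0" "\<And>\<tau>. G 0 \<tau> = 0"
begin

abbreviation "J k \<equiv> ennreal (jbracket (real_of_int k) powr s)"
abbreviation "wF k \<tau> \<equiv> J k * W (1/2) k \<tau> * F k \<tau>"
abbreviation "wG k \<tau> \<equiv> J k * W (1/2) k \<tau> * G k \<tau>"
abbreviation "K \<equiv> 750 * 2 powr s"
abbreviation "symb k \<equiv> ennreal (\<bar>real_of_int k\<bar> * jbracket (real_of_int k) powr s)"

text \<open>When the input modulations are subtracted from the output one, \<open>\<tau>\<close> and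
  \<open>\<tau>1\<close> cancel and the resonance function remains up to sign. Hence the sum of the
  three brackets controls the product of the frequencies, as the symbol bounds assume.\<close>

lemma interaction_bounds:
  fixes k k1 :: int and \<tau> \<tau>1 :: real
  assumes k: "k \<in> D" "k1 \<in> D" "k1 \<noteq> 0" "cyc N (k - k1) \<noteq> 0"
  defines "k2 \<equiv> cyc N (k - k1)"
  defines "x \<equiv> jbracket (\<tau> - sg * dphase N k)" and "y \<equiv> jbracket (\<tau>1 - sg * dphase N k1)"
    and "z \<equiv> jbracket (\<tau> - \<tau>1 - sg * dphase N k2)"
  shows "jbracket k powr s \<le> 2 powr s * (jbracket k1 powr s * jbracket k2 powr s)"
    and "\<bar>real_of_int k\<bar> * x powr (-(1/2)) \<le> 750 * (1 + x powr (-(7/16)) * y powr (1/2) + x powr (-(7/16)) * z powr (1/2))"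
    and "\<bar>real_of_int k\<bar> * x powr (- 1) \<le> 750 *
       ((\<bar>real_of_int k1\<bar> powr (-(3/4)) * y powr (-(1/16))) * (\<bar>real_of_int k2\<bar> powr (-(3/4)) * z powr (-(1/16)))
      + x powr (- 1) * y powr (1/2) + x powr (- 1) * z powr (1/2))"
proof -
  have k2: "k2 \<in> D" "k2 \<noteq> 0"
    using k N by (simp_all add: k2_def)
  note le = dfreq_abs_le[OF k(1)] dfreq_abs_le[OF k(2)] dfreq_abs_le[OF k2(1)]
  have aliases: "k1 + k2 \<in> {k, k + 2 * int N, k - 2 * int N}"
    unfolding k2_def using k N by (intro cyc_diff_aliases)
  \<comment> \<open>Under aliasing \<open>\<bar>k1 + k2\<bar>\<close> is at least
    \<open>2 * N - \<bar>k\<bar>\<close>, which is no less than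
    \<open>\<bar>k\<bar>\<close>.\<close>
  then have "\<bar>k\<bar> \<le> \<bar>k1\<bar> + \<bar>k2\<bar>"
    using le by auto
  then have tri: "\<bar>real_of_int k\<bar> \<le> \<bar>real_of_int k1\<bar> + \<bar>real_of_int k2\<bar>"
    by linarith
  have "jbracket k powr s \<le> (2 * (jbracket k1 * jbracket k2)) powr s"
    using s tri by (intro powr_mono2 jbracket_add_le_mult) auto
  then show "jbracket k powr s \<le> 2 powr s * (jbracket k1 powr s * jbracket k2 powr s)"
    by (simp add: powr_mult)
  have n: "1 \<le> \<bar>real_of_int k1\<bar>" "1 \<le> \<bar>real_of_int k2\<bar>"
    using k k2 by linarith+
  have "1/125 * (\<bar>real_of_int k\<bar> * \<bar>real_of_int k1\<bar> * \<bar>real_of_int k2\<bar>) \<le> \<bar>dphase N k - dphase N k1 - dphase N k2\<bar>"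
    using N le aliases by (rule abs_dphase_resonance)
  also have "\<dots> = \<bar>(\<tau> - sg * dphase N k) - (\<tau>1 - sg * dphase N k1) - (\<tau> - \<tau>1 - sg * dphase N k2)\<bar>"
    using sg by auto
  also have "\<dots> \<le> x + y + z"
    using jbracket_ge_abs[of "\<tau> - sg * dphase N k"] jbracket_ge_abs[of "\<tau>1 - sg * dphase N k1"]
      jbracket_ge_abs[of "\<tau> - \<tau>1 - sg * dphase N k2"]
    unfolding x_def y_def z_def by linarith
  finally have res: "\<bar>real_of_int k\<bar> * \<bar>real_of_int k1\<bar> * \<bar>real_of_int k2\<bar> \<le> 125 * (x + y + z)"
    by simp
  have ge: "1 \<le> x" "1 \<le> y" "1 \<le> z"
    by (simp_all add: x_def y_def z_def jbracket_ge_1)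
  show "\<bar>real_of_int k\<bar> * x powr (-(1/2)) \<le> 750 * (1 + x powr (-(7/16)) * y powr (1/2) + x powr (-(7/16)) * z powr (1/2))"
    by (rule symbol_bound_L2[OF _ n tri ge res]) simp
  show "\<bar>real_of_int k\<bar> * x powr (- 1) \<le> 750 *
       ((\<bar>real_of_int k1\<bar> powr (-(3/4)) * y powr (-(1/16))) * (\<bar>real_of_int k2\<bar> powr (-(3/4)) * z powr (-(1/16)))
      + x powr (- 1) * y powr (1/2) + x powr (- 1) * z powr (1/2))"
    by (rule symbol_bound_L1[OF _ n tri ge res]) simp
qed

lemma integrand_bound_L2:
  assumes k: "k \<in> D" "k1 \<in> D"
  defines "k2 \<equiv> cyc N (k - k1)"
  shows "symb k * W (-(1/2)) k \<tau> * (F k1 \<tau>1 * G k2 (\<tau> - \<tau>1))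
    \<le> ennreal K * ((wF k1 \<tau>1 * W (-(1/2)) k1 \<tau>1) * (wG k2 (\<tau> - \<tau>1) * W (-(1/2)) k2 (\<tau> - \<tau>1))
       + W (-(7/16)) k \<tau> * (wF k1 \<tau>1 * (wG k2 (\<tau> - \<tau>1) * W (-(1/2)) k2 (\<tau> - \<tau>1)))
       + W (-(7/16)) k \<tau> * ((wF k1 \<tau>1 * W (-(1/2)) k1 \<tau>1) * wG k2 (\<tau> - \<tau>1)))"
proof (cases "k1 = 0 \<or> k2 = 0")
  case True
  then show ?thesis by (auto simp: FG0)
next
  case False
  note B = interaction_bounds(1)[OF k, folded k2_def] interaction_bounds(2,3)[OF k, of \<tau> \<tau>1, folded k2_def]
  have "(\<bar>real_of_int k\<bar> * jbracket (\<tau> - sg * dphase N k) powr (-(1/2))) * jbracket k powr s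
    \<le> (750 * (1 + jbracket (\<tau> - sg * dphase N k) powr (-(7/16)) * jbracket (\<tau>1 - sg * dphase N k1) powr (1/2)
       + jbracket (\<tau> - sg * dphase N k) powr (-(7/16)) * jbracket (\<tau> - \<tau>1 - sg * dphase N k2) powr (1/2)))
      * (2 powr s * (jbracket k1 powr s * jbracket k2 powr s))"
    using False by (intro mult_mono B) (auto intro: add_nonneg_nonneg)
  from ennreal_leI[OF this]
  have le: "symb k * W (-(1/2)) k \<tau> \<le> ennreal K * (J k1 * J k2 *
      (1 + W (-(7/16)) k \<tau> * W (1/2) k1 \<tau>1 + W (-(7/16)) k \<tau> * W (1/2) k2 (\<tau> - \<tau>1)))"
    by (simp add: modweight_def ac_simps flip: ennreal_mult ennreal_plus ennreal_1)
  have "symb k * W (-(1/2)) k \<tau> * (F k1 \<tau>1 * G k2 (\<tau> - \<tau>1)) \<le> ennreal K * (J k1 * J k2 *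
      (1 + W (-(7/16)) k \<tau> * W (1/2) k1 \<tau>1 + W (-(7/16)) k \<tau> * W (1/2) k2 (\<tau> - \<tau>1))) * (F k1 \<tau>1 * G k2 (\<tau> - \<tau>1))"
    by (intro mult_right_mono le) auto
  \<comment> \<open>Factors \<open>W (1/2) * W (-(1/2)) = 1\<close> are inserted so that each input
    appears with its full norm weight.\<close>
  also have "\<dots> = ennreal K * (J k1 * J k2 * F k1 \<tau>1 * G k2 (\<tau> - \<tau>1)
      * ((W (1/2) k1 \<tau>1 * W (-(1/2)) k1 \<tau>1) * (W (1/2) k2 (\<tau> - \<tau>1) * W (-(1/2)) k2 (\<tau> - \<tau>1))
       + W (-(7/16)) k \<tau> * W (1/2) k1 \<tau>1 * (W (1/2) k2 (\<tau> - \<tau>1) * W (-(1/2)) k2 (\<tau> - \<tau>1))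
       + W (-(7/16)) k \<tau> * (W (1/2) k1 \<tau>1 * W (-(1/2)) k1 \<tau>1) * W (1/2) k2 (\<tau> - \<tau>1)))"
    by (simp add: modweight_add ac_simps)
  also have "\<dots> = ennreal K * ((wF k1 \<tau>1 * W (-(1/2)) k1 \<tau>1) * (wG k2 (\<tau> - \<tau>1) * W (-(1/2)) k2 (\<tau> - \<tau>1))
       + W (-(7/16)) k \<tau> * (wF k1 \<tau>1 * (wG k2 (\<tau> - \<tau>1) * W (-(1/2)) k2 (\<tau> - \<tau>1)))
       + W (-(7/16)) k \<tau> * ((wF k1 \<tau>1 * W (-(1/2)) k1 \<tau>1) * wG k2 (\<tau> - \<tau>1)))"
    by (simp only: distrib_left distrib_right ac_simps)
  finally show ?thesis .
qed

abbreviation "z k \<equiv> ennreal (\<bar>real_of_int k\<bar> powr (-(3/4)))"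

lemma integrand_bound_L1:
  assumes k: "k \<in> D" "k1 \<in> D"
  defines "k2 \<equiv> cyc N (k - k1)"
  shows "symb k * W (- 1) k \<tau> * (F k1 \<tau>1 * G k2 (\<tau> - \<tau>1))
    \<le> ennreal K * ((z k1 * (wF k1 \<tau>1 * W (-(9/16)) k1 \<tau>1)) * (z k2 * (wG k2 (\<tau> - \<tau>1) * W (-(9/16)) k2 (\<tau> - \<tau>1)))
       + W (- 1) k \<tau> * (wF k1 \<tau>1 * (wG k2 (\<tau> - \<tau>1) * W (-(1/2)) k2 (\<tau> - \<tau>1)))
       + W (- 1) k \<tau> * ((wF k1 \<tau>1 * W (-(1/2)) k1 \<tau>1) * wG k2 (\<tau> - \<tau>1)))"
proof (cases "k1 = 0 \<or> k2 = 0")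
  case True
  then show ?thesis by (auto simp: FG0)
next
  case False
  note B = interaction_bounds(1)[OF k, folded k2_def] interaction_bounds(2,3)[OF k, of \<tau> \<tau>1, folded k2_def]
  have "(\<bar>real_of_int k\<bar> * jbracket (\<tau> - sg * dphase N k) powr (- 1)) * jbracket k powr s
    \<le> (750 * ((\<bar>real_of_int k1\<bar> powr (-(3/4)) * jbracket (\<tau>1 - sg * dphase N k1) powr (-(1/16)))
        * (\<bar>real_of_int k2\<bar> powr (-(3/4)) * jbracket (\<tau> - \<tau>1 - sg * dphase N k2) powr (-(1/16)))
       + jbracket (\<tau> - sg * dphase N k) powr (- 1) * jbracket (\<tau>1 - sg * dphase N k1) powr (1/2)
       + jbracket (\<tau> - sg * dphase N k) powr (- 1) * jbracket (\<tau> - \<tau>1 - sg * dphase N k2) powr (1/2)))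
      * (2 powr s * (jbracket k1 powr s * jbracket k2 powr s))"
    using False by (intro mult_mono B) (auto intro!: add_nonneg_nonneg)
  from ennreal_leI[OF this]
  have le: "symb k * W (- 1) k \<tau> \<le> ennreal K * (J k1 * J k2 *
      ((z k1 * W (-(1/16)) k1 \<tau>1) * (z k2 * W (-(1/16)) k2 (\<tau> - \<tau>1))
        + W (- 1) k \<tau> * W (1/2) k1 \<tau>1 + W (- 1) k \<tau> * W (1/2) k2 (\<tau> - \<tau>1)))"
    by (simp add: modweight_def ac_simps del: powr_neg_one' flip: ennreal_mult ennreal_plus)
  have "symb k * W (- 1) k \<tau> * (F k1 \<tau>1 * G k2 (\<tau> - \<tau>1)) \<le> ennreal K * (J k1 * J k2 *
      ((z k1 * W (-(1/16)) k1 \<tau>1) * (z k2 * W (-(1/16)) k2 (\<tau> - \<tau>1))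
        + W (- 1) k \<tau> * W (1/2) k1 \<tau>1 + W (- 1) k \<tau> * W (1/2) k2 (\<tau> - \<tau>1))) * (F k1 \<tau>1 * G k2 (\<tau> - \<tau>1))"
    by (intro mult_right_mono le) auto
  \<comment> \<open>Here 1/16 is written as \<open>9/16 - 1/2\<close>, exposing the norm weight of
    each input.\<close>
  also have "\<dots> = ennreal K * (J k1 * J k2 * F k1 \<tau>1 * G k2 (\<tau> - \<tau>1)
      * (z k1 * z k2 * ((W (1/2) k1 \<tau>1 * W (-(9/16)) k1 \<tau>1) * (W (1/2) k2 (\<tau> - \<tau>1) * W (-(9/16)) k2 (\<tau> - \<tau>1)))
       + W (- 1) k \<tau> * W (1/2) k1 \<tau>1 * (W (1/2) k2 (\<tau> - \<tau>1) * W (-(1/2)) k2 (\<tau> - \<tau>1))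
       + W (- 1) k \<tau> * (W (1/2) k1 \<tau>1 * W (-(1/2)) k1 \<tau>1) * W (1/2) k2 (\<tau> - \<tau>1)))"
    by (simp add: modweight_add ac_simps)
  also have "\<dots> = ennreal K * ((z k1 * (wF k1 \<tau>1 * W (-(9/16)) k1 \<tau>1)) * (z k2 * (wG k2 (\<tau> - \<tau>1) * W (-(9/16)) k2 (\<tau> - \<tau>1)))
       + W (- 1) k \<tau> * (wF k1 \<tau>1 * (wG k2 (\<tau> - \<tau>1) * W (-(1/2)) k2 (\<tau> - \<tau>1)))
       + W (- 1) k \<tau> * ((wF k1 \<tau>1 * W (-(1/2)) k1 \<tau>1) * wG k2 (\<tau> - \<tau>1)))"
    by (simp only: distrib_left distrib_right ac_simps)
  finally show ?thesis .
qed

lemma cyc_conv_cmult: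
  assumes [measurable]: "\<And>k. f k \<in> borel_measurable borel" "\<And>k. g k \<in> borel_measurable borel"
  shows "c * conv f g k \<tau> = (\<Sum>k1\<in>D. \<integral>\<^sup>+\<tau>1. c * (f k1 \<tau>1 * g (cyc N (k - k1)) (\<tau> - \<tau>1)) \<partial>lborel)"
  unfolding cyc_conv_def sum_distrib_left by (intro sum.cong refl nn_integral_cmult[symmetric]) measurable

abbreviation "T0 \<equiv> conv (\<lambda>k \<tau>. wF k \<tau> * W (-(1/2)) k \<tau>) (\<lambda>k \<tau>. wG k \<tau> * W (-(1/2)) k \<tau>)"
abbreviation "T1 \<equiv> conv wF (\<lambda>k \<tau>. wG k \<tau> * W (-(1/2)) k \<tau>)"
abbreviation "T2 \<equiv> conv (\<lambda>k \<tau>. wF k \<tau> * W (-(1/2)) k \<tau>) wG"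
abbreviation "T3 \<equiv> conv (\<lambda>k \<tau>. z k * (wF k \<tau> * W (-(9/16)) k \<tau>)) (\<lambda>k \<tau>. z k * (wG k \<tau> * W (-(9/16)) k \<tau>))"

lemma conv_bound_L2:
  assumes "k \<in> D"
  shows "symb k * W (-(1/2)) k \<tau> * conv F G k \<tau> \<le> ennreal K * (T0 k \<tau> + W (-(7/16)) k \<tau> * T1 k \<tau> + W (-(7/16)) k \<tau> * T2 k \<tau>)"
proof -
  have "symb k * W (-(1/2)) k \<tau> * conv F G k \<tau> \<le> (\<Sum>k1\<in>D. \<integral>\<^sup>+\<tau>1. ennreal K
      * ((wF k1 \<tau>1 * W (-(1/2)) k1 \<tau>1) * (wG (cyc N (k - k1)) (\<tau> - \<tau>1) * W (-(1/2)) (cyc N (k - k1)) (\<tau> - \<tau>1))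
       + W (-(7/16)) k \<tau> * (wF k1 \<tau>1 * (wG (cyc N (k - k1)) (\<tau> - \<tau>1) * W (-(1/2)) (cyc N (k - k1)) (\<tau> - \<tau>1)))
       + W (-(7/16)) k \<tau> * ((wF k1 \<tau>1 * W (-(1/2)) k1 \<tau>1) * wG (cyc N (k - k1)) (\<tau> - \<tau>1))) \<partial>lborel)"
    by (subst cyc_conv_cmult, simp, simp, intro sum_mono nn_integral_mono integrand_bound_L2 assms)
  also have "\<dots> = ennreal K * (T0 k \<tau> + W (-(7/16)) k \<tau> * T1 k \<tau> + W (-(7/16)) k \<tau> * T2 k \<tau>)"
    by (simp add: nn_integral_cmult nn_integral_add sum.distrib cyc_conv_def flip: sum_distrib_left)
  finally show ?thesis .
qed

lemma conv_bound_L1: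
  assumes "k \<in> D"
  shows "symb k * W (- 1) k \<tau> * conv F G k \<tau> \<le> ennreal K * (T3 k \<tau> + W (- 1) k \<tau> * T1 k \<tau> + W (- 1) k \<tau> * T2 k \<tau>)"
proof -
  have "symb k * W (- 1) k \<tau> * conv F G k \<tau> \<le> (\<Sum>k1\<in>D. \<integral>\<^sup>+\<tau>1. ennreal K
      * ((z k1 * (wF k1 \<tau>1 * W (-(9/16)) k1 \<tau>1)) * (z (cyc N (k - k1)) * (wG (cyc N (k - k1)) (\<tau> - \<tau>1) * W (-(9/16)) (cyc N (k - k1)) (\<tau> - \<tau>1)))
       + W (- 1) k \<tau> * (wF k1 \<tau>1 * (wG (cyc N (k - k1)) (\<tau> - \<tau>1) * W (-(1/2)) (cyc N (k - k1)) (\<tau> - \<tau>1)))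
       + W (- 1) k \<tau> * ((wF k1 \<tau>1 * W (-(1/2)) k1 \<tau>1) * wG (cyc N (k - k1)) (\<tau> - \<tau>1))) \<partial>lborel)"
    by (subst cyc_conv_cmult, simp, simp, intro sum_mono nn_integral_mono integrand_bound_L1 assms)
  also have "\<dots> = ennreal K * (T3 k \<tau> + W (- 1) k \<tau> * T1 k \<tau> + W (- 1) k \<tau> * T2 k \<tau>)"
    by (simp add: nn_integral_cmult nn_integral_add sum.distrib cyc_conv_def flip: sum_distrib_left)
  finally show ?thesis .
qed

lemma mass_T1: "(\<Sum>k\<in>D. \<integral>\<^sup>+\<tau>. (W (-(7/16)) k \<tau> * T1 k \<tau>)\<^sup>2 \<partial>lborel) \<le> C0 * (mass wF * mass wG)"
  by (rule conv_input_dominant) (auto simp: FG0)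

lemma mass_T2: "(\<Sum>k\<in>D. \<integral>\<^sup>+\<tau>. (W (-(7/16)) k \<tau> * T2 k \<tau>)\<^sup>2 \<partial>lborel) \<le> C0 * (mass wF * mass wG)"
proof -
  have "T2 k \<tau> = conv wG (\<lambda>k \<tau>. wF k \<tau> * W (-(1/2)) k \<tau>) k \<tau>" for k \<tau>
    by (rule cyc_conv_commute[OF N]) auto
  then have "(\<Sum>k\<in>D. \<integral>\<^sup>+\<tau>. (W (-(7/16)) k \<tau> * T2 k \<tau>)\<^sup>2 \<partial>lborel) \<le> C0 * (mass wG * mass wF)"
    by (simp only:) (rule conv_input_dominant; simp add: FG0)
  then show ?thesis by (simp only: mult.commute[of "mass wG"])
qed

lemma bilinear_L2:
  "(\<Sum>k\<in>D. \<integral>\<^sup>+\<tau>. (symb k * W (-(1/2)) k \<tau> * conv F G k \<tau>)\<^sup>2 \<partial>lborel)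
    \<le> ennreal (bilinear_const s) * (mass wF * mass wG)"
proof -
  \<comment> \<open>The symbol kills frequency zero, which \<open>conv_output_dominant\<close>
    leaves out.\<close>
  have "(\<Sum>k\<in>D. \<integral>\<^sup>+\<tau>. (symb k * W (-(1/2)) k \<tau> * conv F G k \<tau>)\<^sup>2 \<partial>lborel)
    = (\<Sum>k\<in>D - {0}. \<integral>\<^sup>+\<tau>. (symb k * W (-(1/2)) k \<tau> * conv F G k \<tau>)\<^sup>2 \<partial>lborel)"
    by (rule sum.mono_neutral_right) auto
  also have "\<dots> \<le> (\<Sum>k\<in>D - {0}. \<integral>\<^sup>+\<tau>. (ennreal K)\<^sup>2 * (3 * ((T0 k \<tau>)\<^sup>2 + (W (-(7/16)) k \<tau> * T1 k \<tau>)\<^sup>2 + (W (-(7/16)) k \<tau> * T2 k \<tau>)\<^sup>2)) \<partial>lborel)"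
  proof (intro sum_mono nn_integral_mono)
    fix k \<tau> assume "k \<in> D - {0}"
    then have "(symb k * W (-(1/2)) k \<tau> * conv F G k \<tau>)\<^sup>2
        \<le> (ennreal K * (T0 k \<tau> + W (-(7/16)) k \<tau> * T1 k \<tau> + W (-(7/16)) k \<tau> * T2 k \<tau>))\<^sup>2"
      by (intro power_mono conv_bound_L2) auto
    also have "\<dots> \<le> (ennreal K)\<^sup>2 * (3 * ((T0 k \<tau>)\<^sup>2 + (W (-(7/16)) k \<tau> * T1 k \<tau>)\<^sup>2 + (W (-(7/16)) k \<tau> * T2 k \<tau>)\<^sup>2))"
      unfolding power_mult_distrib[of "ennreal K"] by (intro mult_left_mono ennreal_square_sum3) auto
    finally show "(symb k * W (-(1/2)) k \<tau> * conv F G k \<tau>)\<^sup>2 \<le> \<dots>" .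
  qed
  also have "\<dots> = (ennreal K)\<^sup>2 * (3 * ((\<Sum>k\<in>D - {0}. \<integral>\<^sup>+\<tau>. (T0 k \<tau>)\<^sup>2 \<partial>lborel)
      + (\<Sum>k\<in>D - {0}. \<integral>\<^sup>+\<tau>. (W (-(7/16)) k \<tau> * T1 k \<tau>)\<^sup>2 \<partial>lborel)
      + (\<Sum>k\<in>D - {0}. \<integral>\<^sup>+\<tau>. (W (-(7/16)) k \<tau> * T2 k \<tau>)\<^sup>2 \<partial>lborel)))"
    by (simp add: nn_integral_cmult nn_integral_add sum.distrib flip: sum_distrib_left)
  also have "\<dots> \<le> (ennreal K)\<^sup>2 * (3 * (C0 * (mass wF * mass wG) + C0 * (mass wF * mass wG) + C0 * (mass wF * mass wG)))"
    by (intro mult_left_mono add_mono conv_output_dominant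
          order_trans[OF sum_mono2 mass_T1] order_trans[OF sum_mono2 mass_T2]) auto
  also have "\<dots> = ennreal (3 * K\<^sup>2 * (3 * (4 * jbracket_mass * Cp))) * (mass wF * mass wG)"
  proof -
    have "(ennreal K)\<^sup>2 * (3 * (C0 + C0 + C0)) = ennreal (3 * K\<^sup>2 * (3 * (4 * jbracket_mass * Cp)))"
      using Cp by (simp add: algebra_simps ennreal_power flip: ennreal_plus ennreal_mult ennreal_numeral)
    then show ?thesis
      by (simp only: ennreal_collect flip: mult.assoc[of "ennreal jbracket_mass" C0])
  qed
  also have "\<dots> \<le> ennreal (bilinear_const s) * (mass wF * mass wG)"
    unfolding bilinear_const_def using Cp Cz
    by (intro mult_right_mono ennreal_leI mult_left_mono) auto
  finally show ?thesis .
qed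

lemma bilinear_L1:
  "(\<Sum>k\<in>D. (\<integral>\<^sup>+\<tau>. symb k * W (- 1) k \<tau> * conv F G k \<tau> \<partial>lborel)\<^sup>2)
    \<le> ennreal (bilinear_const s) * (mass wF * mass wG)"
proof -
  \<comment> \<open>The weight 9/16 is spent on integrability in \<open>\<tau>\<close>; the rest is
    the weight of \<open>mass_T1\<close> and \<open>mass_T2\<close>.\<close>
  have CS: "(\<integral>\<^sup>+\<tau>. W (- 1) k \<tau> * T k \<tau> \<partial>lborel)\<^sup>2 \<le> ennreal jbracket_mass * (\<integral>\<^sup>+\<tau>. (W (-(7/16)) k \<tau> * T k \<tau>)\<^sup>2 \<partial>lborel)"
    if [measurable]: "T k \<in> borel_measurable borel" for T k
  proof -
    have eq: "(\<integral>\<^sup>+\<tau>. W (- 1) k \<tau> * T k \<tau> \<partial>lborel) = (\<integral>\<^sup>+\<tau>. W (-(9/16)) k \<tau> * (W (-(7/16)) k \<tau> * T k \<tau>) \<partial>lborel)"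
      by (simp add: modweight_add flip: mult.assoc)
    have w: "(\<integral>\<^sup>+\<tau>. (W (-(9/16)) k \<tau>)\<^sup>2 \<partial>lborel) = ennreal jbracket_mass"
      using nn_integral_modweight[of N sg k] by (simp add: modweight_sq)
    show ?thesis
      unfolding eq w[symmetric] by (rule Cauchy_Schwarz_nn_integral) auto
  qed
  have "(\<Sum>k\<in>D. (\<integral>\<^sup>+\<tau>. symb k * W (- 1) k \<tau> * conv F G k \<tau> \<partial>lborel)\<^sup>2)
    \<le> (\<Sum>k\<in>D. (\<integral>\<^sup>+\<tau>. ennreal K * (T3 k \<tau> + W (- 1) k \<tau> * T1 k \<tau> + W (- 1) k \<tau> * T2 k \<tau>) \<partial>lborel)\<^sup>2)"
    by (intro sum_mono power_mono nn_integral_mono conv_bound_L1) auto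
  also have "\<dots> = (\<Sum>k\<in>D. (ennreal K)\<^sup>2 * ((\<integral>\<^sup>+\<tau>. T3 k \<tau> \<partial>lborel) + (\<integral>\<^sup>+\<tau>. W (- 1) k \<tau> * T1 k \<tau> \<partial>lborel)
      + (\<integral>\<^sup>+\<tau>. W (- 1) k \<tau> * T2 k \<tau> \<partial>lborel))\<^sup>2)"
    by (simp add: nn_integral_cmult nn_integral_add power_mult_distrib)
  also have "\<dots> \<le> (\<Sum>k\<in>D. (ennreal K)\<^sup>2 * (3 * ((\<integral>\<^sup>+\<tau>. T3 k \<tau> \<partial>lborel)\<^sup>2
      + ennreal jbracket_mass * (\<integral>\<^sup>+\<tau>. (W (-(7/16)) k \<tau> * T1 k \<tau>)\<^sup>2 \<partial>lborel)
      + ennreal jbracket_mass * (\<integral>\<^sup>+\<tau>. (W (-(7/16)) k \<tau> * T2 k \<tau>)\<^sup>2 \<partial>lborel))))"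
    by (intro sum_mono mult_left_mono order_trans[OF ennreal_square_sum3] add_mono CS order_refl) auto
  also have "\<dots> = (ennreal K)\<^sup>2 * (3 * ((\<Sum>k\<in>D. (\<integral>\<^sup>+\<tau>. T3 k \<tau> \<partial>lborel)\<^sup>2)
      + ennreal jbracket_mass * (\<Sum>k\<in>D. \<integral>\<^sup>+\<tau>. (W (-(7/16)) k \<tau> * T1 k \<tau>)\<^sup>2 \<partial>lborel)
      + ennreal jbracket_mass * (\<Sum>k\<in>D. \<integral>\<^sup>+\<tau>. (W (-(7/16)) k \<tau> * T2 k \<tau>)\<^sup>2 \<partial>lborel)))"
    by (simp add: sum.distrib flip: sum_distrib_left)
  also have "\<dots> \<le> (ennreal K)\<^sup>2 * (3 * (ennreal (Cz * jbracket_mass\<^sup>2) * (mass wF * mass wG)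
      + ennreal jbracket_mass * (C0 * (mass wF * mass wG)) + ennreal jbracket_mass * (C0 * (mass wF * mass wG))))"
    by (intro mult_left_mono add_mono conv_L1 mass_T1 mass_T2) auto
  also have "\<dots> = ennreal (3 * K\<^sup>2 * (Cz * jbracket_mass\<^sup>2 + 2 * (jbracket_mass * (4 * jbracket_mass * Cp)))) * (mass wF * mass wG)"
  proof -
    have "(ennreal K)\<^sup>2 * (3 * (ennreal (Cz * jbracket_mass\<^sup>2) + ennreal jbracket_mass * C0 + ennreal jbracket_mass * C0))
      = ennreal (3 * K\<^sup>2 * (Cz * jbracket_mass\<^sup>2 + 2 * (jbracket_mass * (4 * jbracket_mass * Cp))))"
      using Cp Cz by (simp add: algebra_simps ennreal_power flip: ennreal_plus ennreal_mult ennreal_numeral)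
    then show ?thesis
      by (simp only: ennreal_collect flip: mult.assoc[of "ennreal jbracket_mass" C0])
  qed
  also have "\<dots> \<le> ennreal (bilinear_const s) * (mass wF * mass wG)"
    unfolding bilinear_const_def using Cp Cz
    by (intro mult_right_mono ennreal_leI mult_left_mono) auto
  finally show ?thesis .
qed

end

end

section \<open>The Fourier transform on the real line\<close>

lemma borel_measurable_cis [measurable]: "cis \<in> borel_measurable borel"
  by (intro borel_measurable_continuous_onI continuous_intros)

lemma decay_pos: "0 < 1 + (x::real)\<^sup>2"
  by (simp add: add_pos_nonneg)

lemma integrable_decay: "integrable lborel (\<lambda>x::real. 1 / (1 + x\<^sup>2))"
proof (rule integrableI_bounded)
  have "(\<integral>\<^sup>+x. ennreal (norm (1 / (1 + (x::real)\<^sup>2))) \<partial>lborel) \<le> (\<integral>\<^sup>+x. ennreal (jbracket x powr (- (9/8))) \<partial>lborel)"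
  proof (intro nn_integral_mono ennreal_leI)
    fix x :: real
    have "norm (1 / (1 + x\<^sup>2)) = jbracket x powr (- 2)"
      using decay_pos[of x] by (simp add: jbracket_def powr_powr)
    also have "\<dots> \<le> jbracket x powr (- (9/8))"
      by (intro powr_mono jbracket_ge_1) auto
    finally show "norm (1 / (1 + x\<^sup>2)) \<le> jbracket x powr (- (9/8))" .
  qed
  also have "\<dots> < \<infinity>" by (rule nn_integral_jbracket_powr_finite)
  finally show "(\<integral>\<^sup>+x. ennreal (norm (1 / (1 + (x::real)\<^sup>2))) \<partial>lborel) < \<infinity>" .
qed auto

lemma integrable_of_decay:
  fixes f :: "real \<Rightarrow> complex"
  assumes "f \<in> borel_measurable borel" "\<And>t. norm (f t) \<le> C / (1 + t\<^sup>2)"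
  shows "integrable lborel f"
proof (rule Bochner_Integration.integrable_bound)
  show "integrable lborel (\<lambda>t. C * (1 / (1 + t\<^sup>2)))"
    by (intro integrable_mult_right integrable_decay)
  show "AE t in lborel. norm (f t) \<le> norm (C * (1 / (1 + t\<^sup>2)))"
  proof (rule AE_I2)
    fix t
    have "norm (f t) \<le> C / (1 + t\<^sup>2)" by (rule assms)
    also have "\<dots> \<le> \<bar>C / (1 + t\<^sup>2)\<bar>" by (rule abs_ge_self)
    finally show "norm (f t) \<le> norm (C * (1 / (1 + t\<^sup>2)))" by simp
  qed
qed (use assms in simp)

text \<open>The bounds with powers 0 and 2 of \<open>t\<close> add up to one integrable majorant for
  each derivative.\<close>

lemma schwartz_decay:
  assumes "schwartz f"
  obtains D C where "D 0 = f" "\<And>n t. (D n has_vector_derivative D (Suc n) t) (at t)"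
    "\<And>n t. norm (D n t) \<le> C n / (1 + t\<^sup>2)"
proof -
  obtain D where D: "D 0 = f" "\<And>n t. (D n has_vector_derivative D (Suc n) t) (at t)"
    and bd: "\<And>m n. bounded (range (\<lambda>t. t ^ m *\<^sub>R D n t))"
    using assms unfolding schwartz_def by blast
  have "\<exists>C. \<forall>t. norm (D n t) \<le> C / (1 + t\<^sup>2)" for n
  proof -
    obtain A where A: "\<And>t. norm (t ^ 0 *\<^sub>R D n t) \<le> A"
      using bd[of 0 n] unfolding bounded_iff by blast
    obtain B where B: "\<And>t. norm (t ^ 2 *\<^sub>R D n t) \<le> B"
      using bd[of 2 n] unfolding bounded_iff by blast
    have "norm (D n t) \<le> (A + B) / (1 + t\<^sup>2)" for t
      using A[of t] B[of t] decay_pos[of t] by (simp add: field_simps)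
    then show ?thesis by blast
  qed
  then obtain C where "\<And>n t. norm (D n t) \<le> C n / (1 + t\<^sup>2)"
    by metis
  with D that show thesis by blast
qed

lemma decay_tendsto_0:
  fixes f :: "real \<Rightarrow> complex"
  assumes "\<And>t. norm (f t) \<le> C / (1 + t\<^sup>2)"
  shows "(f \<longlongrightarrow> 0) at_top" "(f \<longlongrightarrow> 0) at_bot"
proof -
  have "((\<lambda>t::real. C / (1 + t\<^sup>2)) \<longlongrightarrow> 0) at_top" "((\<lambda>t::real. C / (1 + t\<^sup>2)) \<longlongrightarrow> 0) at_bot"
    by real_asymp+
  then show "(f \<longlongrightarrow> 0) at_top" "(f \<longlongrightarrow> 0) at_bot"
    using assms by (auto intro!: Lim_null_comparison[where g="\<lambda>t::real. C / (1 + t\<^sup>2)"])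
qed

lemma integral_derivative_eq_0:
  fixes F f :: "real \<Rightarrow> complex"
  assumes "\<And>t. (F has_vector_derivative f t) (at t)" "\<And>t. isCont f t" "integrable lborel f"
    and "(F \<longlongrightarrow> 0) at_top" "(F \<longlongrightarrow> 0) at_bot"
  shows "(\<integral>t. f t \<partial>lborel) = 0"
proof -
  have "(LBINT t=-\<infinity>..\<infinity>. f t) = 0 - 0"
    using assms by (intro interval_integral_FTC_integrable)
      (auto simp: ereal_tendsto_simps set_integrable_def)
  then show ?thesis
    by (simp add: interval_lebesgue_integral_def set_lebesgue_integral_def)
qed

text \<open>Left without a normalising factor, so inversion and the product formula carry
  \<open>2 * pi\<close>.\<close>

definition ft :: "(real \<Rightarrow> complex) \<Rightarrow> real \<Rightarrow> complex"
  where "ft f \<tau> = (\<integral>t. cis (- (t * \<tau>)) * f t \<partial>lborel)"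

lemma measurable_ft [measurable]:
  assumes [measurable]: "f \<in> borel_measurable borel"
  shows "ft f \<in> borel_measurable borel"
  unfolding ft_def by measurable

lemma integrable_cis_mult:
  assumes "integrable lborel (f :: real \<Rightarrow> complex)"
  shows "integrable lborel (\<lambda>t. cis (- (t * \<tau>)) * f t)"
proof (rule Bochner_Integration.integrable_bound[OF assms])
  have [measurable]: "f \<in> borel_measurable borel" using assms by auto
  show "(\<lambda>t. cis (- (t * \<tau>)) * f t) \<in> borel_measurable lborel" by measurable
qed (simp add: norm_mult)

lemma norm_ft_le:
  assumes "integrable lborel f"
  shows "norm (ft f \<tau>) \<le> (\<integral>t. norm (f t) \<partial>lborel)"
  unfolding ft_def using integral_norm_bound[of lborel "\<lambda>t. cis (- (t * \<tau>)) * f t"]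
  by (simp add: norm_mult)

lemma has_vector_derivative_cis:
  "((\<lambda>t. cis (- (t * \<tau>))) has_vector_derivative cis (- (t * \<tau>)) * (- (\<i> * of_real \<tau>))) (at t)"
proof -
  have "cis (- (t * \<tau>)) = exp (t *\<^sub>R (- (\<i> * of_real \<tau>)))" for t
    by (simp add: cis_conv_exp scaleR_conv_of_real ac_simps)
  then show ?thesis
    by (simp only: exp_scaleR_has_vector_derivative_right)
qed

text \<open>Integration by parts: the derivative of \<open>cis (- (t * \<tau>)) * f t\<close>
  integrates to zero because decay removes the boundary values.\<close>

lemma ft_derivative:
  assumes der: "\<And>t. (f has_vector_derivative f' t) (at t)" "\<And>t. isCont f' t"
    and decay: "\<And>t. norm (f t) \<le> C / (1 + t\<^sup>2)" "\<And>t. norm (f' t) \<le> C' / (1 + t\<^sup>2)"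
  shows "ft f' \<tau> = \<i> * of_real \<tau> * ft f \<tau>"
proof -
  have cont: "isCont f t" for t
    using der(1) has_vector_derivative_continuous by blast
  then have [measurable]: "f \<in> borel_measurable borel" "f' \<in> borel_measurable borel"
    using der(2) by (auto intro!: borel_measurable_continuous_onI continuous_at_imp_continuous_on)
  have int: "integrable lborel f" "integrable lborel f'"
    by (rule integrable_of_decay[OF _ decay(1)], simp) (rule integrable_of_decay[OF _ decay(2)], simp)
  let ?g = "\<lambda>t. cis (- (t * \<tau>)) * f' t + (- (\<i> * of_real \<tau>)) * (cis (- (t * \<tau>)) * f t)"
  have "(\<integral>t. ?g t \<partial>lborel) = 0"
  proof (rule integral_derivative_eq_0)
    fix t
    show "((\<lambda>t. cis (- (t * \<tau>)) * f t) has_vector_derivative ?g t) (at t)"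
      using has_vector_derivative_mult[OF has_vector_derivative_cis der(1), of \<tau> t]
      by (simp add: ac_simps)
    show "isCont ?g t"
    proof -
      have "isCont (\<lambda>t. cis (- (t * \<tau>))) t"
        using has_vector_derivative_cis by (rule has_vector_derivative_continuous)
      then show ?thesis
        using cont der(2) by (intro continuous_intros)
    qed
  next
    show "integrable lborel ?g"
      by (intro Bochner_Integration.integrable_add integrable_mult_right integrable_cis_mult int)
  next
    have "norm (cis (- (t * \<tau>)) * f t) \<le> C / (1 + t\<^sup>2)" for t
      using decay(1)[of t] by (simp add: norm_mult)
    from decay_tendsto_0[OF this]
    show "((\<lambda>t. cis (- (t * \<tau>)) * f t) \<longlongrightarrow> 0) at_top" "((\<lambda>t. cis (- (t * \<tau>)) * f t) \<longlongrightarrow> 0) at_bot"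
      by auto
  qed
  moreover have "(\<integral>t. ?g t \<partial>lborel) = ft f' \<tau> + (- (\<i> * of_real \<tau>)) * ft f \<tau>"
    unfolding ft_def using int
    by (subst Bochner_Integration.integral_add) (auto intro!: integrable_cis_mult integrable_mult_right)
  ultimately show ?thesis by (simp add: algebra_simps)
qed

lemma schwartz_bound:
  assumes "schwartz f"
  obtains C where "\<And>t. norm (f t) \<le> C / (1 + t\<^sup>2)"
  using schwartz_decay[OF assms] by metis

lemma schwartz_isCont: "schwartz f \<Longrightarrow> isCont f t"
  using schwartz_decay has_vector_derivative_continuous by metis

lemma schwartz_measurable: "schwartz f \<Longrightarrow> f \<in> borel_measurable borel"
  by (intro borel_measurable_continuous_onI continuous_at_imp_continuous_on ballI schwartz_isCont)

lemma schwartz_integrable: "schwartz f \<Longrightarrow> integrable lborel f"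
  by (metis schwartz_bound integrable_of_decay schwartz_measurable)

text \<open>Smoothness becomes decay: passing to the second derivative multiplies the transform by
  \<open>- \<tau>^2\<close>, so the L1 norms of \<open>f\<close> and of its second derivative bound
  \<open>1 + \<tau>^2\<close> times the transform.\<close>

lemma ft_schwartz_decay:
  assumes "schwartz f"
  obtains C where "\<And>\<tau>. norm (ft f \<tau>) \<le> C / (1 + \<tau>\<^sup>2)"
proof -
  obtain D C where D: "D 0 = f" "\<And>n t. (D n has_vector_derivative D (Suc n) t) (at t)"
    "\<And>n t. norm (D n t) \<le> C n / (1 + t\<^sup>2)"
    using schwartz_decay[OF assms] by blast
  have cont: "isCont (D n) t" for n t
    using D(2) has_vector_derivative_continuous by blast
  then have "D n \<in> borel_measurable borel" for n
    by (auto intro!: borel_measurable_continuous_onI continuous_at_imp_continuous_on)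
  then have int: "integrable lborel (D n)" for n
    using D(3) by (auto intro: integrable_of_decay)
  have step: "ft (D (Suc n)) \<tau> = \<i> * of_real \<tau> * ft (D n) \<tau>" for n \<tau>
    using D cont by (intro ft_derivative) auto
  define I where "I n = (\<integral>t. norm (D n t) \<partial>lborel)" for n
  have "norm (ft f \<tau>) \<le> (I 0 + I 2) / (1 + \<tau>\<^sup>2)" for \<tau>
  proof -
    have "norm (ft (D 2) \<tau>) = \<tau>\<^sup>2 * norm (ft f \<tau>)"
      using step[of 1 \<tau>] step[of 0 \<tau>] D(1)
      by (simp add: numeral_2_eq_2 norm_mult power2_eq_square)
    moreover have "norm (ft (D 2) \<tau>) \<le> I 2" "norm (ft (D 0) \<tau>) \<le> I 0"
      unfolding I_def by (intro norm_ft_le int)+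
    ultimately show ?thesis
      using D(1) decay_pos[of \<tau>] by (simp add: field_simps)
  qed
  with that show thesis by blast
qed

text \<open>A rescaling of the characteristic function of the standard normal distribution.\<close>

lemma gaussian_transform:
  assumes "0 < \<epsilon>"
  shows "(\<integral>\<tau>. cis (x * \<tau>) * of_real (exp (- (\<epsilon> * \<tau>)\<^sup>2 / 2)) \<partial>lborel)
    = of_real (sqrt (2 * pi) / \<epsilon> * exp (- (x / \<epsilon>)\<^sup>2 / 2))"
proof -
  have std: "(\<integral>y. cis (x * y) * of_real (exp (- y\<^sup>2 / 2)) \<partial>lborel) = of_real (sqrt (2 * pi) * exp (- x\<^sup>2 / 2))" for x
  proof -
    have "of_real (exp (- x\<^sup>2 / 2)) = (\<integral>y. std_normal_density y *\<^sub>R iexp (x * y) \<partial>lborel)"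
      using fun_cong[OF char_std_normal_distribution, of x]
      by (simp add: char_def integral_density)
    also have "\<dots> = (\<integral>y. of_real (1 / sqrt (2 * pi)) * (cis (x * y) * of_real (exp (- y\<^sup>2 / 2))) \<partial>lborel)"
      by (intro Bochner_Integration.integral_cong refl)
         (simp add: std_normal_density_def scaleR_conv_of_real cis_conv_exp)
    also have "\<dots> = of_real (1 / sqrt (2 * pi)) * (\<integral>y. cis (x * y) * of_real (exp (- y\<^sup>2 / 2)) \<partial>lborel)"
      by simp
    finally show ?thesis
      by (simp add: field_simps)
  qed
  have "(\<integral>\<tau>. cis (x * \<tau>) * of_real (exp (- (\<epsilon> * \<tau>)\<^sup>2 / 2)) \<partial>lborel)
    = \<bar>1 / \<epsilon>\<bar> *\<^sub>R (\<integral>y. cis (x * (0 + 1 / \<epsilon> * y)) * of_real (exp (- (\<epsilon> * (0 + 1 / \<epsilon> * y))\<^sup>2 / 2)) \<partial>lborel)"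
    using assms by (intro lborel_integral_real_affine) auto
  also have "\<dots> = of_real (1 / \<epsilon>) * (\<integral>y. cis (x / \<epsilon> * y) * of_real (exp (- y\<^sup>2 / 2)) \<partial>lborel)"
    using assms by (simp add: scaleR_conv_of_real)
  finally show ?thesis
    unfolding std by (simp add: ac_simps)
qed

text \<open>A Gaussian factor makes the double integral absolutely convergent. After Fubini it
  becomes an average of \<open>f\<close> against a Gaussian of width \<open>\<epsilon> n\<close>
  about \<open>s\<close>, and dominated convergence evaluates the limit of both forms.\<close>

theorem fourier_inversion:
  fixes f :: "real \<Rightarrow> complex"
  assumes cont: "\<And>t. isCont f t" and decay: "\<And>t. norm (f t) \<le> C / (1 + t\<^sup>2)"
    and int: "integrable lborel (ft f)"
  shows "(\<integral>\<tau>. cis (s * \<tau>) * ft f \<tau> \<partial>lborel) = of_real (2 * pi) * f s"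
proof (rule LIMSEQ_unique)
  have [measurable]: "f \<in> borel_measurable borel"
    using cont by (intro borel_measurable_continuous_onI continuous_at_imp_continuous_on) auto
  have int_f: "integrable lborel f"
    by (rule integrable_of_decay[OF _ decay]) simp
  define \<epsilon> where "\<epsilon> n = inverse (real (Suc n))" for n
  have \<epsilon>: "0 < \<epsilon> n" for n by (simp add: \<epsilon>_def)
  have \<epsilon>0: "\<epsilon> \<longlonglongrightarrow> 0"
    unfolding \<epsilon>_def by (rule LIMSEQ_inverse_real_of_nat)
  define g where "g n \<tau> = exp (- (\<epsilon> n * \<tau>)\<^sup>2 / 2)" for n \<tau>
  define I where "I n = (\<integral>\<tau>. of_real (g n \<tau>) * (cis (s * \<tau>) * ft f \<tau>) \<partial>lborel)" for n
  have g1: "\<bar>g n \<tau>\<bar> \<le> 1" for n \<tau> by (simp add: g_def)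
  have [measurable]: "g n \<in> borel_measurable borel" for n unfolding g_def by measurable
  show "I \<longlonglongrightarrow> (\<integral>\<tau>. cis (s * \<tau>) * ft f \<tau> \<partial>lborel)"
    unfolding I_def
  proof (rule integral_dominated_convergence[where w="\<lambda>\<tau>. norm (ft f \<tau>)"])
    have "(\<lambda>n. of_real (g n \<tau>) * (cis (s * \<tau>) * ft f \<tau>)) \<longlonglongrightarrow> of_real (exp (- (0 * \<tau>)\<^sup>2 / 2)) * (cis (s * \<tau>) * ft f \<tau>)" for \<tau>
      unfolding g_def by (intro tendsto_intros \<epsilon>0) auto
    then show "AE \<tau> in lborel. (\<lambda>n. of_real (g n \<tau>) * (cis (s * \<tau>) * ft f \<tau>)) \<longlonglongrightarrow> cis (s * \<tau>) * ft f \<tau>"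
      by simp
    show "AE \<tau> in lborel. norm (of_real (g n \<tau>) * (cis (s * \<tau>) * ft f \<tau>)) \<le> norm (ft f \<tau>)" for n
      using g1 by (auto simp: norm_mult intro!: mult_left_le_one_le)
  qed (use int in auto)
  have I: "I n = (\<integral>y. of_real (sqrt (2 * pi) * exp (- y\<^sup>2 / 2)) * f (s + \<epsilon> n * y) \<partial>lborel)" for n
  proof -
    have int_g: "integrable lborel (g n)"
    proof -
      have "integrable lborel (\<lambda>\<tau>. sqrt (2 * pi) * std_normal_density (0 + \<epsilon> n * \<tau>))"
        using \<epsilon>[of n] by (intro integrable_mult_right lborel_integrable_real_affine integrable_normal_density) auto
      then show ?thesis
        by (simp add: std_normal_density_def g_def[abs_def])
    qed
    let ?h = "\<lambda>\<tau> t. (of_real (g n \<tau>) * cis ((s - t) * \<tau>)) * f t"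
    have "I n = (\<integral>\<tau>. \<integral>t. ?h \<tau> t \<partial>lborel \<partial>lborel)"
    proof -
      have "of_real (g n \<tau>) * (cis (s * \<tau>) * ft f \<tau>) = (\<integral>t. ?h \<tau> t \<partial>lborel)" for \<tau>
      proof -
        have h: "?h \<tau> t = (of_real (g n \<tau>) * cis (s * \<tau>)) * (cis (- (t * \<tau>)) * f t)" for t
        proof -
          have "cis ((s - t) * \<tau>) = cis (s * \<tau>) * cis (- (t * \<tau>))"
            by (simp add: cis_mult left_diff_distrib)
          then show ?thesis by (simp only: ac_simps)
        qed
        show ?thesis
          unfolding h integral_mult_right_zero ft_def[symmetric] by (simp only: mult.assoc)
      qed
      then show ?thesis by (simp add: I_def)
    qed
    also have "\<dots> = (\<integral>t. \<integral>\<tau>. ?h \<tau> t \<partial>lborel \<partial>lborel)"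
    proof (rule lborel_pair.Fubini_integral[symmetric])
      show "integrable (lborel \<Otimes>\<^sub>M lborel) (\<lambda>(\<tau>, t). ?h \<tau> t)"
      proof (rule lborel_pair.Fubini_integrable)
        show "integrable lborel (\<lambda>\<tau>. \<integral>t. norm (case (\<tau>, t) of (\<tau>, t) \<Rightarrow> ?h \<tau> t) \<partial>lborel)"
          using int_g int_f by (simp add: norm_mult)
        have "integrable lborel (\<lambda>t. ?h \<tau> t)" for \<tau>
          by (rule Bochner_Integration.integrable_bound[OF int_f])
             (use g1 in \<open>auto simp: norm_mult intro!: mult_left_le_one_le\<close>)
        then show "AE \<tau> in lborel. integrable lborel (\<lambda>t. case (\<tau>, t) of (\<tau>, t) \<Rightarrow> ?h \<tau> t)"
          by simp
      qed measurable
    qed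
    also have "\<dots> = (\<integral>t. of_real (sqrt (2 * pi) / \<epsilon> n * exp (- ((s - t) / \<epsilon> n)\<^sup>2 / 2)) * f t \<partial>lborel)"
    proof (intro Bochner_Integration.integral_cong refl)
      fix t
      have "(\<integral>\<tau>. ?h \<tau> t \<partial>lborel) = (\<integral>\<tau>. cis ((s - t) * \<tau>) * of_real (exp (- (\<epsilon> n * \<tau>)\<^sup>2 / 2)) \<partial>lborel) * f t"
        by (simp add: g_def ac_simps)
      then show "(\<integral>\<tau>. ?h \<tau> t \<partial>lborel) = of_real (sqrt (2 * pi) / \<epsilon> n * exp (- ((s - t) / \<epsilon> n)\<^sup>2 / 2)) * f t"
        unfolding gaussian_transform[OF \<epsilon>] .
    qed
    \<comment> \<open>Substituting \<open>t = s + \<epsilon> n * y\<close> moves the scale from the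
      Gaussian into the argument of \<open>f\<close>, where continuity and a fixed majorant
      apply.\<close>
    also have "\<dots> = \<bar>\<epsilon> n\<bar> *\<^sub>R (\<integral>y. of_real (sqrt (2 * pi) / \<epsilon> n * exp (- ((s - (s + \<epsilon> n * y)) / \<epsilon> n)\<^sup>2 / 2)) * f (s + \<epsilon> n * y) \<partial>lborel)"
      using \<epsilon>[of n] by (intro lborel_integral_real_affine) auto
    also have "\<dots> = (\<integral>y. \<epsilon> n *\<^sub>R (of_real (sqrt (2 * pi) / \<epsilon> n * exp (- ((s - (s + \<epsilon> n * y)) / \<epsilon> n)\<^sup>2 / 2)) * f (s + \<epsilon> n * y)) \<partial>lborel)"
      using \<epsilon>[of n] by simp
    also have "\<dots> = (\<integral>y. of_real (sqrt (2 * pi) * exp (- y\<^sup>2 / 2)) * f (s + \<epsilon> n * y) \<partial>lborel)"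
      using \<epsilon>[of n] by (intro Bochner_Integration.integral_cong refl) (simp add: scaleR_conv_of_real)
    finally show ?thesis .
  qed
  have gauss: "(\<integral>y. complex_of_real (sqrt (2 * pi) * exp (- y\<^sup>2 / 2)) \<partial>lborel) = of_real (2 * pi)"
    using gaussian_transform[of 1 0] by (simp flip: of_real_mult)
  have int_gauss: "integrable lborel (\<lambda>y. sqrt (2 * pi) * exp (- y\<^sup>2 / 2))"
  proof -
    have "integrable lborel (\<lambda>y. sqrt (2 * pi) * std_normal_density y)"
      by (intro integrable_mult_right integrable_normal_density) auto
    then show ?thesis
      by (simp add: std_normal_density_def)
  qed
  have "I \<longlonglongrightarrow> (\<integral>y. of_real (sqrt (2 * pi) * exp (- y\<^sup>2 / 2)) * f s \<partial>lborel)"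
    unfolding I
  proof (rule integral_dominated_convergence[where w="\<lambda>y. sqrt (2 * pi) * exp (- y\<^sup>2 / 2) * \<bar>C\<bar>"])
    have "(\<lambda>n. of_real (sqrt (2 * pi) * exp (- y\<^sup>2 / 2)) * f (s + \<epsilon> n * y)) \<longlonglongrightarrow> of_real (sqrt (2 * pi) * exp (- y\<^sup>2 / 2)) * f s" for y
    proof -
      have "(\<lambda>n. s + \<epsilon> n * y) \<longlonglongrightarrow> s + 0 * y"
        by (intro tendsto_intros \<epsilon>0)
      then have "(\<lambda>n. f (s + \<epsilon> n * y)) \<longlonglongrightarrow> f s"
        using isCont_tendsto_compose[OF cont] by simp
      then show ?thesis by (intro tendsto_intros)
    qed
    then show "AE y in lborel. (\<lambda>n. of_real (sqrt (2 * pi) * exp (- y\<^sup>2 / 2)) * f (s + \<epsilon> n * y)) \<longlonglongrightarrow> of_real (sqrt (2 * pi) * exp (- y\<^sup>2 / 2)) * f s"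
      by simp
    have "norm (f t) \<le> \<bar>C\<bar>" for t
    proof -
      have "norm (f t) \<le> \<bar>C\<bar> / (1 + t\<^sup>2)"
        using decay[of t] decay_pos[of t] by (meson abs_ge_self divide_right_mono less_imp_le order_trans)
      also have "\<dots> \<le> \<bar>C\<bar> / 1"
        by (intro divide_left_mono) (auto simp: decay_pos)
      finally show ?thesis by simp
    qed
    then show "AE y in lborel. norm (of_real (sqrt (2 * pi) * exp (- y\<^sup>2 / 2)) * f (s + \<epsilon> n * y)) \<le> sqrt (2 * pi) * exp (- y\<^sup>2 / 2) * \<bar>C\<bar>" for n
      by (auto simp: norm_mult intro!: mult_left_mono)
  qed (use int_gauss in auto)
  then show "I \<longlonglongrightarrow> of_real (2 * pi) * f s"
    unfolding gauss[symmetric] by simp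
qed

text \<open>\<open>f\<close> is replaced by its inversion integral; the character
  \<open>cis (t * \<tau>1)\<close> then shifts the frequency at which \<open>g\<close> is
  transformed.\<close>

lemma ft_mult:
  assumes f: "schwartz f" and g: "schwartz g"
  shows "of_real (2 * pi) * ft (\<lambda>t. f t * g t) \<tau> = (\<integral>\<tau>1. ft f \<tau>1 * ft g (\<tau> - \<tau>1) \<partial>lborel)"
proof -
  note [measurable] = schwartz_measurable[OF f] schwartz_measurable[OF g]
  note int = schwartz_integrable[OF f] schwartz_integrable[OF g]
  obtain C where C: "\<And>\<tau>. norm (ft f \<tau>) \<le> C / (1 + \<tau>\<^sup>2)"
    using ft_schwartz_decay[OF f] by blast
  have int_ft: "integrable lborel (ft f)"
    by (rule integrable_of_decay[OF _ C]) simp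
  obtain B where B: "\<And>t. norm (f t) \<le> B / (1 + t\<^sup>2)"
    using schwartz_bound[OF f] by blast
  have inv: "of_real (2 * pi) * f t = (\<integral>\<tau>1. cis (t * \<tau>1) * ft f \<tau>1 \<partial>lborel)" for t
    by (rule fourier_inversion[OF schwartz_isCont[OF f] B int_ft, symmetric])
  let ?h = "\<lambda>t \<tau>1. ft f \<tau>1 * (cis (- (t * (\<tau> - \<tau>1))) * g t)"
  have "of_real (2 * pi) * ft (\<lambda>t. f t * g t) \<tau> = (\<integral>t. (of_real (2 * pi) * f t) * (cis (- (t * \<tau>)) * g t) \<partial>lborel)"
    unfolding ft_def integral_mult_right_zero[symmetric] by (simp only: ac_simps)
  also have "\<dots> = (\<integral>t. \<integral>\<tau>1. ?h t \<tau>1 \<partial>lborel \<partial>lborel)"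
  proof (intro Bochner_Integration.integral_cong refl)
    fix t
    have "(of_real (2 * pi) * f t) * (cis (- (t * \<tau>)) * g t) = (\<integral>\<tau>1. (cis (t * \<tau>1) * ft f \<tau>1) * (cis (- (t * \<tau>)) * g t) \<partial>lborel)"
      unfolding inv by simp
    also have "\<dots> = (\<integral>\<tau>1. ?h t \<tau>1 \<partial>lborel)"
    proof (intro Bochner_Integration.integral_cong refl)
      fix \<tau>1
      have "cis (- (t * (\<tau> - \<tau>1))) = cis (t * \<tau>1) * cis (- (t * \<tau>))"
        by (simp add: cis_mult algebra_simps)
      then show "(cis (t * \<tau>1) * ft f \<tau>1) * (cis (- (t * \<tau>)) * g t) = ?h t \<tau>1"
        by (simp only: ac_simps)
    qed
    finally show "(of_real (2 * pi) * f t) * (cis (- (t * \<tau>)) * g t) = \<dots>" .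
  qed
  also have "\<dots> = (\<integral>\<tau>1. \<integral>t. ?h t \<tau>1 \<partial>lborel \<partial>lborel)"
  proof (rule lborel_pair.Fubini_integral[symmetric])
    show "integrable (lborel \<Otimes>\<^sub>M lborel) (\<lambda>(t, \<tau>1). ?h t \<tau>1)"
    proof (rule lborel_pair.Fubini_integrable)
      show "integrable lborel (\<lambda>t. \<integral>\<tau>1. norm (case (t, \<tau>1) of (t, \<tau>1) \<Rightarrow> ?h t \<tau>1) \<partial>lborel)"
        using int_ft int by (simp add: norm_mult)
      have "integrable lborel (\<lambda>\<tau>1. ?h t \<tau>1)" for t
        by (rule Bochner_Integration.integrable_bound[OF integrable_mult_left[OF int_ft, of "g t"]])
           (auto simp: norm_mult)
      then show "AE t in lborel. integrable lborel (\<lambda>\<tau>1. case (t, \<tau>1) of (t, \<tau>1) \<Rightarrow> ?h t \<tau>1)"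
        by simp
    qed measurable
  qed
  also have "\<dots> = (\<integral>\<tau>1. ft f \<tau>1 * ft g (\<tau> - \<tau>1) \<partial>lborel)"
    by (simp add: ft_def)
  finally show ?thesis .
qed

lemma norm_ft_mult_le:
  assumes f: "schwartz f" and g: "schwartz g"
  shows "ennreal (norm (ft (\<lambda>t. f t * g t) \<tau>))
    \<le> (\<integral>\<^sup>+\<tau>1. ennreal (norm (ft f \<tau>1)) * ennreal (norm (ft g (\<tau> - \<tau>1))) \<partial>lborel)"
proof -
  note [measurable] = schwartz_measurable[OF f] schwartz_measurable[OF g]
  \<comment> \<open>The factor \<open>2 * pi \<ge> 1\<close> may be dropped in an upper
    bound.\<close>
  have "1 * norm (ft (\<lambda>t. f t * g t) \<tau>) \<le> (2 * pi) * norm (ft (\<lambda>t. f t * g t) \<tau>)"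
    using pi_ge_two by (intro mult_right_mono) auto
  also have "\<dots> = norm (of_real (2 * pi) * ft (\<lambda>t. f t * g t) \<tau>)"
    unfolding norm_mult norm_of_real by simp
  finally have "ennreal (norm (ft (\<lambda>t. f t * g t) \<tau>)) \<le> ennreal (norm (\<integral>\<tau>1. ft f \<tau>1 * ft g (\<tau> - \<tau>1) \<partial>lborel))"
    unfolding ft_mult[OF f g] by (simp add: ennreal_leI)
  also have "\<dots> \<le> (\<integral>\<^sup>+\<tau>1. ennreal (norm (ft f \<tau>1 * ft g (\<tau> - \<tau>1))) \<partial>lborel)"
  \<comment> \<open>A non-integrable convolution has Bochner integral 0, for which the bound is
    trivial.\<close>
  proof (cases "integrable lborel (\<lambda>\<tau>1. ft f \<tau>1 * ft g (\<tau> - \<tau>1))")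
    case True
    then show ?thesis by (rule integral_norm_bound_ennreal)
  next
    case False
    then show ?thesis by (simp add: not_integrable_integral_eq)
  qed
  finally show ?thesis
    by (simp add: norm_mult ennreal_mult)
qed

section \<open>The discrete Fourier transform\<close>

lemma sum_dtorus:
  assumes "0 < N"
  shows "(\<Sum>x\<in>dtorus N. g x) = (\<Sum>n\<in>dfreq N. g (mesh N * of_int n))"
proof -
  have "inj_on (\<lambda>n::int. mesh N * of_int n) {- int N..<int N}"
    using mesh_pos[OF assms] by (auto simp: inj_on_def)
  then show ?thesis
    unfolding dtorus_def dfreq_def by (subst sum.reindex) auto
qed

lemma finite_dtorus [simp]: "finite (dtorus N)"
  by (simp add: dtorus_def)

lemma cis_mesh_period:
  assumes "0 < N"
  shows "cis (mesh N * of_int (2 * int N * q)) = 1"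
proof -
  have "mesh N * of_int (2 * int N * q) = 2 * pi * of_int q"
    unfolding mesh_mult_N[OF assms, symmetric] by simp
  then show ?thesis by (simp only: cis_multiple_2pi Ints_of_int)
qed

lemma cis_mesh_cyc:
  assumes "0 < N"
  shows "cis (mesh N * of_int (cyc N j * l)) = cis (mesh N * of_int (j * l))"
proof -
  obtain q where q: "cyc N j = j + 2 * int N * q" using cyc_eq by blast
  have "mesh N * of_int (cyc N j * l) = mesh N * of_int (j * l) + mesh N * of_int (2 * int N * (q * l))"
    by (simp add: q algebra_simps)
  then show ?thesis
    by (simp only: cis_mult[symmetric] cis_mesh_period[OF assms] mult_1_right)
qed

text \<open>Translating the summation variable by one multiplies the sum by
  \<open>cis (mesh N * of_int l)\<close>, so the sum vanishes unless that factor is 1, which forces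
  2N to divide \<open>l\<close>.\<close>

lemma character_sum:
  assumes N: "0 < N"
  shows "(\<Sum>n\<in>dfreq N. cis (mesh N * of_int (n * l))) = (if 2 * int N dvd l then of_nat (2 * N) else 0)"
proof (cases "2 * int N dvd l")
  case True
  then obtain q where q: "l = 2 * int N * q" by blast
  have "cis (mesh N * of_int (n * l)) = 1" for n
    using cis_mesh_period[OF N, of "n * q"] by (simp add: q ac_simps)
  then show ?thesis using True by (simp add: dfreq_def)
next
  case False
  let ?S = "\<Sum>n\<in>dfreq N. cis (mesh N * of_int (n * l))"
  have "?S = (\<Sum>n\<in>dfreq N. cis (mesh N * of_int (cyc N (n - (- 1)) * l)))"
    using N by (rule sum_dfreq_shift[symmetric])
  also have "\<dots> = (\<Sum>n\<in>dfreq N. cis (mesh N * of_int l) * cis (mesh N * of_int (n * l)))"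
    unfolding cis_mesh_cyc[OF N] by (intro sum.cong refl) (simp add: cis_mult algebra_simps)
  also have "\<dots> = cis (mesh N * of_int l) * ?S"
    by (rule sum_distrib_left[symmetric])
  finally have "(1 - cis (mesh N * of_int l)) * ?S = 0"
    by (simp add: algebra_simps)
  moreover have "cis (mesh N * of_int l) \<noteq> 1"
  proof
    assume "cis (mesh N * of_int l) = 1"
    then have "cos (mesh N * of_int l) = 1"
      by (simp add: complex_eq_iff)
    then obtain m :: int where "mesh N * of_int l = real_of_int m * 2 * pi"
      unfolding cos_one_2pi_int by blast
    also have "\<dots> = mesh N * of_int (2 * int N * m)"
      unfolding mesh_mult_N[OF N, symmetric] by simp
    finally have "l = 2 * int N * m"
      using mesh_pos[OF N] by (simp only: mult_cancel_left of_int_eq_iff) simp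
    with False show False by simp
  qed
  ultimately show ?thesis using False by simp
qed

lemma dfourier_eq:
  assumes "0 < N"
  shows "dfourier N f k = (1 / of_nat (2 * N)) * (\<Sum>n\<in>dfreq N. cis (- (mesh N * of_int (n * k))) * f (mesh N * of_int n))"
  unfolding dfourier_def sum_dtorus[OF assms]
  using assms by (simp add: mesh_def ac_simps)

lemma dfourier_cyc:
  assumes "0 < N"
  shows "dfourier N f (cyc N j) = dfourier N f j"
proof -
  have "cis (- (mesh N * of_int (n * cyc N j))) = cis (- (mesh N * of_int (n * j)))" for n
    using cis_mesh_cyc[OF assms, of j "- n"] by (simp add: ac_simps)
  then show ?thesis by (simp only: dfourier_eq[OF assms])
qed

lemma dfreq_dvd_diff:
  assumes "k \<in> dfreq N" "j \<in> dfreq N"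
  shows "2 * int N dvd k - j \<longleftrightarrow> k = j"
proof
  assume "2 * int N dvd k - j"
  then obtain q where q: "k - j = 2 * int N * q" by blast
  have "k \<in> {- int N..<int N}" "j \<in> {- int N..<int N}"
    using assms by (simp_all add: dfreq_def)
  then have "0 < int N" "int N * (- 1) < int N * q" "int N * q < int N * 1"
    using q unfolding atLeastLessThan_iff by linarith+
  then have "- 1 < q" "q < 1"
    by (simp_all only: mult_less_cancel_left_pos)
  then have "q = 0" by linarith
  then show "k = j" using q by simp
qed simp

text \<open>\<open>dnabla\<close> is defined by a trigonometric sum; recovering the coefficients of
  such a sum shows that it acts as a multiplier.\<close>

lemma dfourier_synthesis:
  assumes N: "0 < N" and k: "k \<in> dfreq N"
  shows "dfourier N (\<lambda>x. \<Sum>j\<in>dfreq N. c j * cis (of_int j * x)) k = c k"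
proof -
  have "(\<Sum>n\<in>dfreq N. cis (- (mesh N * of_int (n * k))) * (\<Sum>j\<in>dfreq N. c j * cis (of_int j * (mesh N * of_int n))))
    = (\<Sum>n\<in>dfreq N. \<Sum>j\<in>dfreq N. c j * cis (mesh N * of_int (n * (j - k))))"
  proof (intro sum.cong refl)
    fix n
    have "cis (- (mesh N * of_int (n * k))) * cis (of_int j * (mesh N * of_int n)) = cis (mesh N * of_int (n * (j - k)))" for j
      by (simp add: cis_mult algebra_simps)
    then show "cis (- (mesh N * of_int (n * k))) * (\<Sum>j\<in>dfreq N. c j * cis (of_int j * (mesh N * of_int n)))
        = (\<Sum>j\<in>dfreq N. c j * cis (mesh N * of_int (n * (j - k))))"
      unfolding sum_distrib_left by (intro sum.cong refl) (simp only: ac_simps)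
  qed
  also have "\<dots> = (\<Sum>j\<in>dfreq N. c j * (\<Sum>n\<in>dfreq N. cis (mesh N * of_int (n * (j - k)))))"
    by (subst sum.swap) (simp add: sum_distrib_left)
  also have "\<dots> = (\<Sum>j\<in>dfreq N. if j = k then c j * of_nat (2 * N) else 0)"
    by (intro sum.cong refl) (simp only: character_sum[OF N] dfreq_dvd_diff[OF _ k], simp)
  also have "\<dots> = c k * of_nat (2 * N)"
    using k by (simp add: sum.delta)
  finally show ?thesis
    using N by (simp add: dfourier_eq)
qed

lemma dfourier_inversion:
  assumes N: "0 < N" and m: "m \<in> dfreq N"
  shows "f (mesh N * of_int m) = (\<Sum>k\<in>dfreq N. cis (mesh N * of_int (m * k)) * dfourier N f k)"
proof -
  have "(\<Sum>k\<in>dfreq N. cis (mesh N * of_int (m * k)) * (\<Sum>n\<in>dfreq N. cis (- (mesh N * of_int (n * k))) * f (mesh N * of_int n)))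
    = (\<Sum>k\<in>dfreq N. \<Sum>n\<in>dfreq N. f (mesh N * of_int n) * cis (mesh N * of_int (k * (m - n))))"
  proof (intro sum.cong refl)
    fix k
    have "cis (mesh N * of_int (m * k)) * cis (- (mesh N * of_int (n * k))) = cis (mesh N * of_int (k * (m - n)))" for n
      by (simp add: cis_mult algebra_simps)
    then show "cis (mesh N * of_int (m * k)) * (\<Sum>n\<in>dfreq N. cis (- (mesh N * of_int (n * k))) * f (mesh N * of_int n))
        = (\<Sum>n\<in>dfreq N. f (mesh N * of_int n) * cis (mesh N * of_int (k * (m - n))))"
      unfolding sum_distrib_left by (intro sum.cong refl) (simp only: ac_simps)
  qed
  also have "\<dots> = (\<Sum>n\<in>dfreq N. f (mesh N * of_int n) * (\<Sum>k\<in>dfreq N. cis (mesh N * of_int (k * (m - n)))))"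
    by (subst sum.swap) (simp add: sum_distrib_left)
  also have "\<dots> = (\<Sum>n\<in>dfreq N. if m = n then f (mesh N * of_int n) * of_nat (2 * N) else 0)"
    by (intro sum.cong refl) (simp only: character_sum[OF N] dfreq_dvd_diff[OF m], simp)
  also have "\<dots> = f (mesh N * of_int m) * of_nat (2 * N)"
    using m by (simp add: sum.delta')
  finally have "(1 / of_nat (2 * N)) * (\<Sum>k\<in>dfreq N. cis (mesh N * of_int (m * k)) * (\<Sum>n\<in>dfreq N. cis (- (mesh N * of_int (n * k))) * f (mesh N * of_int n)))
      = f (mesh N * of_int m)"
    using N by simp
  then show ?thesis
    unfolding dfourier_eq[OF N] sum_distrib_left by (simp only: ac_simps)
qed

text \<open>\<open>f\<close> is expanded by inversion and its characters are absorbed into the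
  transform of \<open>g\<close>, whose index is folded back by \<open>dfourier_cyc\<close>.\<close>

lemma dfourier_mult:
  assumes N: "0 < N"
  shows "dfourier N (\<lambda>x. f x * g x) k = (\<Sum>k1\<in>dfreq N. dfourier N f k1 * dfourier N g (cyc N (k - k1)))"
proof -
  have "(\<Sum>n\<in>dfreq N. cis (- (mesh N * of_int (n * k))) * (f (mesh N * of_int n) * g (mesh N * of_int n)))
    = (\<Sum>n\<in>dfreq N. \<Sum>k1\<in>dfreq N. dfourier N f k1 * (cis (- (mesh N * of_int (n * (k - k1)))) * g (mesh N * of_int n)))"
  proof (intro sum.cong refl)
    fix n assume n: "n \<in> dfreq N"
    have "cis (- (mesh N * of_int (n * k))) * cis (mesh N * of_int (n * k1)) = cis (- (mesh N * of_int (n * (k - k1))))" for k1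
      by (simp add: cis_mult algebra_simps)
    then show "cis (- (mesh N * of_int (n * k))) * (f (mesh N * of_int n) * g (mesh N * of_int n))
      = (\<Sum>k1\<in>dfreq N. dfourier N f k1 * (cis (- (mesh N * of_int (n * (k - k1)))) * g (mesh N * of_int n)))"
      unfolding dfourier_inversion[OF N n, of f] sum_distrib_left sum_distrib_right
      by (intro sum.cong refl) (simp only: ac_simps)
  qed
  also have "\<dots> = (\<Sum>k1\<in>dfreq N. dfourier N f k1 * (\<Sum>n\<in>dfreq N. cis (- (mesh N * of_int (n * (k - k1)))) * g (mesh N * of_int n)))"
    by (subst sum.swap) (simp only: sum_distrib_left)
  finally have eq: "(\<Sum>n\<in>dfreq N. cis (- (mesh N * of_int (n * k))) * (f (mesh N * of_int n) * g (mesh N * of_int n))) = \<dots>" .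
  have "dfourier N (\<lambda>x. f x * g x) k = (\<Sum>k1\<in>dfreq N. dfourier N f k1 *
      ((1 / of_nat (2 * N)) * (\<Sum>n\<in>dfreq N. cis (- (mesh N * of_int (n * (k - k1)))) * g (mesh N * of_int n))))"
    unfolding dfourier_eq[OF N, of "\<lambda>x. f x * g x"] eq sum_distrib_left[of "1 / of_nat (2 * N)" _ "dfreq N"]
    by (intro sum.cong refl) (simp only: mult.left_commute sum_distrib_left)
  then show ?thesis
    unfolding dfourier_cyc[OF N] by (simp only: dfourier_eq[OF N, of g])
qed

definition dnabla_symbol :: "nat \<Rightarrow> int \<Rightarrow> complex"
  where "dnabla_symbol N k = (2 * \<i> / of_real (mesh N)) * of_real (sin (mesh N * of_int k / 2))"

lemma dfourier_dnabla:
  assumes "0 < N" "k \<in> dfreq N"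
  shows "dfourier N (dnabla N f) k = dnabla_symbol N k * dfourier N f k"
proof -
  have "dnabla N f = (\<lambda>x. \<Sum>j\<in>dfreq N. (dnabla_symbol N j * dfourier N f j) * cis (of_int j * x))"
    by (rule ext) (simp only: dnabla_def dnabla_symbol_def)
  then show ?thesis
    by (simp only: dfourier_synthesis[OF assms])
qed

lemma norm_dnabla_symbol_le:
  assumes "0 < N"
  shows "norm (dnabla_symbol N k) \<le> \<bar>real_of_int k\<bar>"
proof -
  have "norm (dnabla_symbol N k) = 2 / mesh N * \<bar>sin (mesh N * of_int k / 2)\<bar>"
    unfolding dnabla_symbol_def norm_mult norm_divide norm_of_real using mesh_pos[OF assms] by simp
  also have "\<dots> \<le> 2 / mesh N * \<bar>mesh N * of_int k / 2\<bar>"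
    using mesh_pos[OF assms] by (intro mult_left_mono abs_sin_x_le_abs_x) auto
  also have "\<dots> = \<bar>real_of_int k\<bar>"
    using mesh_pos[OF assms] by (simp add: abs_mult)
  finally show ?thesis .
qed

text \<open>Taking the transform in space first reduces the space-time transform to
  \<open>ft\<close> mode by mode. Integrability lets the finite sum pass through the Bochner
  integral.\<close>

lemma stfourier_eq_ft:
  assumes "\<And>x. x \<in> dtorus N \<Longrightarrow> integrable lborel (\<lambda>t. u t x)"
  shows "stfourier N u \<tau> k = ft (\<lambda>t. dfourier N (u t) k) \<tau>"
proof -
  have int: "integrable lborel (\<lambda>t. cis (- (t * \<tau>)) * (cis (- (x * of_int k)) * u t x))" if "x \<in> dtorus N" for x
    by (rule integrable_cis_mult, rule integrable_mult_right, rule assms[OF that])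
  have "ft (\<lambda>t. dfourier N (u t) k) \<tau>
    = (\<integral>t. of_real (mesh N / (2 * pi)) * (\<Sum>x\<in>dtorus N. cis (- (t * \<tau>)) * (cis (- (x * of_int k)) * u t x)) \<partial>lborel)"
    unfolding ft_def dfourier_def
  proof (intro Bochner_Integration.integral_cong refl)
    fix t
    show "cis (- (t * \<tau>)) * (of_real (mesh N / (2 * pi)) * (\<Sum>x\<in>dtorus N. cis (- (x * of_int k)) * u t x))
      = of_real (mesh N / (2 * pi)) * (\<Sum>x\<in>dtorus N. cis (- (t * \<tau>)) * (cis (- (x * of_int k)) * u t x))"
      unfolding sum_distrib_left[symmetric] by (rule mult.left_commute)
  qed
  also have "\<dots> = of_real (mesh N / (2 * pi)) * (\<Sum>x\<in>dtorus N. \<integral>t. cis (- (t * \<tau>)) * (cis (- (x * of_int k)) * u t x) \<partial>lborel)"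
    unfolding integral_mult_right_zero using int by (subst Bochner_Integration.integral_sum) auto
  finally show ?thesis
    by (simp add: stfourier_def mult.assoc)
qed

section \<open>Linear operations on Schwartz functions\<close>

lemma schwartz_add:
  assumes "schwartz f" "schwartz g"
  shows "schwartz (\<lambda>t. f t + g t)"
proof -
  obtain D where D: "D 0 = f" "\<And>n t. (D n has_vector_derivative D (Suc n) t) (at t)"
    "\<And>m n. bounded (range (\<lambda>t. t ^ m *\<^sub>R D n t))"
    using assms(1) unfolding schwartz_def by blast
  obtain E where E: "E 0 = g" "\<And>n t. (E n has_vector_derivative E (Suc n) t) (at t)"
    "\<And>m n. bounded (range (\<lambda>t. t ^ m *\<^sub>R E n t))"
    using assms(2) unfolding schwartz_def by blast
  show ?thesis
    unfolding schwartz_def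
  proof (intro exI[of _ "\<lambda>n t. D n t + E n t"] conjI allI)
    fix m n t
    show "((\<lambda>t. D n t + E n t) has_vector_derivative D (Suc n) t + E (Suc n) t) (at t)"
      by (intro has_vector_derivative_add D E)
    show "bounded (range (\<lambda>t. t ^ m *\<^sub>R (D n t + E n t)))"
      unfolding scaleR_add_right by (intro bounded_plus_comp D E)
  qed (simp add: D(1) E(1))
qed

lemma schwartz_cmult:
  assumes "schwartz f"
  shows "schwartz (\<lambda>t. c * f t)"
proof -
  obtain D where D: "D 0 = f" "\<And>n t. (D n has_vector_derivative D (Suc n) t) (at t)"
    "\<And>m n. bounded (range (\<lambda>t. t ^ m *\<^sub>R D n t))"
    using assms(1) unfolding schwartz_def by blast
  show ?thesis
    unfolding schwartz_def
  proof (intro exI[of _ "\<lambda>n t. c * D n t"] conjI allI)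
    fix m n t
    show "((\<lambda>t. c * D n t) has_vector_derivative c * D (Suc n) t) (at t)"
      using D(2) by (rule has_vector_derivative_mult_right)
    obtain B where B: "\<And>t. norm (t ^ m *\<^sub>R D n t) \<le> B"
      using D(3)[of m n] unfolding bounded_iff by blast
    have "norm (t ^ m *\<^sub>R (c * D n t)) \<le> norm c * B" for t
    proof -
      have "norm (t ^ m *\<^sub>R (c * D n t)) = norm c * norm (t ^ m *\<^sub>R D n t)"
        by (simp add: norm_mult)
      then show ?thesis
        using B[of t] by (simp only: mult_left_mono norm_ge_zero)
    qed
    then show "bounded (range (\<lambda>t. t ^ m *\<^sub>R (c * D n t)))"
      unfolding bounded_iff by blast
  qed (simp add: D(1))
qed

lemma schwartz_0: "schwartz (\<lambda>t. 0)"
  unfolding schwartz_def by (intro exI[of _ "\<lambda>n t. 0"]) auto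

lemma schwartz_sum:
  assumes "finite I" "\<And>i. i \<in> I \<Longrightarrow> schwartz (f i)"
  shows "schwartz (\<lambda>t. \<Sum>i\<in>I. f i t)"
  using assms by (induction rule: finite_induct) (auto simp: schwartz_0 schwartz_add)

lemma schwartz_dfourier:
  assumes "schwartz_in_time N u"
  shows "schwartz (\<lambda>t. dfourier N (u t) k)"
  using assms unfolding dfourier_def schwartz_in_time_def
  by (intro schwartz_cmult schwartz_sum) auto

section \<open>Limits\<close>

lemma esqrt_mono: "a \<le> b \<Longrightarrow> esqrt a \<le> esqrt b"
  by (auto simp: esqrt_def top_unique intro!: ennreal_leI enn2real_mono simp: less_top)

lemma esqrt_square [simp]: "esqrt (a\<^sup>2) = a"
  by (cases a) (auto simp: esqrt_def ennreal_power power2_eq_square[of "top::ennreal"] ennreal_top_mult)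

lemma square_esqrt [simp]: "(esqrt a)\<^sup>2 = a"
  by (cases a) (auto simp: esqrt_def ennreal_power power2_eq_square[of top] ennreal_top_mult)

lemma esqrt_le: "a \<le> b\<^sup>2 \<Longrightarrow> esqrt a \<le> b"
  using esqrt_mono[of a "b\<^sup>2"] by simp

lemma tendsto_0_of_square_le:
  fixes x c :: "nat \<Rightarrow> ennreal"
  assumes "\<And>n. (x n)\<^sup>2 \<le> c n" "c \<longlonglongrightarrow> 0"
  shows "x \<longlonglongrightarrow> 0"
proof (rule order_tendstoI)
  fix e :: ennreal assume "0 < e"
  then have "0 < e * e" by (simp add: ennreal_zero_less_mult_iff)
  with assms(2) have "eventually (\<lambda>n. c n < e * e) sequentially"
    by (rule order_tendstoD)
  then show "eventually (\<lambda>n. x n < e) sequentially"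
  proof eventually_elim
    case (elim n)
    show "x n < e"
    proof (rule ccontr)
      assume "\<not> x n < e"
      then have "e * e \<le> x n * x n" by (intro mult_mono) auto
      with elim assms(1)[of n] show False by (simp add: power2_eq_square)
    qed
  qed
qed simp

lemma ennreal_square_sum_le:
  fixes x y :: ennreal
  shows "(x + y)\<^sup>2 \<le> 2 * x\<^sup>2 + 2 * y\<^sup>2"
proof -
  have "2 * (x * y) \<le> x\<^sup>2 + y\<^sup>2"
    by (rule ennreal_amgm) (simp add: power_mult_distrib)
  then have "x\<^sup>2 + y\<^sup>2 + 2 * (x * y) \<le> x\<^sup>2 + y\<^sup>2 + (x\<^sup>2 + y\<^sup>2)"
    by (rule add_left_mono)
  then show ?thesis
    by (simp add: power2_eq_square algebra_simps mult_2 mult_2_right)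
qed

lemma square_norm_add_le:
  fixes x y :: complex
  shows "ennreal ((norm (x + y))\<^sup>2) \<le> 2 * ennreal ((norm x)\<^sup>2) + 2 * ennreal ((norm y)\<^sup>2)"
proof -
  have "ennreal (norm (x + y)) \<le> ennreal (norm x) + ennreal (norm y)"
    by (simp add: norm_triangle_ineq flip: ennreal_plus)
  then have "(ennreal (norm (x + y)))\<^sup>2 \<le> (ennreal (norm x) + ennreal (norm y))\<^sup>2"
    by (intro power_mono) auto
  also have "\<dots> \<le> 2 * (ennreal (norm x))\<^sup>2 + 2 * (ennreal (norm y))\<^sup>2"
    by (rule ennreal_square_sum_le)
  finally show ?thesis by (simp add: ennreal_power)
qed

lemma Fatou_sum:
  fixes h :: "nat \<Rightarrow> int \<Rightarrow> real \<Rightarrow> ennreal"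
  assumes [measurable]: "\<And>n k. h n k \<in> borel_measurable borel"
    and lim: "\<And>k \<tau>. k \<in> I \<Longrightarrow> (\<lambda>n. h n k \<tau>) \<longlonglongrightarrow> g k \<tau>"
    and bound: "\<And>n. (\<Sum>k\<in>I. \<integral>\<^sup>+\<tau>. h n k \<tau> \<partial>lborel) \<le> B n" and B: "B \<longlonglongrightarrow> b"
    and [measurable]: "\<And>k. g k \<in> borel_measurable borel"
  shows "(\<Sum>k\<in>I. \<integral>\<^sup>+\<tau>. g k \<tau> \<partial>lborel) \<le> b"
proof -
  have "(\<Sum>k\<in>I. \<integral>\<^sup>+\<tau>. g k \<tau> \<partial>lborel) = (\<integral>\<^sup>+\<tau>. (\<Sum>k\<in>I. g k \<tau>) \<partial>lborel)"
    by (rule nn_integral_sum[symmetric]) auto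
  also have "\<dots> = (\<integral>\<^sup>+\<tau>. liminf (\<lambda>n. \<Sum>k\<in>I. h n k \<tau>) \<partial>lborel)"
    by (intro nn_integral_cong lim_imp_Liminf[symmetric] tendsto_sum lim) auto
  also have "\<dots> \<le> liminf (\<lambda>n. \<integral>\<^sup>+\<tau>. (\<Sum>k\<in>I. h n k \<tau>) \<partial>lborel)"
    by (intro nn_integral_liminf) auto
  also have "\<dots> = liminf (\<lambda>n. \<Sum>k\<in>I. \<integral>\<^sup>+\<tau>. h n k \<tau> \<partial>lborel)"
    by (subst nn_integral_sum) auto
  also have "\<dots> \<le> liminf B"
    by (intro Liminf_mono always_eventually allI bound)
  also have "\<dots> = b"
    using B by (intro lim_imp_Liminf) auto
  finally show ?thesis .
qed

text \<open>The squares stand outside the integrals, so Fatou's lemma is applied for each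
  \<open>k\<close>. The tail infima \<open>z\<close> converge upwards to the lower limits
  \<open>l\<close>, which allows squaring and summing, and their sums of squares lie below every
  later \<open>B m\<close>.\<close>

lemma Fatou_sum_squares:
  fixes h :: "nat \<Rightarrow> int \<Rightarrow> real \<Rightarrow> ennreal"
  assumes [measurable]: "\<And>n k. h n k \<in> borel_measurable borel"
    and lim: "\<And>k \<tau>. k \<in> I \<Longrightarrow> (\<lambda>n. h n k \<tau>) \<longlonglongrightarrow> g k \<tau>"
    and bound: "\<And>n. (\<Sum>k\<in>I. (\<integral>\<^sup>+\<tau>. h n k \<tau> \<partial>lborel)\<^sup>2) \<le> B n" and B: "B \<longlonglongrightarrow> b"
  shows "(\<Sum>k\<in>I. (\<integral>\<^sup>+\<tau>. g k \<tau> \<partial>lborel)\<^sup>2) \<le> b"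
proof -
  define y where "y n k = (\<integral>\<^sup>+\<tau>. h n k \<tau> \<partial>lborel)" for n k
  define z where "z n k = (INF m\<in>{n..}. y m k)" for n k
  define l where "l k = (SUP n. z n k)" for k
  have "(\<lambda>n. z n k) \<longlonglongrightarrow> l k" for k
    unfolding l_def by (intro LIMSEQ_SUP) (auto simp: z_def incseq_def intro!: INF_superset_mono)
  then have "(\<lambda>n. \<Sum>k\<in>I. (z n k)\<^sup>2) \<longlonglongrightarrow> (\<Sum>k\<in>I. (l k)\<^sup>2)"
    unfolding power2_eq_square by (intro tendsto_sum tendsto_mult_ennreal) auto
  moreover have "(\<Sum>k\<in>I. (z n k)\<^sup>2) \<le> b" for n
  proof (rule LIMSEQ_le_const[OF B], intro exI[of _ n] allI impI)
    fix m assume "n \<le> m"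
    then have "(\<Sum>k\<in>I. (z n k)\<^sup>2) \<le> (\<Sum>k\<in>I. (y m k)\<^sup>2)"
      by (intro sum_mono power_mono) (auto simp: z_def intro: INF_lower)
    also have "\<dots> \<le> B m" unfolding y_def by (rule bound)
    finally show "(\<Sum>k\<in>I. (z n k)\<^sup>2) \<le> B m" .
  qed
  ultimately have "(\<Sum>k\<in>I. (l k)\<^sup>2) \<le> b"
    by (intro LIMSEQ_le_const2) auto
  moreover have "(\<integral>\<^sup>+\<tau>. g k \<tau> \<partial>lborel) \<le> l k" if "k \<in> I" for k
  proof -
    have "(\<integral>\<^sup>+\<tau>. g k \<tau> \<partial>lborel) = (\<integral>\<^sup>+\<tau>. liminf (\<lambda>n. h n k \<tau>) \<partial>lborel)"
      using that by (intro nn_integral_cong lim_imp_Liminf[symmetric] lim) auto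
    also have "\<dots> \<le> liminf (\<lambda>n. y n k)"
      unfolding y_def by (intro nn_integral_liminf) auto
    finally show ?thesis
      by (simp add: l_def z_def liminf_SUP_INF)
  qed
  then have "(\<Sum>k\<in>I. (\<integral>\<^sup>+\<tau>. g k \<tau> \<partial>lborel)\<^sup>2) \<le> (\<Sum>k\<in>I. (l k)\<^sup>2)"
    by (intro sum_mono power_mono) auto
  ultimately show ?thesis by (rule order_trans[rotated])
qed

section \<open>Convergence in L2 in time\<close>

definition L2_lim :: "(nat \<Rightarrow> real \<Rightarrow> complex) \<Rightarrow> (real \<Rightarrow> complex) \<Rightarrow> bool"
  where "L2_lim fn f \<longleftrightarrow> (\<forall>n. fn n \<in> borel_measurable borel) \<and> f \<in> borel_measurable borel
    \<and> (\<lambda>n. \<integral>\<^sup>+t. ennreal ((norm (fn n t - f t))\<^sup>2) \<partial>lborel) \<longlonglongrightarrow> 0"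

lemma L2_lim_add:
  assumes "L2_lim fn f" "L2_lim gn g"
  shows "L2_lim (\<lambda>n t. fn n t + gn n t) (\<lambda>t. f t + g t)"
proof -
  have [measurable]: "fn n \<in> borel_measurable borel" "f \<in> borel_measurable borel"
    "gn n \<in> borel_measurable borel" "g \<in> borel_measurable borel" for n
    using assms by (auto simp: L2_lim_def)
  have "(\<lambda>n. \<integral>\<^sup>+t. ennreal ((norm ((fn n t + gn n t) - (f t + g t)))\<^sup>2) \<partial>lborel) \<longlonglongrightarrow> 0"
  proof (rule tendsto_sandwich[OF _ _ tendsto_const])
    have "(\<lambda>n. 2 * (\<integral>\<^sup>+t. ennreal ((norm (fn n t - f t))\<^sup>2) \<partial>lborel)
        + 2 * (\<integral>\<^sup>+t. ennreal ((norm (gn n t - g t))\<^sup>2) \<partial>lborel)) \<longlonglongrightarrow> 2 * 0 + 2 * 0"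
      using assms by (intro tendsto_add tendsto_mult_ennreal tendsto_const) (auto simp: L2_lim_def)
    then show "(\<lambda>n. 2 * (\<integral>\<^sup>+t. ennreal ((norm (fn n t - f t))\<^sup>2) \<partial>lborel)
        + 2 * (\<integral>\<^sup>+t. ennreal ((norm (gn n t - g t))\<^sup>2) \<partial>lborel)) \<longlonglongrightarrow> 0"
      by simp
    have "(\<integral>\<^sup>+t. ennreal ((norm ((fn n t + gn n t) - (f t + g t)))\<^sup>2) \<partial>lborel)
      \<le> (\<integral>\<^sup>+t. 2 * ennreal ((norm (fn n t - f t))\<^sup>2) + 2 * ennreal ((norm (gn n t - g t))\<^sup>2) \<partial>lborel)" for n
      unfolding add_diff_add by (intro nn_integral_mono square_norm_add_le)
    also have "(\<integral>\<^sup>+t. 2 * ennreal ((norm (fn n t - f t))\<^sup>2) + 2 * ennreal ((norm (gn n t - g t))\<^sup>2) \<partial>lborel)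
      = 2 * (\<integral>\<^sup>+t. ennreal ((norm (fn n t - f t))\<^sup>2) \<partial>lborel)
        + 2 * (\<integral>\<^sup>+t. ennreal ((norm (gn n t - g t))\<^sup>2) \<partial>lborel)" for n
      by (simp add: nn_integral_add nn_integral_cmult)
    finally show "eventually (\<lambda>n. (\<integral>\<^sup>+t. ennreal ((norm ((fn n t + gn n t) - (f t + g t)))\<^sup>2) \<partial>lborel)
      \<le> 2 * (\<integral>\<^sup>+t. ennreal ((norm (fn n t - f t))\<^sup>2) \<partial>lborel)
        + 2 * (\<integral>\<^sup>+t. ennreal ((norm (gn n t - g t))\<^sup>2) \<partial>lborel)) sequentially"
      by simp
  qed simp
  then show ?thesis by (simp add: L2_lim_def)
qed

lemma L2_lim_cmult:
  assumes "L2_lim fn f"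
  shows "L2_lim (\<lambda>n t. c * fn n t) (\<lambda>t. c * f t)"
proof -
  have [measurable]: "fn n \<in> borel_measurable borel" "f \<in> borel_measurable borel" for n
    using assms by (auto simp: L2_lim_def)
  have "(\<integral>\<^sup>+t. ennreal ((norm (c * fn n t - c * f t))\<^sup>2) \<partial>lborel)
      = ennreal ((norm c)\<^sup>2) * (\<integral>\<^sup>+t. ennreal ((norm (fn n t - f t))\<^sup>2) \<partial>lborel)" for n
    by (subst nn_integral_cmult[symmetric])
       (auto simp: norm_mult power_mult_distrib simp flip: ennreal_mult right_diff_distrib)
  moreover have "(\<lambda>n. ennreal ((norm c)\<^sup>2) * (\<integral>\<^sup>+t. ennreal ((norm (fn n t - f t))\<^sup>2) \<partial>lborel)) \<longlonglongrightarrow> ennreal ((norm c)\<^sup>2) * 0"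
    using assms by (intro tendsto_mult_ennreal tendsto_const) (auto simp: L2_lim_def)
  ultimately show ?thesis by (simp add: L2_lim_def)
qed

lemma L2_lim_sum:
  assumes "finite I" "\<And>i. i \<in> I \<Longrightarrow> L2_lim (\<lambda>n. fn n i) (f i)"
  shows "L2_lim (\<lambda>n t. \<Sum>i\<in>I. fn n i t) (\<lambda>t. \<Sum>i\<in>I. f i t)"
  using assms
proof (induction rule: finite_induct)
  case empty
  show ?case by (simp add: L2_lim_def)
next
  case (insert i I)
  then have "L2_lim (\<lambda>n t. fn n i t + (\<Sum>i\<in>I. fn n i t)) (\<lambda>t. f i t + (\<Sum>i\<in>I. f i t))"
    by (intro L2_lim_add) auto
  with insert show ?case by simp
qed

definition square_integrable :: "(real \<Rightarrow> complex) \<Rightarrow> bool"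
  where "square_integrable f \<longleftrightarrow> f \<in> borel_measurable borel \<and> (\<integral>\<^sup>+t. ennreal ((norm (f t))\<^sup>2) \<partial>lborel) < \<infinity>"

lemma schwartz_square_integrable:
  assumes "schwartz f"
  shows "square_integrable f"
proof -
  obtain C where C: "\<And>t. norm (f t) \<le> C / (1 + t\<^sup>2)"
    using schwartz_bound[OF assms] by blast
  have "(\<integral>\<^sup>+t. ennreal ((norm (f t))\<^sup>2) \<partial>lborel) \<le> (\<integral>\<^sup>+t. ennreal (norm (C\<^sup>2 * (1 / (1 + t\<^sup>2)))) \<partial>lborel)"
  proof (intro nn_integral_mono ennreal_leI)
    fix t
    have "(norm (f t))\<^sup>2 \<le> (C / (1 + t\<^sup>2))\<^sup>2"
      by (intro power_mono C) auto
    also have "\<dots> = (C\<^sup>2 * (1 / (1 + t\<^sup>2))) * (1 / (1 + t\<^sup>2))"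
      by (simp add: power2_eq_square)
    also have "\<dots> \<le> (C\<^sup>2 * (1 / (1 + t\<^sup>2))) * 1"
      by (intro mult_left_mono) (simp_all add: divide_le_eq_1_pos decay_pos)
    finally show "(norm (f t))\<^sup>2 \<le> norm (C\<^sup>2 * (1 / (1 + t\<^sup>2)))" by simp
  qed
  also have "\<dots> < \<infinity>"
    using integrable_mult_right[OF integrable_decay, of "C\<^sup>2"] unfolding integrable_iff_bounded by blast
  finally show ?thesis
    using schwartz_measurable[OF assms] by (simp add: square_integrable_def)
qed

lemma L2_lim_square_integrable:
  assumes "L2_lim fn f" "\<And>n. square_integrable (fn n)"
  shows "square_integrable f"
proof -
  have [measurable]: "fn n \<in> borel_measurable borel" "f \<in> borel_measurable borel" for n
    using assms by (auto simp: L2_lim_def)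
  have "eventually (\<lambda>n. (\<integral>\<^sup>+t. ennreal ((norm (fn n t - f t))\<^sup>2) \<partial>lborel) < 1) sequentially"
    using assms(1) unfolding L2_lim_def by (intro order_tendstoD(2)[of _ 0]) auto
  then obtain n where n: "(\<integral>\<^sup>+t. ennreal ((norm (fn n t - f t))\<^sup>2) \<partial>lborel) < 1"
    using eventually_happens trivial_limit_sequentially by blast
  have "(\<integral>\<^sup>+t. ennreal ((norm (f t))\<^sup>2) \<partial>lborel)
    \<le> (\<integral>\<^sup>+t. 2 * ennreal ((norm (fn n t))\<^sup>2) + 2 * ennreal ((norm (fn n t - f t))\<^sup>2) \<partial>lborel)"
  proof (rule nn_integral_mono)
    fix t
    show "ennreal ((norm (f t))\<^sup>2) \<le> 2 * ennreal ((norm (fn n t))\<^sup>2) + 2 * ennreal ((norm (fn n t - f t))\<^sup>2)"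
      using square_norm_add_le[of "fn n t" "f t - fn n t"] by (simp add: norm_minus_commute)
  qed
  also have "\<dots> = 2 * (\<integral>\<^sup>+t. ennreal ((norm (fn n t))\<^sup>2) \<partial>lborel) + 2 * (\<integral>\<^sup>+t. ennreal ((norm (fn n t - f t))\<^sup>2) \<partial>lborel)"
    by (simp add: nn_integral_add nn_integral_cmult)
  also have "\<dots> < \<infinity>"
    using n assms(2)[of n] by (auto simp: square_integrable_def ennreal_mult_less_top intro: less_trans)
  finally show ?thesis by (simp add: square_integrable_def)
qed

lemma nn_integral_norm_mult_square_le:
  fixes f g :: "real \<Rightarrow> complex"
  assumes [measurable]: "f \<in> borel_measurable borel" "g \<in> borel_measurable borel"
  shows "(\<integral>\<^sup>+t. ennreal (norm (f t * g t)) \<partial>lborel)\<^sup>2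
    \<le> (\<integral>\<^sup>+t. ennreal ((norm (f t))\<^sup>2) \<partial>lborel) * (\<integral>\<^sup>+t. ennreal ((norm (g t))\<^sup>2) \<partial>lborel)"
  using Cauchy_Schwarz_nn_integral[of "\<lambda>t. ennreal (norm (f t))" lborel "\<lambda>t. ennreal (norm (g t))"]
  by (simp add: norm_mult ennreal_mult ennreal_power)

lemma square_integrable_mult:
  assumes "square_integrable f" "square_integrable g"
  shows "integrable lborel (\<lambda>t. f t * g t)"
proof (rule integrableI_bounded)
  have [measurable]: "f \<in> borel_measurable borel" "g \<in> borel_measurable borel"
    using assms by (auto simp: square_integrable_def)
  show "(\<lambda>t. f t * g t) \<in> borel_measurable lborel" by simp
  have "(\<integral>\<^sup>+t. ennreal (norm (f t * g t)) \<partial>lborel)\<^sup>2 < \<infinity>"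
    using assms
    by (intro le_less_trans[OF nn_integral_norm_mult_square_le])
       (auto simp: square_integrable_def ennreal_mult_less_top)
  then show "(\<integral>\<^sup>+t. ennreal (norm (f t * g t)) \<partial>lborel) < \<infinity>"
    by (auto simp: power2_eq_square less_top[symmetric] ennreal_mult_eq_top_iff)
qed

text \<open>A product of two L2 functions is integrable, so its transform is a classical integral at
  every \<open>\<tau>\<close>, and by Cauchy-Schwarz it depends continuously on both
  factors.\<close>

lemma ft_mult_tendsto:
  assumes f: "L2_lim fn f" "\<And>n. square_integrable (fn n)"
    and g: "L2_lim gn g" "\<And>n. square_integrable (gn n)"
  shows "(\<lambda>n. ft (\<lambda>t. fn n t * gn n t) \<tau>) \<longlonglongrightarrow> ft (\<lambda>t. f t * g t) \<tau>"
proof -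
  have [measurable]: "fn n \<in> borel_measurable borel" "f \<in> borel_measurable borel"
    "gn n \<in> borel_measurable borel" "g \<in> borel_measurable borel" for n
    using f g by (auto simp: L2_lim_def)
  have sf: "square_integrable f" and sg: "square_integrable g"
    using f g L2_lim_square_integrable by blast+
  define P where "P f g = (\<integral>\<^sup>+t. ennreal (norm (f t * g t)) \<partial>lborel)" for f g :: "real \<Rightarrow> complex"
  \<comment> \<open>The difference of products is expanded about the limits: each term has a factor
    tending to 0, next to a fixed function or to another such factor.\<close>
  define E where "E n = P (\<lambda>t. fn n t - f t) (\<lambda>t. gn n t - g t) + P (\<lambda>t. fn n t - f t) g + P f (\<lambda>t. gn n t - g t)" for n
  have limf: "(\<lambda>n. \<integral>\<^sup>+t. ennreal ((norm (fn n t - f t))\<^sup>2) \<partial>lborel) \<longlonglongrightarrow> 0"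
    and limg: "(\<lambda>n. \<integral>\<^sup>+t. ennreal ((norm (gn n t - g t))\<^sup>2) \<partial>lborel) \<longlonglongrightarrow> 0"
    using f g by (auto simp: L2_lim_def)
  have "(\<lambda>n. P (\<lambda>t. fn n t - f t) (\<lambda>t. gn n t - g t)) \<longlonglongrightarrow> 0"
    unfolding P_def
    using tendsto_mult_ennreal[OF limf limg]
    by (intro tendsto_0_of_square_le[OF nn_integral_norm_mult_square_le]) auto
  moreover have "(\<lambda>n. P (\<lambda>t. fn n t - f t) g) \<longlonglongrightarrow> 0"
    unfolding P_def
    using tendsto_mult_ennreal[OF limf tendsto_const[of "\<integral>\<^sup>+t. ennreal ((norm (g t))\<^sup>2) \<partial>lborel"]] sg
    by (intro tendsto_0_of_square_le[OF nn_integral_norm_mult_square_le]) (auto simp: square_integrable_def)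
  moreover have "(\<lambda>n. P f (\<lambda>t. gn n t - g t)) \<longlonglongrightarrow> 0"
    unfolding P_def
    using tendsto_mult_ennreal[OF tendsto_const[of "\<integral>\<^sup>+t. ennreal ((norm (f t))\<^sup>2) \<partial>lborel"] limg] sf
    by (intro tendsto_0_of_square_le[OF nn_integral_norm_mult_square_le]) (auto simp: square_integrable_def)
  ultimately have "E \<longlonglongrightarrow> 0 + 0 + 0"
    unfolding E_def by (intro tendsto_add)
  then have E: "E \<longlonglongrightarrow> 0" by simp
  have le: "ennreal (norm (ft (\<lambda>t. fn n t * gn n t) \<tau> - ft (\<lambda>t. f t * g t) \<tau>)) \<le> E n" for n
  proof -
    have int: "integrable lborel (\<lambda>t. fn n t * gn n t)" "integrable lborel (\<lambda>t. f t * g t)"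
      by (intro square_integrable_mult f g sf sg)+
    have "ft (\<lambda>t. fn n t * gn n t) \<tau> - ft (\<lambda>t. f t * g t) \<tau>
      = (\<integral>t. cis (- (t * \<tau>)) * (fn n t * gn n t) - cis (- (t * \<tau>)) * (f t * g t) \<partial>lborel)"
      unfolding ft_def by (intro Bochner_Integration.integral_diff[symmetric] integrable_cis_mult int)
    then have "ennreal (norm (ft (\<lambda>t. fn n t * gn n t) \<tau> - ft (\<lambda>t. f t * g t) \<tau>))
      \<le> (\<integral>\<^sup>+t. ennreal (norm (cis (- (t * \<tau>)) * (fn n t * gn n t) - cis (- (t * \<tau>)) * (f t * g t))) \<partial>lborel)"
      using integral_norm_bound_ennreal[OF Bochner_Integration.integrable_diff[OF integrable_cis_mult[OF int(1)] integrable_cis_mult[OF int(2)]]]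
      by simp
    also have "\<dots> \<le> (\<integral>\<^sup>+t. ennreal (norm ((fn n t - f t) * (gn n t - g t))) + ennreal (norm ((fn n t - f t) * g t))
        + ennreal (norm (f t * (gn n t - g t))) \<partial>lborel)"
    proof (rule nn_integral_mono)
      fix t
      have "norm (cis (- (t * \<tau>)) * (fn n t * gn n t) - cis (- (t * \<tau>)) * (f t * g t)) = norm (fn n t * gn n t - f t * g t)"
        unfolding right_diff_distrib[symmetric] by (simp add: norm_mult)
      also have "fn n t * gn n t - f t * g t = (fn n t - f t) * (gn n t - g t) + (fn n t - f t) * g t + f t * (gn n t - g t)"
        by (simp add: algebra_simps)
      also have "norm \<dots> \<le> norm ((fn n t - f t) * (gn n t - g t)) + norm ((fn n t - f t) * g t) + norm (f t * (gn n t - g t))"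
        by (intro norm_triangle_le add_mono norm_triangle_ineq order_refl)
      finally show "ennreal (norm (cis (- (t * \<tau>)) * (fn n t * gn n t) - cis (- (t * \<tau>)) * (f t * g t)))
        \<le> ennreal (norm ((fn n t - f t) * (gn n t - g t))) + ennreal (norm ((fn n t - f t) * g t))
        + ennreal (norm (f t * (gn n t - g t)))"
        by (simp add: ennreal_leI flip: ennreal_plus)
    qed
    also have "\<dots> = E n"
      by (simp add: E_def P_def nn_integral_add)
    finally show ?thesis .
  qed
  have "(\<lambda>n. ennreal (norm (ft (\<lambda>t. fn n t * gn n t) \<tau> - ft (\<lambda>t. f t * g t) \<tau>))) \<longlonglongrightarrow> 0"
    by (rule tendsto_sandwich[OF _ _ tendsto_const E]; intro always_eventually allI le zero_le)
  then show ?thesis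
    by (simp add: ennreal_tendsto_0_iff tendsto_norm_zero_iff LIM_zero_iff)
qed

text \<open>\<open>X_norm\<close> is an infimum over limits along all approximating sequences; an
  estimate by every pair of finite limits passes to it without comparing those limits.
  Multiplication on \<open>ennreal\<close> is discontinuous at \<open>0 * top\<close>, so the infima
  are approached through values below \<open>top\<close>.\<close>

lemma le_Inf_mult_Inf:
  fixes Z :: ennreal
  assumes A: "x \<in> A" "x < top" and B: "y \<in> B" "y < top"
    and le: "\<And>a b. a \<in> A \<Longrightarrow> a < top \<Longrightarrow> b \<in> B \<Longrightarrow> b < top \<Longrightarrow> Z \<le> ennreal c * a * b"
  shows "Z \<le> ennreal c * Inf A * Inf B"
proof -
  obtain f where f: "\<And>n::nat. f n \<in> A" "f \<longlonglongrightarrow> Inf A"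
    using Inf_as_limit[of A] A by blast
  obtain g where g: "\<And>n::nat. g n \<in> B" "g \<longlonglongrightarrow> Inf B"
    using Inf_as_limit[of B] B by blast
  have fin: "Inf A < top" "Inf B < top"
    using A B Inf_lower le_less_trans by metis+
  have "(\<lambda>n. ennreal c * f n * g n) \<longlonglongrightarrow> ennreal c * \<alpha> * \<beta>"
    if "f \<longlonglongrightarrow> \<alpha>" "g \<longlonglongrightarrow> \<beta>" "\<alpha> < top" "\<beta> < top" for \<alpha> \<beta>
    using that by (intro tendsto_mult_ennreal tendsto_const) (auto simp: ennreal_mult_eq_top_iff)
  from this[OF f(2) g(2) fin] have "(\<lambda>n. ennreal c * f n * g n) \<longlonglongrightarrow> ennreal c * Inf A * Inf B" .
  moreover have "eventually (\<lambda>n. Z \<le> ennreal c * f n * g n) sequentially"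
    using order_tendstoD(2)[OF f(2) fin(1)] order_tendstoD(2)[OF g(2) fin(2)]
    by eventually_elim (intro le f g)
  ultimately show ?thesis
    by (intro tendsto_lowerbound[where F=sequentially]) auto
qed

section \<open>The estimate on the completion\<close>

lemma stfourier_schwartz:
  assumes "schwartz_in_time N \<phi>"
  shows "stfourier N \<phi> \<tau> k = ft (\<lambda>t. dfourier N (\<phi> t) k) \<tau>"
  using assms by (intro stfourier_eq_ft schwartz_integrable) (auto simp: schwartz_in_time_def)

lemma measurable_stfourier_schwartz:
  assumes "schwartz_in_time N \<phi>"
  shows "(\<lambda>\<tau>. stfourier N \<phi> \<tau> k) \<in> borel_measurable borel"
  unfolding stfourier_schwartz[OF assms]
  by (intro measurable_ft schwartz_measurable schwartz_dfourier assms)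

lemma square_bourgain_norm:
  "(bourgain_norm N sg s b u)\<^sup>2 = (\<Sum>k\<in>dfreq N. \<integral>\<^sup>+\<tau>. ennreal
      (jbracket (of_int k) powr (2 * s) * jbracket (\<tau> - sg * dphase N k) powr (2 * b)
        * (cmod (stfourier N u \<tau> k))\<^sup>2) \<partial>lborel)"
  by (simp add: bourgain_norm_def)

text \<open>The squared transform decays like \<open>(1 + \<tau>^2)^(-2)\<close>, while the
  modulation weight grows at most like \<open>1 + \<tau>^2\<close>.\<close>

lemma bourgain_norm_schwartz_finite:
  assumes "schwartz_in_time N \<phi>"
  shows "bourgain_norm N sg s (1/2) \<phi> < top"
proof -
  have "(\<integral>\<^sup>+\<tau>. ennreal (jbracket (of_int k) powr (2 * s) * jbracket (\<tau> - sg * dphase N k) powr (2 * (1/2))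
        * (cmod (stfourier N \<phi> \<tau> k))\<^sup>2) \<partial>lborel) < top" for k
  proof -
    obtain C where C: "\<And>\<tau>. norm (ft (\<lambda>t. dfourier N (\<phi> t) k) \<tau>) \<le> C / (1 + \<tau>\<^sup>2)"
      using ft_schwartz_decay[OF schwartz_dfourier[OF assms]] by blast
    define A where "A = jbracket (of_int k) powr (2 * s)"
    define c where "c = sg * dphase N k"
    define B where "B = A * (2 * jbracket c) * C\<^sup>2"
    have "(\<integral>\<^sup>+\<tau>. ennreal (A * jbracket (\<tau> - c) powr (2 * (1/2)) * (cmod (stfourier N \<phi> \<tau> k))\<^sup>2) \<partial>lborel)
      \<le> (\<integral>\<^sup>+\<tau>. ennreal (norm (B * (1 / (1 + \<tau>\<^sup>2)))) \<partial>lborel)"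
    proof (intro nn_integral_mono ennreal_leI)
      fix \<tau>
      have "jbracket \<tau> * 1 \<le> jbracket \<tau> * jbracket \<tau>"
        by (intro mult_left_mono jbracket_ge_1) auto
      also have "\<dots> = 1 + \<tau>\<^sup>2"
        by (simp add: jbracket_sqrt)
      finally have "jbracket \<tau> \<le> 1 + \<tau>\<^sup>2" by simp
      then have "2 * (jbracket \<tau> * jbracket c) \<le> 2 * ((1 + \<tau>\<^sup>2) * jbracket c)"
        by (intro mult_left_mono mult_right_mono) auto
      moreover have "jbracket (\<tau> - c) \<le> 2 * (jbracket \<tau> * jbracket c)"
        by (rule jbracket_add_le_mult) simp
      ultimately have j: "jbracket (\<tau> - c) \<le> 2 * ((1 + \<tau>\<^sup>2) * jbracket c)"
        by linarith
      have "(cmod (stfourier N \<phi> \<tau> k))\<^sup>2 \<le> (C / (1 + \<tau>\<^sup>2))\<^sup>2"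
        unfolding stfourier_schwartz[OF assms] by (intro power_mono C) auto
      then have "A * jbracket (\<tau> - c) * (cmod (stfourier N \<phi> \<tau> k))\<^sup>2 \<le> A * (2 * ((1 + \<tau>\<^sup>2) * jbracket c)) * (C / (1 + \<tau>\<^sup>2))\<^sup>2"
        using j by (intro mult_mono mult_left_mono) (auto simp: A_def)
      also have "\<dots> = B * (1 / (1 + \<tau>\<^sup>2))"
        using decay_pos[of \<tau>] by (simp add: B_def power2_eq_square[of "C / (1 + \<tau>\<^sup>2)"] power2_eq_square[of C])
      also have "\<dots> \<le> norm (B * (1 / (1 + \<tau>\<^sup>2)))"
        unfolding real_norm_def by (rule abs_ge_self)
      finally show "A * jbracket (\<tau> - c) powr (2 * (1/2)) * (cmod (stfourier N \<phi> \<tau> k))\<^sup>2 \<le> norm (B * (1 / (1 + \<tau>\<^sup>2)))"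
        by simp
    qed
    also have "\<dots> < \<infinity>"
      using integrable_mult_right[OF integrable_decay, of B] unfolding integrable_iff_bounded by blast
    finally show ?thesis by (simp add: A_def c_def)
  qed
  then have "(bourgain_norm N sg s (1/2) \<phi>)\<^sup>2 < top"
    unfolding square_bourgain_norm by (auto simp: less_top[symmetric] ennreal_sum_less_top)
  then show ?thesis
    by (auto simp: power2_eq_square less_top[symmetric] ennreal_mult_eq_top_iff)
qed

lemma stfourier_diff:
  assumes "schwartz_in_time N \<phi>" "schwartz_in_time N \<psi>"
  shows "stfourier N (\<lambda>t x. \<phi> t x - \<psi> t x) \<tau> k = stfourier N \<phi> \<tau> k - stfourier N \<psi> \<tau> k"
proof -
  have int: "integrable lborel (\<lambda>t. cis (- (t * \<tau>)) * (cis (- (x * of_int k)) * u t x))"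
    if "schwartz_in_time N u" "x \<in> dtorus N" for u x
    using that by (intro integrable_cis_mult integrable_mult_right schwartz_integrable) (auto simp: schwartz_in_time_def)
  have "(\<integral>t. cis (- (t * \<tau>)) * cis (- (x * of_int k)) * (\<phi> t x - \<psi> t x) \<partial>lborel)
     = (\<integral>t. cis (- (t * \<tau>)) * cis (- (x * of_int k)) * \<phi> t x \<partial>lborel)
      - (\<integral>t. cis (- (t * \<tau>)) * cis (- (x * of_int k)) * \<psi> t x \<partial>lborel)" if "x \<in> dtorus N" for x
    unfolding right_diff_distrib mult.assoc using assms that
    by (intro Bochner_Integration.integral_diff int)
  then show ?thesis
    unfolding stfourier_def right_diff_distrib[symmetric] sum_subtractf[symmetric] by simp
qed

text \<open>A triangle inequality for squares with constant 2, enough to bound the norms along a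
  Cauchy sequence.\<close>

lemma square_bourgain_norm_le:
  assumes "schwartz_in_time N \<phi>" "schwartz_in_time N \<psi>"
  shows "(bourgain_norm N sg s b \<phi>)\<^sup>2
    \<le> 2 * (bourgain_norm N sg s b (\<lambda>t x. \<phi> t x - \<psi> t x))\<^sup>2 + 2 * (bourgain_norm N sg s b \<psi>)\<^sup>2"
proof -
  note [measurable] = measurable_stfourier_schwartz[OF assms(1)] measurable_stfourier_schwartz[OF assms(2)]
  define w where "w k \<tau> = jbracket (of_int k) powr (2 * s) * jbracket (\<tau> - sg * dphase N k) powr (2 * b)" for k \<tau>
  have w: "0 \<le> w k \<tau>" for k \<tau> by (simp add: w_def)
  have [measurable]: "w k \<in> borel_measurable borel" for k unfolding w_def by measurable
  have "(\<Sum>k\<in>dfreq N. \<integral>\<^sup>+\<tau>. ennreal (w k \<tau> * (cmod (stfourier N \<phi> \<tau> k))\<^sup>2) \<partial>lborel)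
    \<le> (\<Sum>k\<in>dfreq N. \<integral>\<^sup>+\<tau>. 2 * ennreal (w k \<tau> * (cmod (stfourier N \<phi> \<tau> k - stfourier N \<psi> \<tau> k))\<^sup>2)
        + 2 * ennreal (w k \<tau> * (cmod (stfourier N \<psi> \<tau> k))\<^sup>2) \<partial>lborel)"
  proof (intro sum_mono nn_integral_mono)
    fix k \<tau>
    have "ennreal (w k \<tau>) * ennreal ((cmod (stfourier N \<phi> \<tau> k))\<^sup>2)
      \<le> ennreal (w k \<tau>) * (2 * ennreal ((cmod (stfourier N \<phi> \<tau> k - stfourier N \<psi> \<tau> k))\<^sup>2) + 2 * ennreal ((cmod (stfourier N \<psi> \<tau> k))\<^sup>2))"
      using square_norm_add_le[of "stfourier N \<phi> \<tau> k - stfourier N \<psi> \<tau> k" "stfourier N \<psi> \<tau> k"]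
      by (intro mult_left_mono) auto
    then show "ennreal (w k \<tau> * (cmod (stfourier N \<phi> \<tau> k))\<^sup>2)
      \<le> 2 * ennreal (w k \<tau> * (cmod (stfourier N \<phi> \<tau> k - stfourier N \<psi> \<tau> k))\<^sup>2) + 2 * ennreal (w k \<tau> * (cmod (stfourier N \<psi> \<tau> k))\<^sup>2)"
      by (simp add: ennreal_mult' w distrib_left mult.left_commute)
  qed
  also have "\<dots> = 2 * (\<Sum>k\<in>dfreq N. \<integral>\<^sup>+\<tau>. ennreal (w k \<tau> * (cmod (stfourier N \<phi> \<tau> k - stfourier N \<psi> \<tau> k))\<^sup>2) \<partial>lborel)
      + 2 * (\<Sum>k\<in>dfreq N. \<integral>\<^sup>+\<tau>. ennreal (w k \<tau> * (cmod (stfourier N \<psi> \<tau> k))\<^sup>2) \<partial>lborel)"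
    by (simp add: nn_integral_add nn_integral_cmult sum.distrib sum_distrib_left)
  finally show ?thesis
    unfolding square_bourgain_norm stfourier_diff[OF assms] w_def .
qed

lemma X_approx_subseq:
  assumes "X_approx N sg s b \<phi> u" "strict_mono r"
  shows "X_approx N sg s b (\<phi> \<circ> r) u"
proof -
  have "\<exists>M. \<forall>m\<ge>M. \<forall>n\<ge>M. bourgain_norm N sg s b (\<lambda>t x. \<phi> (r m) t x - \<phi> (r n) t x) < ennreal e" if e: "e > 0" for e
  proof -
    obtain M where M: "\<forall>m\<ge>M. \<forall>n\<ge>M. bourgain_norm N sg s b (\<lambda>t x. \<phi> m t x - \<phi> n t x) < ennreal e"
      using assms(1) e unfolding X_approx_def by blast
    have "M \<le> r n" if "M \<le> n" for n
      using seq_suble[OF assms(2), of n] that by linarith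
    with M show ?thesis by blast
  qed
  moreover have "(\<lambda>n. \<integral>\<^sup>+t. ennreal ((cmod (\<phi> (r n) t x - u t x))\<^sup>2) \<partial>lborel) \<longlonglongrightarrow> 0" if "x \<in> dtorus N" for x
  proof -
    have "(\<lambda>n. \<integral>\<^sup>+t. ennreal ((cmod (\<phi> n t x - u t x))\<^sup>2) \<partial>lborel) \<longlonglongrightarrow> 0"
      using assms(1) that by (simp add: X_approx_def)
    from LIMSEQ_subseq_LIMSEQ[OF this assms(2)] show ?thesis
      by (simp add: o_def)
  qed
  ultimately show ?thesis
    using assms(1) by (auto simp: X_approx_def)
qed

text \<open>Existence of the limit of the norms along some sequence only uses that \<^typ>\<open>ennreal\<close> is
  compact; boundedness comes from the Cauchy property.\<close>

lemma X_space_finite_limit: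
  assumes "u \<in> X_space N sg s (1/2)"
  obtains \<phi> L where "X_approx N sg s (1/2) \<phi> u" "(\<lambda>n. bourgain_norm N sg s (1/2) (\<phi> n)) \<longlonglongrightarrow> L" "L < top"
proof -
  let ?B = "bourgain_norm N sg s (1/2)"
  obtain \<phi> where \<phi>: "X_approx N sg s (1/2) \<phi> u"
    using assms unfolding X_space_def by blast
  then have sch: "schwartz_in_time N (\<phi> n)" for n by (simp add: X_approx_def)
  have "0 < (1::real)" by simp
  with \<phi> obtain M where M: "\<forall>m\<ge>M. \<forall>n\<ge>M. ?B (\<lambda>t x. \<phi> m t x - \<phi> n t x) < ennreal 1"
    unfolding X_approx_def by blast
  define R where "R = 2 * 1 + 2 * (?B (\<phi> M))\<^sup>2"
  have "R < top"
    using bourgain_norm_schwartz_finite[OF sch, of sg s M]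
    by (simp add: R_def power2_eq_square ennreal_mult_less_top)
  have bound: "(?B (\<phi> n))\<^sup>2 \<le> R" if "M \<le> n" for n
  proof -
    have "(?B (\<lambda>t x. \<phi> n t x - \<phi> M t x))\<^sup>2 \<le> 1\<^sup>2"
      using M that by (intro power_mono) (auto intro: less_imp_le)
    then have "2 * (?B (\<lambda>t x. \<phi> n t x - \<phi> M t x))\<^sup>2 + 2 * (?B (\<phi> M))\<^sup>2 \<le> R"
      unfolding R_def by (intro add_right_mono mult_left_mono) auto
    with square_bourgain_norm_le[OF sch sch] show ?thesis
      by (rule order_trans)
  qed
  obtain L r where r: "strict_mono r" "((\<lambda>n. ?B (\<phi> n)) \<circ> r) \<longlonglongrightarrow> L"
    using compact_complete_linorder by blast
  have "?B (\<phi> (r n)) \<le> esqrt R" if "M \<le> n" for n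
    using esqrt_mono[OF bound[of "r n"]] seq_suble[OF r(1), of n] that by simp
  then have "L \<le> esqrt R"
    using r(2) by (intro LIMSEQ_le_const2[of "(\<lambda>n. ?B (\<phi> n)) \<circ> r"]) (auto simp: o_def)
  also have "\<dots> < top"
    using \<open>R < top\<close> by (auto simp: esqrt_def)
  finally have "L < top" .
  with that[of "\<phi> \<circ> r" L] X_approx_subseq[OF \<phi> r(1)] r(2) show thesis
    by (simp add: o_def)
qed

lemma X_approx_L2_lim:
  assumes "X_approx N sg s b \<phi> u" "x \<in> dtorus N"
  shows "L2_lim (\<lambda>n t. \<phi> n t x) (\<lambda>t. u t x)"
  using assms schwartz_measurable unfolding X_approx_def L2_lim_def schwartz_in_time_def by auto

lemma X_approx_square_integrable:
  assumes "X_approx N sg s b \<phi> u" "x \<in> dtorus N"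
  shows "square_integrable (\<lambda>t. u t x)"
proof (rule L2_lim_square_integrable[OF X_approx_L2_lim[OF assms]])
  show "square_integrable (\<lambda>t. \<phi> n t x)" for n
    using assms by (intro schwartz_square_integrable) (auto simp: X_approx_def schwartz_in_time_def)
qed

lemma X_approx_L2_lim_dfourier:
  assumes "X_approx N sg s b \<phi> u"
  shows "L2_lim (\<lambda>n t. dfourier N (\<phi> n t) k) (\<lambda>t. dfourier N (u t) k)"
  unfolding dfourier_def
  by (intro L2_lim_cmult L2_lim_sum[where fn="\<lambda>n x t. cis (- (x * of_int k)) * \<phi> n t x"] X_approx_L2_lim[OF assms] finite_dtorus)

lemma X_approx_square_integrable_dfourier:
  assumes "X_approx N sg s b \<phi> u"
  shows "square_integrable (\<lambda>t. dfourier N (\<phi> n t) k)" "square_integrable (\<lambda>t. dfourier N (u t) k)"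
proof -
  show *: "square_integrable (\<lambda>t. dfourier N (\<phi> n t) k)" for n
    using assms by (intro schwartz_square_integrable schwartz_dfourier) (auto simp: X_approx_def)
  show "square_integrable (\<lambda>t. dfourier N (u t) k)"
    by (rule L2_lim_square_integrable[OF X_approx_L2_lim_dfourier[OF assms] *])
qed

text \<open>For mean-zero arguments this is the transform of the differentiated product.
  Approximants may have a mean; removing the zero mode from the formula itself keeps it within the
  bilinear estimate and continuous under L2 limits. \<open>ft\<close> is applied to products because
  an L2 factor may have no classical transform.\<close>

definition mode_product :: "nat \<Rightarrow> (real \<Rightarrow> real \<Rightarrow> complex) \<Rightarrow> (real \<Rightarrow> real \<Rightarrow> complex) \<Rightarrow> int \<Rightarrow> real \<Rightarrow> complex"
  where "mode_product N u v k \<tau> = dnabla_symbol N k * (\<Sum>k1\<in>dfreq N.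
    if k1 = 0 \<or> cyc N (k - k1) = 0 then 0
    else ft (\<lambda>t. dfourier N (u t) k1 * dfourier N (v t) (cyc N (k - k1))) \<tau>)"

lemma mode_product_tendsto:
  assumes "X_approx N sg s b \<phi> u" "X_approx N sg s b \<psi> v"
  shows "(\<lambda>n. mode_product N (\<phi> n) (\<psi> n) k \<tau>) \<longlonglongrightarrow> mode_product N u v k \<tau>"
proof -
  have "(\<lambda>n. ft (\<lambda>t. dfourier N (\<phi> n t) k1 * dfourier N (\<psi> n t) k2) \<tau>)
      \<longlonglongrightarrow> ft (\<lambda>t. dfourier N (u t) k1 * dfourier N (v t) k2) \<tau>" for k1 k2
    by (intro ft_mult_tendsto X_approx_L2_lim_dfourier[OF assms(1)] X_approx_L2_lim_dfourier[OF assms(2)]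
        X_approx_square_integrable_dfourier[OF assms(1)] X_approx_square_integrable_dfourier[OF assms(2)])
  then have "(\<lambda>n. if k1 = 0 \<or> cyc N (k - k1) = 0 then 0
      else ft (\<lambda>t. dfourier N (\<phi> n t) k1 * dfourier N (\<psi> n t) (cyc N (k - k1))) \<tau>)
    \<longlonglongrightarrow> (if k1 = 0 \<or> cyc N (k - k1) = 0 then 0
      else ft (\<lambda>t. dfourier N (u t) k1 * dfourier N (v t) (cyc N (k - k1))) \<tau>)" for k1
    by simp
  then show ?thesis
    unfolding mode_product_def by (intro tendsto_mult tendsto_const tendsto_sum)
qed

lemma measurable_mode_product:
  assumes "\<And>k. (\<lambda>t. dfourier N (u t) k) \<in> borel_measurable borel" "\<And>k. (\<lambda>t. dfourier N (v t) k) \<in> borel_measurable borel"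
  shows "mode_product N u v k \<in> borel_measurable borel"
proof -
  note [measurable] = assms
  have [measurable]: "ft (\<lambda>t. dfourier N (u t) k1 * dfourier N (v t) k2) \<in> borel_measurable borel" for k1 k2
    by (rule measurable_ft) measurable
  show ?thesis unfolding mode_product_def by measurable
qed

lemma integrable_dnabla_mult:
  assumes "\<And>x. x \<in> dtorus N \<Longrightarrow> square_integrable (\<lambda>t. u t x)" "\<And>x. x \<in> dtorus N \<Longrightarrow> square_integrable (\<lambda>t. v t x)"
  shows "integrable lborel (\<lambda>t. dnabla N (\<lambda>x. u t x * v t x) y)"
  unfolding dnabla_def dfourier_def
  by (intro Bochner_Integration.integrable_sum integrable_mult_left integrable_mult_right square_integrable_mult assms)

lemma dfourier_mean_zero:
  assumes "AE t in lborel. (\<Sum>x\<in>dtorus N. u t x) = 0"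
  shows "AE t in lborel. dfourier N (u t) 0 = 0"
  using assms by eventually_elim (simp add: dfourier_def)

lemma stfourier_dnabla_mult:
  assumes N: "0 < N" and k: "k \<in> dfreq N"
    and u: "\<And>x. x \<in> dtorus N \<Longrightarrow> square_integrable (\<lambda>t. u t x)" "\<And>k. square_integrable (\<lambda>t. dfourier N (u t) k)"
      "AE t in lborel. (\<Sum>x\<in>dtorus N. u t x) = 0"
    and v: "\<And>x. x \<in> dtorus N \<Longrightarrow> square_integrable (\<lambda>t. v t x)" "\<And>k. square_integrable (\<lambda>t. dfourier N (v t) k)"
      "AE t in lborel. (\<Sum>x\<in>dtorus N. v t x) = 0"
  shows "stfourier N (\<lambda>t. dnabla N (\<lambda>x. u t x * v t x)) \<tau> k = mode_product N u v k \<tau>"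
proof -
  let ?p = "\<lambda>k1 t. dfourier N (u t) k1 * dfourier N (v t) (cyc N (k - k1))"
  have "stfourier N (\<lambda>t. dnabla N (\<lambda>x. u t x * v t x)) \<tau> k = ft (\<lambda>t. dfourier N (dnabla N (\<lambda>x. u t x * v t x)) k) \<tau>"
    by (intro stfourier_eq_ft integrable_dnabla_mult u v)
  also have "\<dots> = (\<integral>t. dnabla_symbol N k * (\<Sum>k1\<in>dfreq N. cis (- (t * \<tau>)) * ?p k1 t) \<partial>lborel)"
    unfolding ft_def dfourier_dnabla[OF N k] dfourier_mult[OF N] sum_distrib_left[symmetric]
    by (simp only: mult.left_commute)
  also have "\<dots> = dnabla_symbol N k * (\<Sum>k1\<in>dfreq N. ft (?p k1) \<tau>)"
    unfolding ft_def integral_mult_right_zero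
    by (subst Bochner_Integration.integral_sum) (auto intro!: integrable_cis_mult square_integrable_mult u v)
  \<comment> \<open>A vanishing mean kills the coefficient at frequency zero for almost every
    \<open>t\<close>, so the removed interactions are zero.\<close>
  also have "(\<Sum>k1\<in>dfreq N. ft (?p k1) \<tau>) = (\<Sum>k1\<in>dfreq N. if k1 = 0 \<or> cyc N (k - k1) = 0 then 0 else ft (?p k1) \<tau>)"
  proof (intro sum.cong refl)
    fix k1
    have "ft (?p k1) \<tau> = 0" if "k1 = 0 \<or> cyc N (k - k1) = 0"
    proof -
      have "AE t in lborel. cis (- (t * \<tau>)) * ?p k1 t = 0"
        using dfourier_mean_zero[OF u(3)] dfourier_mean_zero[OF v(3)]
        by eventually_elim (use that in auto)
      then show ?thesis unfolding ft_def by (rule integral_eq_zero_AE)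
    qed
    then show "ft (?p k1) \<tau> = (if k1 = 0 \<or> cyc N (k - k1) = 0 then 0 else ft (?p k1) \<tau>)" by simp
  qed
  finally show ?thesis unfolding mode_product_def .
qed

context dispersion
begin

text \<open>Zero at frequency zero, in step with \<open>mode_product\<close> and as the bilinear
  estimates require of their inputs.\<close>

definition mode_norm :: "(real \<Rightarrow> real \<Rightarrow> complex) \<Rightarrow> int \<Rightarrow> real \<Rightarrow> ennreal"
  where "mode_norm \<phi> k \<tau> = (if k = 0 then 0 else ennreal (norm (ft (\<lambda>t. dfourier N (\<phi> t) k) \<tau>)))"

lemma measurable_mode_norm:
  assumes "schwartz_in_time N \<phi>"
  shows "mode_norm \<phi> k \<in> borel_measurable borel"
proof -
  have [measurable]: "ft (\<lambda>t. dfourier N (\<phi> t) k) \<in> borel_measurable borel"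
    by (intro measurable_ft schwartz_measurable schwartz_dfourier assms)
  show ?thesis unfolding mode_norm_def by measurable
qed

lemma mass_mode_norm_le:
  assumes "schwartz_in_time N \<phi>"
  shows "(\<Sum>k\<in>D. \<integral>\<^sup>+\<tau>. (ennreal (jbracket (real_of_int k) powr s) * W (1/2) k \<tau> * mode_norm \<phi> k \<tau>)\<^sup>2 \<partial>lborel)
    \<le> (bourgain_norm N sg s (1/2) \<phi>)\<^sup>2"
  unfolding square_bourgain_norm stfourier_schwartz[OF assms]
proof (intro sum_mono nn_integral_mono)
  fix k \<tau>
  show "(ennreal (jbracket (real_of_int k) powr s) * W (1/2) k \<tau> * mode_norm \<phi> k \<tau>)\<^sup>2
    \<le> ennreal (jbracket (of_int k) powr (2 * s) * jbracket (\<tau> - sg * dphase N k) powr (2 * (1/2))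
        * (cmod (ft (\<lambda>t. dfourier N (\<phi> t) k) \<tau>))\<^sup>2)"
    by (simp add: mode_norm_def modweight_def power_mult_distrib ennreal_power powr_power ac_simps flip: ennreal_mult)
qed

lemma norm_mode_product_le:
  assumes \<phi>: "schwartz_in_time N \<phi>" and \<psi>: "schwartz_in_time N \<psi>"
  shows "ennreal (norm (mode_product N \<phi> \<psi> k \<tau>)) \<le> ennreal \<bar>real_of_int k\<bar> * cyc_conv N (mode_norm \<phi>) (mode_norm \<psi>) k \<tau>"
proof -
  let ?t = "\<lambda>k1. if k1 = 0 \<or> cyc N (k - k1) = 0 then 0
    else ft (\<lambda>t. dfourier N (\<phi> t) k1 * dfourier N (\<psi> t) (cyc N (k - k1))) \<tau>"
  have "norm (mode_product N \<phi> \<psi> k \<tau>) \<le> \<bar>real_of_int k\<bar> * (\<Sum>k1\<in>D. norm (?t k1))"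
    unfolding mode_product_def norm_mult
    by (intro mult_mono norm_dnabla_symbol_le N sum_norm_le order_refl) auto
  then have "ennreal (norm (mode_product N \<phi> \<psi> k \<tau>)) \<le> ennreal (\<bar>real_of_int k\<bar> * (\<Sum>k1\<in>D. norm (?t k1)))"
    by (rule ennreal_leI)
  also have "\<dots> = ennreal \<bar>real_of_int k\<bar> * (\<Sum>k1\<in>D. ennreal (norm (?t k1)))"
    by (subst ennreal_mult) (auto simp: sum_nonneg)
  also have "\<dots> \<le> ennreal \<bar>real_of_int k\<bar> * cyc_conv N (mode_norm \<phi>) (mode_norm \<psi>) k \<tau>"
    unfolding cyc_conv_def
  proof (intro mult_left_mono sum_mono)
    fix k1
    show "ennreal (norm (?t k1)) \<le> (\<integral>\<^sup>+\<tau>1. mode_norm \<phi> k1 \<tau>1 * mode_norm \<psi> (cyc N (k - k1)) (\<tau> - \<tau>1) \<partial>lborel)"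
    proof (cases "k1 = 0 \<or> cyc N (k - k1) = 0")
      case False
      then show ?thesis
        using norm_ft_mult_le[OF schwartz_dfourier[OF \<phi>] schwartz_dfourier[OF \<psi>], of k1 "cyc N (k - k1)" \<tau>]
        by (simp add: mode_norm_def)
    qed auto
  qed auto
  finally show ?thesis .
qed

lemma mode_product_bounds:
  assumes s: "0 \<le> s" and \<phi>: "schwartz_in_time N \<phi>" and \<psi>: "schwartz_in_time N \<psi>"
  defines "R \<equiv> ennreal (bilinear_const s) * ((bourgain_norm N sg s (1/2) \<phi>)\<^sup>2 * (bourgain_norm N sg s (1/2) \<psi>)\<^sup>2)"
  shows "(\<Sum>k\<in>D. \<integral>\<^sup>+\<tau>. ennreal ((jbracket (real_of_int k) powr s * jbracket (\<tau> - sg * dphase N k) powr (-(1/2))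
      * norm (mode_product N \<phi> \<psi> k \<tau>))\<^sup>2) \<partial>lborel) \<le> R" (is "?L2 \<le> R")
    and "(\<Sum>k\<in>D. (\<integral>\<^sup>+\<tau>. ennreal (jbracket (real_of_int k) powr s * jbracket (\<tau> - sg * dphase N k) powr (- 1)
      * norm (mode_product N \<phi> \<psi> k \<tau>)) \<partial>lborel)\<^sup>2) \<le> R" (is "?L1 \<le> R")
proof -
  have pt: "ennreal (jbracket (real_of_int k) powr s * jbracket (\<tau> - sg * dphase N k) powr p * norm (mode_product N \<phi> \<psi> k \<tau>))
      \<le> ennreal (\<bar>real_of_int k\<bar> * jbracket (real_of_int k) powr s) * W p k \<tau> * conv (mode_norm \<phi>) (mode_norm \<psi>) k \<tau>" for p k \<tau>
  proof -
    have "ennreal (jbracket (real_of_int k) powr s * jbracket (\<tau> - sg * dphase N k) powr p * norm (mode_product N \<phi> \<psi> k \<tau>))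
      = ennreal (jbracket (real_of_int k) powr s) * W p k \<tau> * ennreal (norm (mode_product N \<phi> \<psi> k \<tau>))"
      by (simp add: modweight_def ennreal_mult)
    also have "\<dots> \<le> ennreal (jbracket (real_of_int k) powr s) * W p k \<tau> * (ennreal \<bar>real_of_int k\<bar> * conv (mode_norm \<phi>) (mode_norm \<psi>) k \<tau>)"
      by (intro mult_left_mono norm_mode_product_le \<phi> \<psi>) auto
    finally show ?thesis by (simp add: ennreal_mult ac_simps)
  qed
  have z: "mode_norm \<phi> 0 \<tau> = 0" "mode_norm \<psi> 0 \<tau> = 0" for \<tau>
    by (simp_all add: mode_norm_def)
  note bil = bilinear_L2[OF s, where F="mode_norm \<phi>" and G="mode_norm \<psi>", OF measurable_mode_norm[OF \<phi>] measurable_mode_norm[OF \<psi>] z]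
    bilinear_L1[OF s, where F="mode_norm \<phi>" and G="mode_norm \<psi>", OF measurable_mode_norm[OF \<phi>] measurable_mode_norm[OF \<psi>] z]
  have R: "ennreal (bilinear_const s) *
    ((\<Sum>k\<in>D. \<integral>\<^sup>+\<tau>. (ennreal (jbracket (real_of_int k) powr s) * W (1/2) k \<tau> * mode_norm \<phi> k \<tau>)\<^sup>2 \<partial>lborel) *
     (\<Sum>k\<in>D. \<integral>\<^sup>+\<tau>. (ennreal (jbracket (real_of_int k) powr s) * W (1/2) k \<tau> * mode_norm \<psi> k \<tau>)\<^sup>2 \<partial>lborel)) \<le> R"
    unfolding R_def by (intro mult_left_mono mult_mono mass_mode_norm_le \<phi> \<psi>) auto
  have "?L2 \<le> (\<Sum>k\<in>D. \<integral>\<^sup>+\<tau>. (ennreal (\<bar>real_of_int k\<bar> * jbracket (real_of_int k) powr s) * W (-(1/2)) k \<tau> * conv (mode_norm \<phi>) (mode_norm \<psi>) k \<tau>)\<^sup>2 \<partial>lborel)"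
    using pt by (intro sum_mono nn_integral_mono) (simp add: power_mono flip: ennreal_power)
  also note bil(1)
  also note R
  finally show "?L2 \<le> R" .
  have "?L1 \<le> (\<Sum>k\<in>D. (\<integral>\<^sup>+\<tau>. ennreal (\<bar>real_of_int k\<bar> * jbracket (real_of_int k) powr s) * W (- 1) k \<tau> * conv (mode_norm \<phi>) (mode_norm \<psi>) k \<tau> \<partial>lborel)\<^sup>2)"
    by (intro sum_mono power_mono nn_integral_mono pt) auto
  also note bil(2)
  also note R
  finally show "?L1 \<le> R" .
qed

lemma bilinear_const_nonneg: "0 \<le> bilinear_const s"
  using Cp Cz by (simp add: bilinear_const_def)

text \<open>Fatou's lemma carries both halves of the Z norm from the approximants to the pointwise
  limit of \<open>mode_product\<close>; each half is at most \<open>?c\<close>, whence the factor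
  2.\<close>

lemma Z_norm_le:
  assumes s: "0 \<le> s"
    and u: "X_approx N sg s (1/2) \<phi> u" "(\<lambda>n. bourgain_norm N sg s (1/2) (\<phi> n)) \<longlonglongrightarrow> L" "L < top"
      "AE t in lborel. (\<Sum>x\<in>dtorus N. u t x) = 0"
    and v: "X_approx N sg s (1/2) \<psi> v" "(\<lambda>n. bourgain_norm N sg s (1/2) (\<psi> n)) \<longlonglongrightarrow> M" "M < top"
      "AE t in lborel. (\<Sum>x\<in>dtorus N. v t x) = 0"
  shows "Z_norm N sg s (\<lambda>t. dnabla N (\<lambda>x. u t x * v t x)) \<le> ennreal (2 * sqrt (bilinear_const s)) * L * M"
proof -
  let ?U = "\<lambda>t. dnabla N (\<lambda>x. u t x * v t x)"
  let ?c = "ennreal (sqrt (bilinear_const s)) * L * M"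
  let ?R = "\<lambda>n. ennreal (bilinear_const s) * ((bourgain_norm N sg s (1/2) (\<phi> n))\<^sup>2 * (bourgain_norm N sg s (1/2) (\<psi> n))\<^sup>2)"
  have sch: "schwartz_in_time N (\<phi> n)" "schwartz_in_time N (\<psi> n)" for n
    using u(1) v(1) by (simp_all add: X_approx_def)
  have lim: "?R \<longlonglongrightarrow> ?c\<^sup>2"
  proof -
    have "?R \<longlonglongrightarrow> ennreal (bilinear_const s) * ((L * L) * (M * M))"
      unfolding power2_eq_square using u(2,3) v(2,3)
      by (intro tendsto_mult_ennreal tendsto_const) (auto simp: ennreal_mult_eq_top_iff)
    also have "ennreal (bilinear_const s) * ((L * L) * (M * M)) = ?c\<^sup>2"
      using bilinear_const_nonneg
      by (simp add: power_mult_distrib ennreal_power power2_eq_square[of L] power2_eq_square[of M] ac_simps)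
    finally show ?thesis .
  qed
  have eq: "stfourier N ?U \<tau> k = mode_product N u v k \<tau>" if "k \<in> D" for k \<tau>
    using u v that N
    by (intro stfourier_dnabla_mult X_approx_square_integrable X_approx_square_integrable_dfourier)
  have meas [measurable]: "mode_product N (\<phi> n) (\<psi> n) k \<in> borel_measurable borel" "mode_product N u v k \<in> borel_measurable borel" for n k
    using X_approx_square_integrable_dfourier[OF u(1)] X_approx_square_integrable_dfourier[OF v(1)]
    by (auto intro!: measurable_mode_product simp: square_integrable_def)
  have A: "(\<Sum>k\<in>D. \<integral>\<^sup>+\<tau>. ennreal ((jbracket (real_of_int k) powr s * jbracket (\<tau> - sg * dphase N k) powr (-(1/2))
      * norm (mode_product N u v k \<tau>))\<^sup>2) \<partial>lborel) \<le> ?c\<^sup>2"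
  proof (rule Fatou_sum[OF _ _ mode_product_bounds(1)[OF s sch(1) sch(2)] lim])
    show "(\<lambda>n. ennreal ((jbracket (real_of_int k) powr s * jbracket (\<tau> - sg * dphase N k) powr (-(1/2)) * norm (mode_product N (\<phi> n) (\<psi> n) k \<tau>))\<^sup>2))
      \<longlonglongrightarrow> ennreal ((jbracket (real_of_int k) powr s * jbracket (\<tau> - sg * dphase N k) powr (-(1/2)) * norm (mode_product N u v k \<tau>))\<^sup>2)" for k \<tau>
      by (intro tendsto_ennrealI tendsto_power tendsto_mult tendsto_const tendsto_norm mode_product_tendsto[OF u(1) v(1)])
  qed measurable
  have B: "(\<Sum>k\<in>D. (\<integral>\<^sup>+\<tau>. ennreal (jbracket (real_of_int k) powr s * jbracket (\<tau> - sg * dphase N k) powr (- 1)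
      * norm (mode_product N u v k \<tau>)) \<partial>lborel)\<^sup>2) \<le> ?c\<^sup>2"
  proof (rule Fatou_sum_squares[OF _ _ mode_product_bounds(2)[OF s sch(1) sch(2)] lim])
    show "(\<lambda>n. ennreal (jbracket (real_of_int k) powr s * jbracket (\<tau> - sg * dphase N k) powr (- 1) * norm (mode_product N (\<phi> n) (\<psi> n) k \<tau>)))
      \<longlonglongrightarrow> ennreal (jbracket (real_of_int k) powr s * jbracket (\<tau> - sg * dphase N k) powr (- 1) * norm (mode_product N u v k \<tau>))" for k \<tau>
      by (intro tendsto_ennrealI tendsto_mult tendsto_const tendsto_norm mode_product_tendsto[OF u(1) v(1)])
  qed measurable
  have "bourgain_norm N sg s (- 1 / 2) ?U \<le> ?c"
    unfolding bourgain_norm_def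
  proof (rule esqrt_le, rule order_trans[OF _ A], intro sum_mono nn_integral_mono)
    fix k \<tau> assume "k \<in> D"
    then show "ennreal (jbracket (of_int k) powr (2 * s) * jbracket (\<tau> - sg * dphase N k) powr (2 * (- 1 / 2)) * (cmod (stfourier N ?U \<tau> k))\<^sup>2)
      \<le> ennreal ((jbracket (real_of_int k) powr s * jbracket (\<tau> - sg * dphase N k) powr (-(1/2)) * norm (mode_product N u v k \<tau>))\<^sup>2)"
      by (simp add: eq power_mult_distrib powr_power ac_simps)
  qed
  moreover have "esqrt (\<Sum>k\<in>D. (\<integral>\<^sup>+\<tau>. ennreal (cmod (of_real
            (jbracket (of_int k) powr s * jbracket (\<tau> - sg * dphase N k) powr (- 1))
              * stfourier N ?U \<tau> k)) \<partial>lborel)\<^sup>2) \<le> ?c"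
  proof (rule esqrt_le, rule order_trans[OF _ B], intro sum_mono power_mono nn_integral_mono)
    fix k \<tau> assume "k \<in> D"
    then show "ennreal (cmod (of_real (jbracket (of_int k) powr s * jbracket (\<tau> - sg * dphase N k) powr (- 1)) * stfourier N ?U \<tau> k))
      \<le> ennreal (jbracket (real_of_int k) powr s * jbracket (\<tau> - sg * dphase N k) powr (- 1) * norm (mode_product N u v k \<tau>))"
      unfolding norm_mult norm_of_real by (simp add: eq)
  qed auto
  \<comment> \<open>Selects the branch of \<open>Z_norm\<close> that is not
    \<open>top\<close>.\<close>
  moreover have "integrable lborel (\<lambda>t. ?U t x)" for x
    by (intro integrable_dnabla_mult X_approx_square_integrable[OF u(1)] X_approx_square_integrable[OF v(1)])
  ultimately have "Z_norm N sg s ?U \<le> ?c + ?c"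
    unfolding Z_norm_def by (auto intro!: add_mono)
  also have "?c + ?c = ennreal (2 * sqrt (bilinear_const s)) * L * M"
  proof -
    have "ennreal (2 * sqrt (bilinear_const s)) = 2 * ennreal (sqrt (bilinear_const s))"
      using bilinear_const_nonneg[of s] by (simp add: ennreal_mult)
    then show ?thesis
      by (simp only: mult.assoc mult_2 distrib_right)
  qed
  finally show ?thesis .
qed

end

theorem lemma4p7:
  fixes s :: real
  assumes "s \<ge> 0"
  shows "\<exists>C::real. C > 0 \<and> (\<forall>N::nat. 0 < mesh N \<and> mesh N \<le> 1 \<longrightarrow>
    (\<forall>sg\<in>{1, - 1 :: real}. \<forall>u\<in>X_space N sg s (1 / 2). \<forall>v\<in>X_space N sg s (1 / 2).
      (AE t in lborel. (\<Sum>x\<in>dtorus N. u t x) = 0) \<longrightarrow>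
      (AE t in lborel. (\<Sum>x\<in>dtorus N. v t x) = 0) \<longrightarrow>
      Z_norm N sg s (\<lambda>t. dnabla N (\<lambda>x. u t x * v t x))
        \<le> ennreal C * X_norm N sg s (1 / 2) u * X_norm N sg s (1 / 2) v))"
proof -
  obtain Cp where Cp: "0 \<le> Cp" "\<And>N S (m::int \<Rightarrow> int) K A. 0 < N \<Longrightarrow> S \<subseteq> {- int N..int N} \<Longrightarrow> K \<noteq> 0 \<Longrightarrow> \<bar>K\<bar> \<le> int N \<Longrightarrow>
       (\<And>j. j \<in> S \<Longrightarrow> \<bar>m j\<bar> \<le> int N \<and> j + m j \<in> {K, K + 2 * int N, K - 2 * int N}) \<Longrightarrow>
       (\<Sum>j\<in>S. jbracket (A - (dphase N j + dphase N (m j))) powr (-(3/4))) \<le> Cp"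
    using dphase_pair_sum_bounded by blast
  have "1 < (3/2::real)" by simp
  then obtain Cz where Cz: "0 \<le> Cz" "\<And>S::int set. finite S \<Longrightarrow> (\<Sum>j\<in>S. \<bar>real_of_int j\<bar> powr (-(3/2))) \<le> Cz"
    using int_powr_sum_bounded by blast
  define C where "C = 2 * sqrt (dispersion.bilinear_const Cp Cz s)"
  have disp: "dispersion N sg Cp Cz" if "0 < mesh N" "sg \<in> {1, - 1}" for N sg
  proof
    \<comment> \<open>\<open>mesh 0 = pi / 0 = 0\<close>, so a positive mesh excludes
      \<open>N = 0\<close>.\<close>
    show "0 < N" using that(1) by (cases "N = 0") (auto simp: mesh_def)
    then show "(\<Sum>j\<in>S. jbracket (A - (dphase N j + dphase N (m j))) powr (-(3/4))) \<le> Cp"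
      if "S \<subseteq> {- int N..int N}" "K \<noteq> 0" "\<bar>K\<bar> \<le> int N"
        "\<And>j. j \<in> S \<Longrightarrow> \<bar>m j\<bar> \<le> int N \<and> j + m j \<in> {K, K + 2 * int N, K - 2 * int N}" for S m K A
      using that by (rule Cp(2))
  qed (use that Cp Cz in auto)
  \<comment> \<open>\<open>C\<close> is only known to be nonnegative; adding 1 makes the constant
    positive.\<close>
  have "Z_norm N sg s (\<lambda>t. dnabla N (\<lambda>x. u t x * v t x)) \<le> ennreal (C + 1) * X_norm N sg s (1 / 2) u * X_norm N sg s (1 / 2) v"
    if N: "0 < mesh N" and sg: "sg \<in> {1, - 1 :: real}" and u: "u \<in> X_space N sg s (1/2)" and v: "v \<in> X_space N sg s (1/2)"
      and u0: "AE t in lborel. (\<Sum>x\<in>dtorus N. u t x) = 0" and v0: "AE t in lborel. (\<Sum>x\<in>dtorus N. v t x) = 0" for N sg u v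
  proof -
    interpret dispersion N sg Cp Cz using N sg by (rule disp)
    obtain \<phi> L where \<phi>: "X_approx N sg s (1/2) \<phi> u" "(\<lambda>n. bourgain_norm N sg s (1/2) (\<phi> n)) \<longlonglongrightarrow> L" "L < top"
      using X_space_finite_limit[OF u] by blast
    obtain \<psi> M where \<psi>: "X_approx N sg s (1/2) \<psi> v" "(\<lambda>n. bourgain_norm N sg s (1/2) (\<psi> n)) \<longlonglongrightarrow> M" "M < top"
      using X_space_finite_limit[OF v] by blast
    have "Z_norm N sg s (\<lambda>t. dnabla N (\<lambda>x. u t x * v t x)) \<le> ennreal C * X_norm N sg s (1 / 2) u * X_norm N sg s (1 / 2) v"
      unfolding X_norm_def
    proof (rule le_Inf_mult_Inf[where x=L and y=M])
      show "L \<in> {L. \<exists>\<phi>. X_approx N sg s (1/2) \<phi> u \<and> (\<lambda>n. bourgain_norm N sg s (1/2) (\<phi> n)) \<longlonglongrightarrow> L}"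
        "M \<in> {L. \<exists>\<phi>. X_approx N sg s (1/2) \<phi> v \<and> (\<lambda>n. bourgain_norm N sg s (1/2) (\<phi> n)) \<longlonglongrightarrow> L}"
        using \<phi> \<psi> by blast+
      fix a b
      assume "a \<in> {L. \<exists>\<phi>. X_approx N sg s (1/2) \<phi> u \<and> (\<lambda>n. bourgain_norm N sg s (1/2) (\<phi> n)) \<longlonglongrightarrow> L}" "a < top"
        "b \<in> {L. \<exists>\<phi>. X_approx N sg s (1/2) \<phi> v \<and> (\<lambda>n. bourgain_norm N sg s (1/2) (\<phi> n)) \<longlonglongrightarrow> L}" "b < top"
      then show "Z_norm N sg s (\<lambda>t. dnabla N (\<lambda>x. u t x * v t x)) \<le> ennreal C * a * b"
        unfolding C_def using assms u0 v0 by (blast intro: Z_norm_le)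
    qed (use \<phi> \<psi> in auto)
    also have "\<dots> \<le> ennreal (C + 1) * X_norm N sg s (1 / 2) u * X_norm N sg s (1 / 2) v"
      by (intro mult_right_mono ennreal_leI) auto
    finally show ?thesis .
  qed
  moreover have "0 < C + 1"
  proof -
    \<comment> \<open>Any instance of the locale yields \<open>0 \<le> C\<close>.\<close>
    interpret dispersion 1 1 Cp Cz by (rule disp) (auto simp: mesh_def)
    show ?thesis using bilinear_const_nonneg[of s] by (simp add: C_def add_nonneg_pos)
  qed
  ultimately show ?thesis by blast
qed

end
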